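(* Let $0 < k < d \le D$ and let $P \subset V$ be a $d$-dimensional polytope that is $(k-1)$-integral and in $k$-general position with respect to $\mathfrak{e}$. Let $\Lambda_P := \mathrm{aff}(P) \cap \Lambda$, let $\mathrm{lin}(P)$ be the translate of $\mathrm{aff}(P)$ through the origin and $\Lambda_{\mathrm{lin}(P)} := \mathrm{lin}(P)\cap\Lambda$. Then $$\mathrm{Vol}_{\Lambda_{\mathrm{lin}(P)}}(P) = \sum_{\mathbf{y} \in \pi^{(D-k)}(\Lambda_P)} \mathrm{Vol}_{\Lambda^k \cap \Lambda_{\mathrm{lin}(P)}}(\pi_{D-k}(\mathbf{y},P)).$$
   Context: $V$ is a real vector space of dimension $D$, $\Lambda \subset V$ a lattice, and $\mathfrak{e} = (\mathbf{e}^1,\dots,\mathbf{e}^D)$ a fixed basis of $\Lambda$, giving coordinates on $V$. $V_j$ is the span of $\mathbf{e}^1,\dots,\mathbf{e}^j$, $\Lambda_j$ the lattice generated by $\mathbf{e}^1,\dots,\mathbf{e}^j$, and $\Lambda^k$ the lattice generated by $\mathbf{e}^{k+1},\dots,\mathbf{e}^D$. $\pi^{(D-j)}: V \to V_j$ forgets the last $D-j$ coordinates; for $\mathbf{y}\in V_j$ and $S\subset V$, $\pi_{D-j}(\mathbf{y},S) := S\cap(\pi^{(D-j)})^{-1}(\mathbf{y})$. An $\ell$-dimensional affine subspace $U$ is integral if $\pi^{(D-\ell)}(U\cap\Lambda)=\Lambda_\ell$, and in general position if $\pi^{(D-\ell)}(U)=V_\ell$. A polytope is affinely integral (resp. in affinely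 general position) if its affine hull is integral (resp. in general position). A $d$-dimensional polytope is $k$-integral (resp. in $k$-general position) if every face of dimension at most $k$ is affinely integral (resp. in affinely general position). For a sublattice $\Gamma\subset\Lambda$ spanning a subspace $U$ and a polytope $Q$ in a translate of $U$, $\mathrm{Vol}_\Gamma(Q)$ denotes volume w.r.t. the Lebesgue measure on $U$ normalized so a fundamental domain of $\Gamma$ has volume $1$ (sets of lower dimension have volume $0$). *)

theory Defs
  imports "HOL-Analysis.Analysis"
begin

definition lattice_gen :: "(nat \<Rightarrow> 'a::real_vector) \<Rightarrow> nat set \<Rightarrow> 'a set" where
  "lattice_gen b I = range (\<lambda>c :: nat \<Rightarrow> int. \<Sum>i\<in>I. of_int (c i) *\<^sub>R b i)"

(* A lattice of rank r is a set that has some lattice basis b 1, ..., b r; the lattice spans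
   the whole space iff r is the dimension of the space. *)
definition lattice_basis :: "nat \<Rightarrow> (nat \<Rightarrow> 'a::real_vector) \<Rightarrow> 'a set \<Rightarrow> bool" where
  "lattice_basis r b \<Gamma> \<longleftrightarrow>
     inj_on b {1..r} \<and> independent (b ` {1..r}) \<and> \<Gamma> = lattice_gen b {1..r}"

(* The map that forgets the last m coordinates with respect to the basis e 1, ..., e D of the
   whole space, D = DIM('a). Its target is regarded as the span of e 1, ..., e (D - m) inside
   the same space. *)
definition coord_proj :: "(nat \<Rightarrow> 'a::euclidean_space) \<Rightarrow> nat \<Rightarrow> 'a \<Rightarrow> 'a" where
  "coord_proj e m x =
     (\<Sum>i\<in>{1..DIM('a) - m}. representation (e ` {1..DIM('a)}) x (e i) *\<^sub>R e i)"

definition coord_slice :: "(nat \<Rightarrow> 'a::euclidean_space) \<Rightarrow> nat \<Rightarrow> 'a \<Rightarrow> 'a set \<Rightarrow> 'a set" where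
  "coord_slice e m y S = S \<inter> coord_proj e m -` {y}"

(* For the next two notions, aff_dim U = int l with l a natural number excludes U = {},
   whose affine dimension is -1. *)
definition integral_affine :: "'a::euclidean_space set \<Rightarrow> (nat \<Rightarrow> 'a) \<Rightarrow> 'a set \<Rightarrow> bool" where
  "integral_affine \<Lambda> e U \<longleftrightarrow>
     affine U \<and>
     (\<exists>l. aff_dim U = int l \<and> coord_proj e (DIM('a) - l) ` (U \<inter> \<Lambda>) = lattice_gen e {1..l})"

definition general_position_affine :: "(nat \<Rightarrow> 'a::euclidean_space) \<Rightarrow> 'a set \<Rightarrow> bool" where
  "general_position_affine e U \<longleftrightarrow>
     affine U \<and>
     (\<exists>l. aff_dim U = int l \<and> coord_proj e (DIM('a) - l) ` U = span (e ` {1..l}))"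

(* Faces are nonempty faces here: the library's face_of also admits the empty set. *)
definition k_integral ::
    "'a::euclidean_space set \<Rightarrow> (nat \<Rightarrow> 'a) \<Rightarrow> nat \<Rightarrow> 'a set \<Rightarrow> bool" where
  "k_integral \<Lambda> e k P \<longleftrightarrow>
     (\<forall>F. F face_of P \<and> F \<noteq> {} \<and> aff_dim F \<le> int k \<longrightarrow> integral_affine \<Lambda> e (affine hull F))"

definition k_general_position :: "(nat \<Rightarrow> 'a::euclidean_space) \<Rightarrow> nat \<Rightarrow> 'a set \<Rightarrow> bool" where
  "k_general_position e k P \<longleftrightarrow>
     (\<forall>F. F face_of P \<and> F \<noteq> {} \<and> aff_dim F \<le> int k \<longrightarrow>
          general_position_affine e (affine hull F))"

(* The translate of the affine hull through the origin; it exists uniquely for P \<noteq> {}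
   by affine_parallel_subspace. *)
definition lin_hull :: "'a::euclidean_space set \<Rightarrow> 'a set" where
  "lin_hull P = (THE L. subspace L \<and> affine_parallel (affine hull P) L)"

(* For a lattice \<Gamma> and a set Q contained in a translate of span \<Gamma>: the Lebesgue measure of Q in
   the coordinates given by an origin q in Q and a lattice basis b of \<Gamma>. The half-open
   parallelepiped of b is a fundamental domain and corresponds to the unit cube, so it has
   volume 1. The value depends neither on b (two lattice bases differ by a unimodular matrix)
   nor on q (translation invariance). *)
definition lattice_volume :: "'a::euclidean_space set \<Rightarrow> 'a set \<Rightarrow> real" where
  "lattice_volume \<Gamma> Q =
     (if Q = {} then 0
      else
        let r = dim \<Gamma>; b = (SOME b. lattice_basis r b \<Gamma>); q = (SOME q. q \<in> Q)
        in measure (completion (Pi\<^sub>M {1..r} (\<lambda>_. lborel)))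
             {x \<in> extensional {1..r}. q + (\<Sum>i\<in>{1..r}. x i *\<^sub>R b i) \<in> Q})"

end

(* Slicing one coordinate at a time reduces the theorem to the following statement: if Q is a
   polytope of dimension at least 2 whose vertices have integral height and none of whose edges is
   horizontal, then vol(Q) is the sum over all integers n of the volume A(n) of the section at height n.
   (A vertex or edge of a slice of P lies in the relative interior of a face of P; the kernel of the
   projection on the direction space of that face shows that the face has dimension at most j for a
   vertex and exactly j + 1 for an edge of the slice fixing j coordinates. Hence integrality makes the
   vertices lattice points, and general position makes the edges nonhorizontal.)

   For such Q of dimension l there are coefficients c(t), t ranging over the heights of the vertices,
   such that the integral over Q of g(height) equals the sum of c(t) G(t) for every l-fold
   antiderivative G of g; this follows by induction on l from the decomposition of Q into pyramids over
   its facets. If g has period 1 and mean m, then G can be taken to be m x^l / l! plus a function of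
   period 1, and the integral over Q of g(height) is m vol(Q). Applying this to the periodization of the
   continuous function A shows that the periodization is constant. *)
theory Submission
  imports Defs
begin

text \<open>An integral section of a lattice polytope need not be a lattice polytope, and no single
  section determines the volume; only the sum over all heights does. Testing against all functions
  of period 1 at once captures this sum. The vertices enter only through the values of an
  antiderivative at their heights. A function of period 1 has one and the same value at all of them,
  and this value is multiplied by the sum of the coefficients \<open>c(t)\<close>. That sum is zero,
  because adding a constant to \<open>G\<close> does not change \<open>g\<close>. Dimension at least
  2 is essential: a segment from 0 to \<open>n\<close> has length \<open>n\<close> but contains
  \<open>n + 1\<close> integral points. In higher dimension the extreme sections are single vertices
  and have volume 0, which makes \<open>A\<close> continuous. The hypothesis \<open>k < d\<close>
  keeps every slice that is cut within this range. Integrality stops at dimension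
  \<open>k - 1\<close>, so the lattice points of a slice may meet the next coordinate only in
  multiples of some integer. Heights are therefore measured in units of this integer.\<close>

section \<open>Lebesgue measure on flats\<close>

text \<open>The coordinates are indexed by the basis vectors themselves, so that enlarging a basis
  is \<open>insert\<close> on sets. For independent \<open>B\<close> the parallelepiped of
  \<open>B\<close> has volume 1. Functions rather than sets are measured because weights depending
  on the height are needed.\<close>

definition flat_integral :: "'a::euclidean_space set \<Rightarrow> ('a \<Rightarrow> ennreal) \<Rightarrow> 'a \<Rightarrow> ennreal" where
  "flat_integral B f q = (\<integral>\<^sup>+x. f (q + (\<Sum>v\<in>B. x v *\<^sub>R v)) \<partial>Pi\<^sub>M B (\<lambda>_. lborel))"

lemma measurable_combination [measurable]:
  fixes B :: "'a::euclidean_space set"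
  shows "(\<lambda>x. \<Sum>v\<in>B. x v *\<^sub>R v) \<in> borel_measurable (Pi\<^sub>M B (\<lambda>_. lborel))"
  by measurable

lemma flat_integral_measurable [measurable]:
  fixes B :: "'a::euclidean_space set"
  assumes "finite B" and [measurable]: "f \<in> borel_measurable borel"
  shows "flat_integral B f \<in> borel_measurable borel"
proof -
  interpret product_sigma_finite "\<lambda>_::'a. lborel :: real measure" by standard
  interpret sigma_finite_measure "Pi\<^sub>M B (\<lambda>_. lborel :: real measure)"
    by (rule sigma_finite[OF assms(1)])
  show ?thesis unfolding flat_integral_def by measurable
qed

lemma flat_integral_empty [simp]: "flat_integral {} f q = f q"
  unfolding flat_integral_def by (simp add: PiM_empty nn_integral_count_space_finite)

text \<open>Tonelli with one coordinate split off. For a vector transversal to \<open>B\<close> it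
  is integration over parallel sections; used inductively it reduces translation and scaling to the
  real line.\<close>

lemma flat_integral_insert:
  fixes B :: "'a::euclidean_space set"
  assumes "finite B" "v \<notin> B" and [measurable]: "f \<in> borel_measurable borel"
  shows "flat_integral (insert v B) f q = (\<integral>\<^sup>+t. flat_integral B f (q + t *\<^sub>R v) \<partial>lborel)"
proof -
  interpret product_sigma_finite "\<lambda>_::'a. lborel :: real measure" by standard
  have "flat_integral (insert v B) f q =
      (\<integral>\<^sup>+y. (\<integral>\<^sup>+x. f (q + (\<Sum>u\<in>insert v B. (x(v := y)) u *\<^sub>R u)) \<partial>Pi\<^sub>M B (\<lambda>_. lborel)) \<partial>lborel)"
    unfolding flat_integral_def by (rule product_nn_integral_insert_rev[OF assms(1,2)]) measurable
  also have "\<dots> = (\<integral>\<^sup>+y. (\<integral>\<^sup>+x. f (q + (y *\<^sub>R v + (\<Sum>u\<in>B. x u *\<^sub>R u))) \<partial>Pi\<^sub>M B (\<lambda>_. lborel)) \<partial>lborel)"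
  proof (intro nn_integral_cong arg_cong[of _ _ f] arg_cong[of _ _ "(+) q"])
    fix x :: "'a \<Rightarrow> real" and y
    have "(\<Sum>u\<in>B. (x(v := y)) u *\<^sub>R u) = (\<Sum>u\<in>B. x u *\<^sub>R u)"
      using assms(2) by (intro sum.cong) auto
    then show "(\<Sum>u\<in>insert v B. (x(v := y)) u *\<^sub>R u) = y *\<^sub>R v + (\<Sum>u\<in>B. x u *\<^sub>R u)"
      using assms by simp
  qed
  finally show ?thesis by (simp add: flat_integral_def algebra_simps)
qed

lemma combination_in_span: "(\<Sum>v\<in>B. x v *\<^sub>R v) \<in> span B"
  by (intro span_sum span_scale span_base)

lemma flat_integral_cong:
  assumes "\<And>x. x - q \<in> span B \<Longrightarrow> f x = g x"
  shows "flat_integral B f q = flat_integral B g q"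
  unfolding flat_integral_def
  by (intro nn_integral_cong assms) (simp add: combination_in_span)

lemma flat_integral_mono:
  assumes "\<And>x. x - q \<in> span B \<Longrightarrow> f x \<le> g x"
  shows "flat_integral B f q \<le> flat_integral B g q"
  unfolding flat_integral_def
  by (intro nn_integral_mono assms) (simp add: combination_in_span)

lemma flat_integral_cmult:
  assumes [measurable]: "f \<in> borel_measurable borel"
  shows "flat_integral B (\<lambda>x. c * f x) q = c * flat_integral B f q"
  unfolding flat_integral_def by (rule nn_integral_cmult) measurable

lemma flat_integral_sum:
  assumes "\<And>i. i \<in> I \<Longrightarrow> f i \<in> borel_measurable borel"
  shows "flat_integral B (\<lambda>x. \<Sum>i\<in>I. f i x) q = (\<Sum>i\<in>I. flat_integral B (f i) q)"
  unfolding flat_integral_def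
  by (rule nn_integral_sum) (use assms in measurable)

lemma nn_integral_lborel_shift:
  assumes [measurable]: "f \<in> borel_measurable borel"
  shows "(\<integral>\<^sup>+t. f (t + s) \<partial>lborel) = (\<integral>\<^sup>+t. f t \<partial>(lborel :: real measure))"
  using nn_integral_real_affine[of f 1 s] by (simp add: add.commute)

lemma flat_integral_shift_sum:
  fixes B :: "'a::euclidean_space set"
  assumes "finite B" and [measurable]: "f \<in> borel_measurable borel"
  shows "flat_integral B f (q + (\<Sum>v\<in>B. s v *\<^sub>R v)) = flat_integral B f q"
  using assms(1)
proof (induction B arbitrary: q)
  case (insert v B)
  note [measurable] = flat_integral_measurable[OF insert.hyps(1)]
  have "flat_integral (insert v B) f (q + (\<Sum>u\<in>insert v B. s u *\<^sub>R u)) =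
      (\<integral>\<^sup>+t. flat_integral B f ((q + (t + s v) *\<^sub>R v) + (\<Sum>u\<in>B. s u *\<^sub>R u)) \<partial>lborel)"
    using insert.hyps by (subst flat_integral_insert) (auto simp: algebra_simps)
  also have "\<dots> = (\<integral>\<^sup>+t. flat_integral B f (q + (t + s v) *\<^sub>R v) \<partial>lborel)"
    by (simp only: insert.IH)
  also have "\<dots> = (\<integral>\<^sup>+t. flat_integral B f (q + t *\<^sub>R v) \<partial>lborel)"
    by (rule nn_integral_lborel_shift) measurable
  finally show ?case using insert.hyps by (simp add: flat_integral_insert)
qed simp

lemma flat_integral_shift:
  fixes B :: "'a::euclidean_space set"
  assumes "finite B" "f \<in> borel_measurable borel" "q' - q \<in> span B"
  shows "flat_integral B f q' = flat_integral B f q"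
proof -
  obtain s where "q' - q = (\<Sum>v\<in>B. s v *\<^sub>R v)"
    using assms(1,3) by (auto simp: span_finite)
  then have "q' = q + (\<Sum>v\<in>B. s v *\<^sub>R v)" by (simp add: algebra_simps)
  then show ?thesis using flat_integral_shift_sum[OF assms(1,2)] by simp
qed

text \<open>A homothety whose centre \<open>p\<close> may lie outside the flat through
  \<open>q\<close>; each basis direction contributes one factor \<open>s\<close>.\<close>

lemma flat_integral_scale:
  fixes B :: "'a::euclidean_space set"
  assumes "finite B" and [measurable]: "f \<in> borel_measurable borel" and "s > 0"
  shows "flat_integral B f (p + s *\<^sub>R (q - p)) =
         ennreal (s ^ card B) * flat_integral B (\<lambda>y. f (p + s *\<^sub>R (y - p))) q"
  using assms(1)
proof (induction B arbitrary: q)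
  case (insert v B)
  note [measurable] = flat_integral_measurable[OF insert.hyps(1)]
  have "flat_integral (insert v B) f (p + s *\<^sub>R (q - p)) =
      (\<integral>\<^sup>+t. flat_integral B f (p + s *\<^sub>R (q - p) + t *\<^sub>R v) \<partial>lborel)"
    using insert.hyps by (simp add: flat_integral_insert)
  also have "\<dots> = ennreal s * (\<integral>\<^sup>+t. flat_integral B f (p + s *\<^sub>R (q - p) + (s * t) *\<^sub>R v) \<partial>lborel)"
    using \<open>s > 0\<close> by (subst nn_integral_real_affine[where c = s and t = 0]) auto
  also have "\<dots> = ennreal s * (\<integral>\<^sup>+t. flat_integral B f (p + s *\<^sub>R ((q + t *\<^sub>R v) - p)) \<partial>lborel)"
    by (simp add: algebra_simps)
  also have "\<dots> = ennreal s * (\<integral>\<^sup>+t. ennreal (s ^ card B) *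
      flat_integral B (\<lambda>y. f (p + s *\<^sub>R (y - p))) (q + t *\<^sub>R v) \<partial>lborel)"
    by (simp only: insert.IH)
  also have "\<dots> = ennreal s * (ennreal (s ^ card B) * (\<integral>\<^sup>+t.
      flat_integral B (\<lambda>y. f (p + s *\<^sub>R (y - p))) (q + t *\<^sub>R v) \<partial>lborel))"
    by (subst nn_integral_cmult) (auto intro!: measurable_compose[OF _ flat_integral_measurable] insert.hyps)
  also have "(\<integral>\<^sup>+t. flat_integral B (\<lambda>y. f (p + s *\<^sub>R (y - p))) (q + t *\<^sub>R v) \<partial>lborel) =
      flat_integral (insert v B) (\<lambda>y. f (p + s *\<^sub>R (y - p))) q"
    using insert.hyps by (subst flat_integral_insert) auto
  finally show ?case
    using insert.hyps \<open>s > 0\<close> by (simp add: ennreal_mult mult.assoc)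
qed simp

text \<open>A shear: \<open>w\<close> and \<open>a\<close> times \<open>v\<close> differ by a vector
  of \<open>span B\<close>, under which the inner integral is invariant, so only the substitution in
  the outer variable leaves a factor.\<close>

lemma flat_integral_replace:
  fixes B :: "'a::euclidean_space set"
  assumes "finite B" "v \<notin> B" "w \<notin> B" "w - a *\<^sub>R v \<in> span B" "a \<noteq> 0"
    and [measurable]: "f \<in> borel_measurable borel"
  shows "flat_integral (insert v B) f q = ennreal \<bar>a\<bar> * flat_integral (insert w B) f q"
proof -
  note [measurable] = flat_integral_measurable[OF assms(1)]
  have *: "flat_integral B f (q + t *\<^sub>R w) = flat_integral B f (q + (a * t) *\<^sub>R v)" for t
  proof (rule flat_integral_shift)
    have "q + t *\<^sub>R w - (q + (a * t) *\<^sub>R v) = t *\<^sub>R (w - a *\<^sub>R v)" by (simp add: algebra_simps)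
    then show "q + t *\<^sub>R w - (q + (a * t) *\<^sub>R v) \<in> span B" using assms(4) by (simp add: span_scale)
  qed (use assms in auto)
  have "flat_integral (insert v B) f q = (\<integral>\<^sup>+t. flat_integral B f (q + t *\<^sub>R v) \<partial>lborel)"
    using assms by (simp add: flat_integral_insert)
  also have "\<dots> = ennreal \<bar>a\<bar> * (\<integral>\<^sup>+t. flat_integral B f (q + (a * t) *\<^sub>R v) \<partial>lborel)"
    using assms(5) by (subst nn_integral_real_affine[where c = a and t = 0]) auto
  finally show ?thesis using assms by (simp add: flat_integral_insert *)
qed

text \<open>Steinitz exchange, one vector at a time, each swap costing a factor. No determinant is
  computed: it suffices that the constant is independent of \<open>f\<close> and \<open>q\<close>,
  and for two bases of one lattice it is identified as 1 by tiling.\<close>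

lemma flat_integral_change_basis:
  fixes B B' :: "'a::euclidean_space set"
  assumes "independent B" "independent B'" "span B = span B'"
  obtains c where "c > 0"
    "\<And>f q. f \<in> borel_measurable borel \<Longrightarrow> flat_integral B f q = ennreal c * flat_integral B' f q"
proof -
  have "\<exists>c>0. \<forall>f q. f \<in> borel_measurable borel \<longrightarrow> flat_integral B f q = ennreal c * flat_integral B' f q"
    using assms
  proof (induction "card (B' - B)" arbitrary: B rule: less_induct)
    case less
    have fin: "finite B" "finite B'" using less.prems by (auto intro: independent_imp_finite)
    show ?case
    proof (cases "B' \<subseteq> B")
      case True
      then have "B' = B"
        using less.prems by (metis card_subset_eq dim_eq_card fin(1))
      then show ?thesis by (intro exI[of _ 1]) simp
    next
      case False
      then obtain w where w: "w \<in> B'" "w \<notin> B" by auto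
      have "w \<in> span B" using w less.prems by (simp add: span_base)
      then obtain a where a: "w = (\<Sum>v\<in>B. a v *\<^sub>R v)" using fin by (auto simp: span_finite)
      \<comment> \<open>The vector to be swapped out is sought outside \<open>B'\<close>, so that no
        vector already shared is lost and the count of missing ones drops.\<close>
      have "\<exists>v\<in>B - B'. a v \<noteq> 0"
      proof (rule ccontr)
        assume "\<not> (\<exists>v\<in>B - B'. a v \<noteq> 0)"
        then have "w = (\<Sum>v\<in>B \<inter> B'. a v *\<^sub>R v)"
          unfolding a by (intro sum.mono_neutral_right) (use fin in auto)
        then have "w \<in> span (B' - {w})"
          using w(2) by (metis (no_types, lifting) DiffI Int_iff singletonD span_sum span_scale span_base)
        then show False using less.prems(2) w(1) by (auto simp: dependent_def)
      qed
      then obtain v where v: "v \<in> B" "v \<notin> B'" "a v \<noteq> 0" by auto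
      define C where "C = B - {v}"
      have C: "finite C" "v \<notin> C" "B = insert v C" "w \<notin> C" using v w fin by (auto simp: C_def)
      have wa: "w - a v *\<^sub>R v = (\<Sum>u\<in>C. a u *\<^sub>R u)" unfolding a C(3) using C by simp
      have wsp: "w - a v *\<^sub>R v \<in> span C"
        unfolding wa by (rule combination_in_span)
      have vsp: "v \<in> span (insert w C)"
      proof -
        have "v = (1 / a v) *\<^sub>R (w - (w - a v *\<^sub>R v))" using v(3) by simp
        moreover have "w \<in> span (insert w C)" by (simp add: span_base)
        moreover have "w - a v *\<^sub>R v \<in> span (insert w C)"
          using wsp by (meson span_mono subset_insertI subsetD)
        ultimately show ?thesis by (metis span_scale span_diff)
      qed
      have span_eq: "span (insert w C) = span B"
      proof
        show "span (insert w C) \<subseteq> span B"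
          using \<open>w \<in> span B\<close> C(3) by (intro span_minimal) (auto intro: span_base)
        show "span B \<subseteq> span (insert w C)"
          using vsp C(3) by (intro span_minimal) (auto intro: span_base)
      qed
      have "card (insert w C) = card B" using C by simp
      also have "\<dots> = dim (insert w C)"
        using span_eq less.prems(1) by (metis dim_eq_card_independent dim_span)
      finally have ind: "independent (insert w C)"
        using C(1) by (intro card_le_dim_spanning[of _ "insert w C"]) (auto intro: span_base)
      have "B' - insert w C \<subset> B' - B" using v w C(3) by auto
      then have "card (B' - insert w C) < card (B' - B)" using fin by (intro psubset_card_mono) auto
      from less.hyps[OF this ind less.prems(2)] span_eq less.prems(3)
      obtain c where c: "c > 0" "\<And>f q. f \<in> borel_measurable borel \<Longrightarrow>
           flat_integral (insert w C) f q = ennreal c * flat_integral B' f q" by auto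
      have "flat_integral B f q = ennreal (\<bar>a v\<bar> * c) * flat_integral B' f q"
        if "f \<in> borel_measurable borel" for f q
        using flat_integral_replace[OF C(1,2,4) wsp v(3) that] c(2)[OF that] c(1)
        unfolding C(3)[symmetric] by (simp add: ennreal_mult mult.assoc)
      then show ?thesis using c(1) v(3) by (intro exI[of _ "\<bar>a v\<bar> * c"]) auto
    qed
  qed
  then show thesis using that by blast
qed

text \<open>Coordinates with respect to \<open>B\<close> as linear functionals on the whole space,
  hence continuous and measurable everywhere and not only on \<open>span B\<close>.\<close>

lemma dual_functionals:
  fixes B :: "'a::euclidean_space set"
  assumes "independent B"
  obtains h :: "'a \<Rightarrow> 'a \<Rightarrow> real" where "\<And>v. linear (h v)"
    "\<And>c v. v \<in> B \<Longrightarrow> h v (\<Sum>u\<in>B. c u *\<^sub>R u) = c v"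
proof -
  have fin: "finite B" using assms(1) by (rule independent_imp_finite)
  have "\<exists>g :: 'a \<Rightarrow> real. linear g \<and> (\<forall>x\<in>B. g x = (if x = v then 1 else 0))" for v
    using linear_independent_extend[OF assms] .
  then obtain h where h: "\<And>v. linear (h v :: 'a \<Rightarrow> real)" "\<And>v x. x \<in> B \<Longrightarrow> h v x = (if x = v then 1 else 0)"
    by metis
  have "h v (\<Sum>u\<in>B. c u *\<^sub>R u) = c v" if "v \<in> B" for c v
  proof -
    have "h v (\<Sum>u\<in>B. c u *\<^sub>R u) = (\<Sum>u\<in>B. c u * (if u = v then 1 else 0))"
      by (simp add: linear_sum[OF h(1)] linear_cmul[OF h(1)] h(2))
    also have "\<dots> = c v" using fin that by (simp add: if_distrib cong: if_cong)
    finally show ?thesis .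
  qed
  with h(1) show thesis by (rule that)
qed

lemma emeasure_PiM_lborel_box:
  assumes "finite B"
  shows "emeasure (Pi\<^sub>M B (\<lambda>_. lborel)) (Pi\<^sub>E B (\<lambda>_. {a..b::real})) = (\<Prod>v\<in>B. ennreal (if a \<le> b then b - a else 0))"
proof -
  interpret product_sigma_finite "\<lambda>_. lborel :: real measure" by standard
  show ?thesis using assms by (subst emeasure_PiM) (auto intro!: prod.cong)
qed

lemma flat_integral_finite:
  fixes B :: "'a::euclidean_space set"
  assumes "independent B" "bounded S" "\<And>x. f x \<le> ennreal K" "\<And>x. x \<notin> S \<Longrightarrow> f x = 0"
  shows "flat_integral B f q < \<infinity>"
proof -
  have fin: "finite B" using assms(1) by (rule independent_imp_finite)
  obtain h :: "'a \<Rightarrow> 'a \<Rightarrow> real" where h: "\<And>v. linear (h v)"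
      "\<And>c v. v \<in> B \<Longrightarrow> h v (\<Sum>u\<in>B. c u *\<^sub>R u) = c v"
    using dual_functionals[OF assms(1)] by blast
  have "bounded ((\<lambda>x. x - q) ` S)" using assms(2) by (simp add: bounded_translation_minus)
  then have "bounded (h v ` (\<lambda>x. x - q) ` S)" for v
    by (intro bounded_linear_image[of "(\<lambda>x. x - q) ` S"]) (auto simp: linear_linear h(1))
  then have "bounded (\<Union>v\<in>B. h v ` (\<lambda>x. x - q) ` S)" using fin by blast
  then obtain M where M: "\<And>v x. v \<in> B \<Longrightarrow> x \<in> S \<Longrightarrow> \<bar>h v (x - q)\<bar> \<le> M"
    unfolding bounded_iff by (auto simp: image_iff)
  have "flat_integral B f q \<le>
      (\<integral>\<^sup>+x. ennreal K * indicator (Pi\<^sub>E B (\<lambda>_. {-M..M})) x \<partial>Pi\<^sub>M B (\<lambda>_. lborel))"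
    unfolding flat_integral_def
  proof (intro nn_integral_mono)
    fix x :: "'a \<Rightarrow> real" assume x: "x \<in> space (Pi\<^sub>M B (\<lambda>_. lborel))"
    show "f (q + (\<Sum>v\<in>B. x v *\<^sub>R v)) \<le> ennreal K * indicator (Pi\<^sub>E B (\<lambda>_. {-M..M})) x"
    proof (cases "q + (\<Sum>v\<in>B. x v *\<^sub>R v) \<in> S")
      case True
      have "\<bar>x v\<bar> \<le> M" if "v \<in> B" for v
        using M[OF that True] h(2)[OF that] by simp
      then have "x \<in> Pi\<^sub>E B (\<lambda>_. {-M..M})" using x by (auto simp: space_PiM PiE_iff abs_le_iff)
      (metis minus_le_iff)
      then show ?thesis using assms(3) by simp
    qed (simp add: assms(4))
  qed
  also have "\<dots> = ennreal K * emeasure (Pi\<^sub>M B (\<lambda>_. lborel)) (Pi\<^sub>E B (\<lambda>_. {-M..M}))"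
    using fin by (intro nn_integral_cmult_indicator sets_PiM_I_finite) auto
  also have "\<dots> < \<infinity>"
    by (auto simp: emeasure_PiM_lborel_box fin ennreal_mult_less_top power_less_top_ennreal)
  finally show ?thesis .
qed

text \<open>A basis of the directions that \<open>T\<close> shares with \<open>span B\<close> is
  extended to a basis of \<open>span B\<close>; by the dimension bound some vector \<open>v\<close>
  is new. When \<open>v\<close> is integrated last, every parallel flat except the one at
  \<open>t = 0\<close> misses \<open>T\<close>.\<close>

lemma flat_integral_null:
  fixes B :: "'a::euclidean_space set"
  assumes "independent B" "affine T" "aff_dim T < int (card B)"
    and f: "f \<in> borel_measurable borel" "\<And>x. x \<notin> T \<Longrightarrow> f x = 0"
  shows "flat_integral B f q = 0"
proof (cases "\<exists>q'. q' \<in> T \<and> q' - q \<in> span B")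
  case False
  then have "flat_integral B f q = flat_integral B (\<lambda>_. 0) q"
    by (intro flat_integral_cong) (use f(2) in blast)
  then show ?thesis by (simp add: flat_integral_def)
next
  case True
  then obtain q' where q': "q' \<in> T" "q' - q \<in> span B" by auto
  have fin: "finite B" using assms(1) by (rule independent_imp_finite)
  define L where "L = (\<lambda>x. x - q') ` T"
  have L: "subspace L" unfolding L_def using assms(2) q'(1)
    using affine_diffs_subspace_subtract by auto
  have dimL: "int (dim L) = aff_dim T"
    unfolding L_def using aff_dim_dim_affine_diffs[of T q'] assms(2) q'(1) by simp
  define U where "U = L \<inter> span B"
  have U: "subspace U" unfolding U_def using L by (simp add: subspace_inter)
  obtain B0 where B0: "B0 \<subseteq> U" "independent B0" "U \<subseteq> span B0"
    using maximal_independent_subset by metis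
  have "card B0 = dim U" using B0 basis_card_eq_dim by metis
  also have "\<dots> \<le> dim L" unfolding U_def by (rule dim_subset) auto
  finally have cB0: "card B0 < card B" using dimL assms(3) by linarith
  obtain B1 where B1: "B0 \<subseteq> B1" "B1 \<subseteq> span B" "independent B1" "span B \<subseteq> span B1"
    using maximal_independent_subset_extend[of B0 "span B"] B0 unfolding U_def by blast
  have sp: "span B1 = span B" using B1 by (metis span_minimal subspace_span subset_antisym)
  then have "card B1 = card B" using B1(3) assms(1) by (metis dim_eq_card)
  with cB0 have "\<not> B1 \<subseteq> B0" using B1(1) by auto
  then obtain v where v: "v \<in> B1" "v \<notin> B0" by auto
  have fin1: "finite B1" using B1(3) by (rule independent_imp_finite)
  have vsp: "v \<notin> span (B1 - {v})" using B1(3) v(1) by (auto simp: dependent_def)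
  have zero: "flat_integral (B1 - {v}) f (q' + t *\<^sub>R v) = 0" if "t \<noteq> 0" for t
  proof -
    have "f x = 0" if x: "x - (q' + t *\<^sub>R v) \<in> span (B1 - {v})" for x
    proof (rule ccontr)
      assume "f x \<noteq> 0"
      then have "x \<in> T" using f(2) by blast
      then have "x - q' \<in> L" by (auto simp: L_def)
      moreover have "x - q' \<in> span B"
      proof -
        have "x - q' = (x - (q' + t *\<^sub>R v)) + t *\<^sub>R v" by simp
        moreover have "x - (q' + t *\<^sub>R v) \<in> span B1" using x by (meson Diff_subset span_mono subsetD)
        ultimately show ?thesis using v(1) sp by (metis span_add span_scale span_base)
      qed
      ultimately have "x - q' \<in> span B0" using B0 by (auto simp: U_def)
      moreover have "span B0 \<subseteq> span (B1 - {v})" using B1(1) v(2) by (intro span_mono) auto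
      ultimately have "x - q' \<in> span (B1 - {v})" by auto
      then have "(x - q') - (x - (q' + t *\<^sub>R v)) \<in> span (B1 - {v})" using x by (rule span_diff)
      then have "t *\<^sub>R v \<in> span (B1 - {v})" by simp
      then have "(1 / t) *\<^sub>R t *\<^sub>R v \<in> span (B1 - {v})" by (rule span_scale)
      then show False using vsp \<open>t \<noteq> 0\<close> by simp
    qed
    then have "flat_integral (B1 - {v}) f (q' + t *\<^sub>R v) = flat_integral (B1 - {v}) (\<lambda>_. 0) (q' + t *\<^sub>R v)"
      by (intro flat_integral_cong) auto
    then show ?thesis by (simp add: flat_integral_def)
  qed
  have "flat_integral B1 f q' = flat_integral (insert v (B1 - {v})) f q'" using v(1) by (simp add: insert_absorb)
  also have "\<dots> = (\<integral>\<^sup>+t. flat_integral (B1 - {v}) f (q' + t *\<^sub>R v) \<partial>lborel)"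
    using fin1 f(1) by (intro flat_integral_insert) auto
  also have "\<dots> = (\<integral>\<^sup>+t. 0 \<partial>(lborel :: real measure))"
    by (intro nn_integral_cong_AE eventually_mono[OF AE_lborel_singleton[of 0]]) (use zero in auto)
  finally have z: "flat_integral B1 f q' = 0" by simp
  obtain c where "flat_integral B f q' = ennreal c * flat_integral B1 f q'"
    using flat_integral_change_basis[OF assms(1) B1(3) sp[symmetric]] f(1) by metis
  then have "flat_integral B f q' = 0" using z by simp
  then show ?thesis using flat_integral_shift[OF fin f(1) q'(2)] by simp
qed

text \<open>The bridge between the index set \<open>{1..r}\<close> of \<open>lattice_volume\<close>
  and indexing by basis vectors.\<close>

lemma flat_integral_reindex:
  fixes b :: "'i \<Rightarrow> 'a::euclidean_space"
  assumes "finite I" "inj_on b I" and [measurable]: "f \<in> borel_measurable borel"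
  shows "(\<integral>\<^sup>+x. f (q + (\<Sum>i\<in>I. x i *\<^sub>R b i)) \<partial>Pi\<^sub>M I (\<lambda>_. lborel)) = flat_integral (b ` I) f q"
  using assms(1,2)
proof (induction I arbitrary: q)
  case empty
  show ?case by (simp add: PiM_empty nn_integral_count_space_finite)
next
  case (insert i I)
  interpret product_sigma_finite "\<lambda>_::'i. lborel :: real measure" by standard
  have "(\<integral>\<^sup>+x. f (q + (\<Sum>j\<in>insert i I. x j *\<^sub>R b j)) \<partial>Pi\<^sub>M (insert i I) (\<lambda>_. lborel)) =
     (\<integral>\<^sup>+y. (\<integral>\<^sup>+x. f (q + (\<Sum>j\<in>insert i I. (x(i := y)) j *\<^sub>R b j)) \<partial>Pi\<^sub>M I (\<lambda>_. lborel)) \<partial>lborel)"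
    by (rule product_nn_integral_insert_rev[OF insert.hyps(1,2)]) measurable
  also have "\<dots> = (\<integral>\<^sup>+y. (\<integral>\<^sup>+x. f ((q + y *\<^sub>R b i) + (\<Sum>j\<in>I. x j *\<^sub>R b j)) \<partial>Pi\<^sub>M I (\<lambda>_. lborel)) \<partial>lborel)"
  proof (intro nn_integral_cong arg_cong[of _ _ f])
    fix x :: "'i \<Rightarrow> real" and y
    have "(\<Sum>j\<in>I. (x(i := y)) j *\<^sub>R b j) = (\<Sum>j\<in>I. x j *\<^sub>R b j)"
      using insert.hyps(2) by (intro sum.cong) auto
    then show "q + (\<Sum>j\<in>insert i I. (x(i := y)) j *\<^sub>R b j) = q + y *\<^sub>R b i + (\<Sum>j\<in>I. x j *\<^sub>R b j)"
      using insert.hyps by simp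
  qed
  also have "\<dots> = (\<integral>\<^sup>+y. flat_integral (b ` I) f (q + y *\<^sub>R b i) \<partial>lborel)"
    using insert by simp
  also have "\<dots> = flat_integral (b ` insert i I) f q"
    using insert by (subst image_insert, subst flat_integral_insert) auto
  finally show ?case .
qed

section \<open>Lattice bases as sets, and the independence of the volume from the basis\<close>

definition int_basis :: "'a::euclidean_space set \<Rightarrow> 'a set \<Rightarrow> bool" where
  "int_basis B \<Gamma> \<longleftrightarrow> independent B \<and> \<Gamma> = range (\<lambda>c :: 'a \<Rightarrow> int. \<Sum>v\<in>B. of_int (c v) *\<^sub>R v)"

lemma int_basis_memI: "int_basis B \<Gamma> \<Longrightarrow> x = (\<Sum>v\<in>B. of_int (c v) *\<^sub>R v) \<Longrightarrow> x \<in> \<Gamma>"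
  by (auto simp: int_basis_def)

lemma int_basis_memE:
  assumes "int_basis B \<Gamma>" "x \<in> \<Gamma>"
  obtains c where "x = (\<Sum>v\<in>B. of_int (c v) *\<^sub>R v)"
  using assms by (auto simp: int_basis_def)

lemma lattice_basis_imp_int_basis:
  assumes "lattice_basis r b \<Gamma>"
  shows "int_basis (b ` {1..r}) \<Gamma>"
proof -
  have inj: "inj_on b {1..r}" using assms by (simp add: lattice_basis_def)
  have "lattice_gen b {1..r} = range (\<lambda>c :: 'a \<Rightarrow> int. \<Sum>v\<in>b ` {1..r}. of_int (c v) *\<^sub>R v)"
    unfolding lattice_gen_def
  proof (intro equalityI image_subsetI)
    fix c :: "nat \<Rightarrow> int"
    have "(\<Sum>i\<in>{1..r}. of_int (c i) *\<^sub>R b i) = (\<Sum>v\<in>b ` {1..r}. of_int (c (inv_into {1..r} b v)) *\<^sub>R v)"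
      using inj by (simp add: sum.reindex)
    then show "(\<Sum>i\<in>{1..r}. of_int (c i) *\<^sub>R b i) \<in> range (\<lambda>c :: 'a \<Rightarrow> int. \<Sum>v\<in>b ` {1..r}. of_int (c v) *\<^sub>R v)"
      by (rule image_eqI[of _ _ "\<lambda>v. c (inv_into {1..r} b v)"]) simp
  next
    fix c :: "'a \<Rightarrow> int"
    show "(\<Sum>v\<in>b ` {1..r}. of_int (c v) *\<^sub>R v) \<in> range (\<lambda>c :: nat \<Rightarrow> int. \<Sum>i\<in>{1..r}. of_int (c i) *\<^sub>R b i)"
      using inj by (auto simp: sum.reindex intro!: image_eqI[of _ _ "\<lambda>i. c (b i)"])
  qed
  then show ?thesis using assms by (simp add: int_basis_def lattice_basis_def)
qed

lemma int_basis_imp_lattice_basis: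
  assumes "int_basis B \<Gamma>"
  obtains b where "lattice_basis (card B) b \<Gamma>" "b ` {1..card B} = B"
proof -
  have "finite B" using assms by (auto simp: int_basis_def intro: independent_imp_finite)
  then obtain b where b: "bij_betw b {1..card B} B"
    using finite_same_card_bij[of "{1..card B}" B] by auto
  then have inj: "inj_on b {1..card B}" and im: "b ` {1..card B} = B" by (auto simp: bij_betw_def)
  have "int_basis B (lattice_gen b {1..card B})"
    using lattice_basis_imp_int_basis[of "card B" b "lattice_gen b {1..card B}"] inj im assms
    by (auto simp: lattice_basis_def int_basis_def)
  then have "lattice_basis (card B) b \<Gamma>"
    using assms inj im by (simp add: lattice_basis_def int_basis_def)
  then show thesis using im that by blast
qed

lemma int_basis_subset:
  assumes "int_basis B \<Gamma>" shows "B \<subseteq> \<Gamma>"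
proof
  fix v assume v: "v \<in> B"
  have "finite B" using assms by (auto simp: int_basis_def intro: independent_imp_finite)
  then have "v = (\<Sum>u\<in>B. of_int (if u = v then 1 else 0) *\<^sub>R u)"
    using v by (simp add: if_distrib[of of_int] if_distrib[of "\<lambda>x. x *\<^sub>R _"] cong: if_cong)
  then show "v \<in> \<Gamma>" by (rule int_basis_memI[OF assms])
qed

lemma int_basis_span:
  assumes "int_basis B \<Gamma>" shows "span \<Gamma> = span B"
proof
  show "span \<Gamma> \<subseteq> span B"
    using assms by (intro span_minimal) (auto simp: int_basis_def intro!: combination_in_span)
  show "span B \<subseteq> span \<Gamma>" by (intro span_mono int_basis_subset assms)
qed

lemma int_basis_dim: "int_basis B \<Gamma> \<Longrightarrow> dim \<Gamma> = card B"
  using int_basis_span by (metis dim_span dim_eq_card int_basis_def)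

lemma int_basis_countable:
  assumes "int_basis B \<Gamma>" shows "countable \<Gamma>"
proof -
  have fin: "finite B" using assms by (auto simp: int_basis_def intro: independent_imp_finite)
  have "\<Gamma> \<subseteq> (\<lambda>c :: 'a \<Rightarrow> int. \<Sum>v\<in>B. of_int (c v) *\<^sub>R v) ` (Pi\<^sub>E B (\<lambda>_. UNIV))"
  proof
    fix x assume "x \<in> \<Gamma>"
    then obtain c :: "'a \<Rightarrow> int" where "x = (\<Sum>v\<in>B. of_int (c v) *\<^sub>R v)"
      using assms by (auto simp: int_basis_def)
    then have "x = (\<Sum>v\<in>B. of_int (restrict c B v) *\<^sub>R v)" by simp
    moreover have "restrict c B \<in> Pi\<^sub>E B (\<lambda>_. UNIV)" by simp
    ultimately show "x \<in> (\<lambda>c :: 'a \<Rightarrow> int. \<Sum>v\<in>B. of_int (c v) *\<^sub>R v) ` (Pi\<^sub>E B (\<lambda>_. UNIV))"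
      by (rule image_eqI)
  qed
  moreover have "countable ((\<lambda>c :: 'a \<Rightarrow> int. \<Sum>v\<in>B. of_int (c v) *\<^sub>R v) ` (Pi\<^sub>E B (\<lambda>_. UNIV)))"
    using fin by (intro countable_image countable_PiE) auto
  ultimately show ?thesis by (blast intro: countable_subset)
qed

lemma int_basis_uminus: "int_basis B \<Gamma> \<Longrightarrow> x \<in> \<Gamma> \<Longrightarrow> - x \<in> \<Gamma>"
proof -
  assume B: "int_basis B \<Gamma>" and "x \<in> \<Gamma>"
  then obtain c :: "'a \<Rightarrow> int" where "x = (\<Sum>v\<in>B. of_int (c v) *\<^sub>R v)"
    by (auto simp: int_basis_def)
  then have "- x = (\<Sum>v\<in>B. of_int (- c v) *\<^sub>R v)" by (simp add: sum_negf)
  then show "- x \<in> \<Gamma>" by (rule int_basis_memI[OF B])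
qed

text \<open>The cell is the half-open parallelepiped of \<open>B\<close>; the floors of the
  coordinates give the unique lattice vector that moves a point into it.\<close>

lemma int_basis_cell:
  fixes B :: "'a::euclidean_space set"
  assumes "int_basis B \<Gamma>"
  obtains C where "C \<in> sets borel" "flat_integral B (indicator C) 0 = 1" "C \<subseteq> span B"
    "\<And>x. x \<in> span B \<Longrightarrow> \<exists>!z. z \<in> \<Gamma> \<and> x - z \<in> C"
proof -
  have ind: "independent B" using assms by (simp add: int_basis_def)
  have fin: "finite B" using ind by (rule independent_imp_finite)
  obtain h :: "'a \<Rightarrow> 'a \<Rightarrow> real" where h: "\<And>v. linear (h v)"
      "\<And>c v. v \<in> B \<Longrightarrow> h v (\<Sum>u\<in>B. c u *\<^sub>R u) = c v"
    using dual_functionals[OF ind] by blast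
  have hx: "x = (\<Sum>u\<in>B. h u x *\<^sub>R u)" if x: "x \<in> span B" for x
  proof -
    obtain c where c: "x = (\<Sum>u\<in>B. c u *\<^sub>R u)" using x fin by (auto simp: span_finite)
    show ?thesis using h(2)[of _ c] unfolding c[symmetric] using c by simp
  qed
  define C where "C = span B \<inter> {x. \<forall>v\<in>B. h v x \<in> {0..<1}}"
  have [measurable]: "h v \<in> borel_measurable borel" for v
    using h(1) by (simp add: borel_measurable_continuous_onI linear_continuous_on linear_linear)
  show thesis
  proof (rule that[of C])
    have "{x \<in> space borel. \<forall>v\<in>B. h v x \<in> {0..<1}} \<in> sets borel" using fin by measurable
    then have "{x. \<forall>v\<in>B. h v x \<in> {0..<1}} \<in> sets borel" by simp
    then show "C \<in> sets borel" unfolding C_def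
      by (intro sets.Int) (auto intro: borel_closed closed_subspace)
    have "flat_integral B (indicator C) 0 =
       (\<integral>\<^sup>+x. indicator (Pi\<^sub>E B (\<lambda>_. {0..<1::real})) x \<partial>Pi\<^sub>M B (\<lambda>_. lborel))"
      unfolding flat_integral_def
    proof (intro nn_integral_cong)
      fix x :: "'a \<Rightarrow> real" assume x: "x \<in> space (Pi\<^sub>M B (\<lambda>_. lborel))"
      have "0 + (\<Sum>v\<in>B. x v *\<^sub>R v) \<in> C \<longleftrightarrow> x \<in> Pi\<^sub>E B (\<lambda>_. {0..<1::real})"
        using x h(2) by (auto simp: C_def combination_in_span space_PiM PiE_iff)
      then show "indicator C (0 + (\<Sum>v\<in>B. x v *\<^sub>R v)) = (indicator (Pi\<^sub>E B (\<lambda>_. {0..<1::real})) x :: ennreal)"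
        by (simp add: indicator_def)
    qed
    also have "\<dots> = emeasure (Pi\<^sub>M B (\<lambda>_. lborel)) (Pi\<^sub>E B (\<lambda>_. {0..<1::real}))"
      using fin by (intro nn_integral_indicator sets_PiM_I_finite) auto
    also have "\<dots> = 1"
    proof -
      interpret product_sigma_finite "\<lambda>_::'a. lborel :: real measure" by standard
      show ?thesis using fin by (subst emeasure_PiM) auto
    qed
    finally show "flat_integral B (indicator C) 0 = 1" .
    show "C \<subseteq> span B" by (auto simp: C_def)
    show "\<exists>!z. z \<in> \<Gamma> \<and> x - z \<in> C" if x: "x \<in> span B" for x
    proof
      let ?z = "\<Sum>v\<in>B. of_int \<lfloor>h v x\<rfloor> *\<^sub>R v"
      have 1: "?z \<in> \<Gamma>" using assms by (auto simp: int_basis_def intro!: image_eqI[of _ _ "\<lambda>v. \<lfloor>h v x\<rfloor>"])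
      have 2: "h v (x - ?z) = h v x - of_int \<lfloor>h v x\<rfloor>" if "v \<in> B" for v
        using h(2)[OF that] by (simp add: linear_diff[OF h(1)])
      show "?z \<in> \<Gamma> \<and> x - ?z \<in> C"
        using 1 2 x by (auto simp: C_def intro!: span_diff combination_in_span) linarith+
      fix z assume z: "z \<in> \<Gamma> \<and> x - z \<in> C"
      then obtain c :: "'a \<Rightarrow> int" where c: "z = (\<Sum>v\<in>B. of_int (c v) *\<^sub>R v)"
        using assms by (auto simp: int_basis_def)
      have "c v = \<lfloor>h v x\<rfloor>" if v: "v \<in> B" for v
      proof -
        have "h v (x - z) = h v x - c v" using h(2)[OF v] by (simp add: c linear_diff[OF h(1)])
        moreover have "0 \<le> h v (x - z)" "h v (x - z) < 1" using z v by (auto simp: C_def)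
        ultimately show ?thesis by (intro floor_unique[symmetric]) auto
      qed
      then show "z = ?z" using c by simp
    qed
  qed
qed

lemma nn_integral_count_space_unique:
  assumes "\<exists>!z. z \<in> A \<and> P z"
  shows "(\<integral>\<^sup>+z. of_bool (P z) \<partial>count_space A) = (1::ennreal)"
proof -
  obtain z where z: "z \<in> A" "P z" "\<And>y. y \<in> A \<Longrightarrow> P y \<Longrightarrow> y = z" using assms by (elim ex1E) blast
  have "(\<integral>\<^sup>+z. of_bool (P z) \<partial>count_space A) = (\<integral>\<^sup>+y. indicator {z} y \<partial>count_space A)"
  proof (intro nn_integral_cong)
    fix y assume "y \<in> space (count_space A)"
    then have "P y \<longleftrightarrow> y = z" using z by (metis space_count_space)
    then show "of_bool (P y) = (indicator {z} y :: ennreal)" by (simp add: indicator_def)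
  qed
  also have "\<dots> = emeasure (count_space A) {z}" using z(1) by (intro nn_integral_indicator) auto
  also have "\<dots> = 1" using z(1) by simp
  finally show ?thesis .
qed

text \<open>The translates of the cell of one basis tile the span; cutting the cell of the other
  basis along this tiling and translating the pieces back shows that both cells have the same volume.\<close>

lemma flat_integral_int_basis_unique:
  fixes B B' :: "'a::euclidean_space set"
  assumes B: "int_basis B \<Gamma>" and B': "int_basis B' \<Gamma>" and f: "f \<in> borel_measurable borel"
  shows "flat_integral B f q = flat_integral B' f q"
proof -
  have ind: "independent B" "independent B'" using assms by (auto simp: int_basis_def)
  have fin: "finite B" using ind(1) by (rule independent_imp_finite)
  have sp: "span B = span B'" using B B' by (metis int_basis_span)
  obtain c where c: "c > 0" "\<And>f q. f \<in> borel_measurable borel \<Longrightarrow>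
      flat_integral B f q = ennreal c * flat_integral B' f q"
    using flat_integral_change_basis[OF ind sp] by blast
  obtain C where C[measurable]: "C \<in> sets borel" and C1: "flat_integral B (indicator C) 0 = 1"
      "C \<subseteq> span B" "\<And>x. x \<in> span B \<Longrightarrow> \<exists>!z. z \<in> \<Gamma> \<and> x - z \<in> C"
    using int_basis_cell[OF B] by blast
  obtain C' where C'[measurable]: "C' \<in> sets borel" and C'1: "flat_integral B' (indicator C') 0 = 1"
      "C' \<subseteq> span B'" "\<And>x. x \<in> span B' \<Longrightarrow> \<exists>!z. z \<in> \<Gamma> \<and> x - z \<in> C'"
    using int_basis_cell[OF B'] by blast
  let ?G = "count_space \<Gamma>"
  have cnt: "countable \<Gamma>" using B by (rule int_basis_countable)
  have "flat_integral B (indicator C') 0 =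
      flat_integral B (\<lambda>x. \<integral>\<^sup>+z. indicator C' x * indicator C (x - z) \<partial>?G) 0"
  proof (rule flat_integral_cong)
    fix x :: 'a assume "x - 0 \<in> span B"
    then have "(\<integral>\<^sup>+z. of_bool (x - z \<in> C) \<partial>?G) = (1::ennreal)"
      using C1(3) by (intro nn_integral_count_space_unique) auto
    then have "(\<integral>\<^sup>+z. indicator C (x - z) \<partial>?G) = (1::ennreal)" by (simp add: indicator_def)
    then show "(indicator C' x :: ennreal) = (\<integral>\<^sup>+z. indicator C' x * indicator C (x - z) \<partial>?G)"
      by (subst nn_integral_cmult) auto
  qed
  also have "\<dots> = (\<integral>\<^sup>+z. flat_integral B (\<lambda>x. indicator C' x * indicator C (x - z)) 0 \<partial>?G)"
    unfolding flat_integral_def by (rule nn_integral_count_space_nn_integral[OF cnt]) measurable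
  also have "\<dots> = (\<integral>\<^sup>+z. flat_integral B (\<lambda>x. indicator C' (x + z) * indicator C x) 0 \<partial>?G)"
  proof (rule nn_integral_cong)
    fix z assume "z \<in> space ?G"
    then have "z \<in> span B" using int_basis_span[OF B] by (auto intro: span_base)
    then have "flat_integral B (\<lambda>x. indicator C' x * indicator C (x - z)) 0 =
        flat_integral B (\<lambda>x. indicator C' x * indicator C (x - z)) z"
      using fin by (intro flat_integral_shift[symmetric]) auto
    then show "flat_integral B (\<lambda>x. indicator C' x * indicator C (x - z)) 0 =
        flat_integral B (\<lambda>x. indicator C' (x + z) * indicator C x) 0"
      by (simp add: flat_integral_def algebra_simps)
  qed
  also have "\<dots> = flat_integral B (\<lambda>x. \<integral>\<^sup>+z. indicator C' (x + z) * indicator C x \<partial>?G) 0"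
    unfolding flat_integral_def by (rule nn_integral_count_space_nn_integral[OF cnt, symmetric]) measurable
  also have "\<dots> = flat_integral B (indicator C) 0"
  proof (rule flat_integral_cong)
    fix x :: 'a assume "x - 0 \<in> span B"
    then have "\<exists>!z. z \<in> \<Gamma> \<and> x - z \<in> C'" using C'1(3) sp by simp
    then obtain z where z: "z \<in> \<Gamma>" "x - z \<in> C'" "\<And>y. y \<in> \<Gamma> \<Longrightarrow> x - y \<in> C' \<Longrightarrow> y = z"
      by (elim ex1E) blast
    have "(\<integral>\<^sup>+z. of_bool (x + z \<in> C') \<partial>?G) = (1::ennreal)"
    proof (rule nn_integral_count_space_unique, rule ex1I[of _ "- z"])
      fix y assume "y \<in> \<Gamma> \<and> x + y \<in> C'"
      then have "- y = z" using z(3)[of "- y"] int_basis_uminus[OF B] by simp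
      then show "y = - z" by auto
    qed (use z(1,2) int_basis_uminus[OF B] in simp)
    then have "(\<integral>\<^sup>+z. indicator C' (x + z) \<partial>?G) = (1::ennreal)" by (simp add: indicator_def)
    then show "(\<integral>\<^sup>+z. indicator C' (x + z) * indicator C x \<partial>?G) = (indicator C x :: ennreal)"
      by (subst nn_integral_multc) auto
  qed
  finally have "flat_integral B (indicator C') 0 = 1" using C1(1) by simp
  then have "ennreal c = 1" using c(2)[of "indicator C'" 0] C'1(1) by simp
  then show ?thesis using c(2)[OF f] by simp
qed

text \<open>Removes the choices from \<open>lattice_volume\<close>: a closed \<open>Q\<close> pulls
  back to a measurable set, on which the completion agrees with the product measure, and neither the
  chosen basis nor the chosen origin affects the value.\<close>

lemma lattice_volume_eq:
  fixes Q :: "'a::euclidean_space set"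
  assumes B: "int_basis B \<Gamma>" and "closed Q" "\<And>x. x \<in> Q \<Longrightarrow> x - q \<in> span B"
  shows "lattice_volume \<Gamma> Q = enn2real (flat_integral B (indicator Q) q)"
proof (cases "Q = {}")
  case True
  then show ?thesis by (simp add: lattice_volume_def flat_integral_def)
next
  case False
  define r where "r = dim \<Gamma>"
  have r: "r = card B" using B by (simp add: int_basis_dim r_def)
  define b where "b = (SOME b. lattice_basis r b \<Gamma>)"
  have lb: "lattice_basis r b \<Gamma>"
    using int_basis_imp_lattice_basis[OF B] unfolding b_def r by (metis someI_ex)
  define q' where "q' = (SOME q. q \<in> Q)"
  have q': "q' \<in> Q" using False unfolding q'_def by (metis someI_ex ex_in_conv)
  have [measurable]: "Q \<in> sets borel" using assms(2) by (rule borel_closed)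
  have fin: "finite B" using B by (auto simp: int_basis_def intro: independent_imp_finite)
  let ?M = "Pi\<^sub>M {1..r} (\<lambda>_. lborel :: real measure)"
  let ?S = "{x \<in> extensional {1..r}. q' + (\<Sum>i\<in>{1..r}. x i *\<^sub>R b i) \<in> Q}"
  have S: "?S = {x \<in> space ?M. q' + (\<Sum>i\<in>{1..r}. x i *\<^sub>R b i) \<in> Q}"
    by (auto simp: space_PiM PiE_def)
  have Sm: "?S \<in> sets ?M" unfolding S by measurable
  have "lattice_volume \<Gamma> Q = measure (completion ?M) ?S"
    using False by (simp add: lattice_volume_def Let_def r_def b_def q'_def)
  also have "\<dots> = enn2real (emeasure ?M ?S)" using Sm by (simp add: measure_def)
  also have "emeasure ?M ?S = (\<integral>\<^sup>+x. indicator ?S x \<partial>?M)" using Sm by simp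
  also have "\<dots> = (\<integral>\<^sup>+x. indicator Q (q' + (\<Sum>i\<in>{1..r}. x i *\<^sub>R b i)) \<partial>?M)"
    by (intro nn_integral_cong) (auto simp: indicator_def space_PiM PiE_def)
  also have "\<dots> = flat_integral (b ` {1..r}) (indicator Q) q'"
    using lb by (intro flat_integral_reindex) (auto simp: lattice_basis_def)
  also have "\<dots> = flat_integral B (indicator Q) q'"
    by (intro flat_integral_int_basis_unique[OF lattice_basis_imp_int_basis[OF lb] B]) simp
  also have "\<dots> = flat_integral B (indicator Q) q"
    using fin assms(3)[OF q'] by (intro flat_integral_shift) auto
  finally show ?thesis .
qed

section \<open>Integrals determined by iterated antiderivatives\<close>

text \<open>All intermediate antiderivatives are recorded because each step up in dimension uses one
  more of them.\<close>

definition antideriv_chain :: "nat \<Rightarrow> (nat \<Rightarrow> real \<Rightarrow> real) \<Rightarrow> bool" where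
  "antideriv_chain l G \<longleftrightarrow> continuous_on UNIV (G 0) \<and>
     (\<forall>i<l. \<forall>x. (G (Suc i) has_real_derivative G i x) (at x))"

text \<open>In distributional terms, the \<open>l\<close>-th derivative of \<open>I\<close> is, up
  to sign, a sum of point masses at the knots \<open>T\<close>, as for integration against a spline.
  Since \<open>I\<close> takes values in \<open>ennreal\<close>, only functions that are nonnegative
  on the range \<open>J\<close> of heights are tested. The first conjunct is there because
  \<open>ennreal\<close> sends negative reals to 0, so that the equation alone would say too
  little.\<close>

definition is_spline ::
    "nat \<Rightarrow> real set \<Rightarrow> real set \<Rightarrow> ((real \<Rightarrow> real) \<Rightarrow> ennreal) \<Rightarrow> (real \<Rightarrow> real) \<Rightarrow> bool" where
  "is_spline l J T I c \<longleftrightarrow> (\<forall>G. antideriv_chain l G \<longrightarrow> (\<forall>x\<in>J. 0 \<le> G 0 x) \<longrightarrow>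
     0 \<le> (\<Sum>t\<in>T. c t * G l t) \<and> I (G 0) = ennreal (\<Sum>t\<in>T. c t * G l t))"

lemma is_splineD:
  assumes "is_spline l J T I c" "antideriv_chain l G" "\<And>x. x \<in> J \<Longrightarrow> 0 \<le> G 0 x"
  shows "0 \<le> (\<Sum>t\<in>T. c t * G l t)" "I (G 0) = ennreal (\<Sum>t\<in>T. c t * G l t)"
  using assms unfolding is_spline_def by blast+

lemma antideriv_chain_continuous:
  assumes "antideriv_chain l G" "i \<le> l"
  shows "continuous_on UNIV (G i)"
proof (cases i)
  case (Suc j)
  then have "\<And>x. (G i has_real_derivative G j x) (at x)"
    using assms by (auto simp: antideriv_chain_def)
  then show ?thesis using DERIV_continuous_on by blast
qed (use assms in \<open>auto simp: antideriv_chain_def\<close>)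

lemma antideriv_chain_add:
  "antideriv_chain l G \<Longrightarrow> antideriv_chain l H \<Longrightarrow> antideriv_chain l (\<lambda>i x. G i x + H i x)"
  unfolding antideriv_chain_def by (auto intro!: continuous_intros derivative_eq_intros)

text \<open>The bottom member is the constant \<open>K\<close>. Adding such a chain lifts a bounded
  test function above 0; with \<open>K\<close> the mean of a periodic function it restores that
  mean.\<close>

lemma antideriv_chain_power:
  "antideriv_chain l (\<lambda>i x. K * x ^ i / fact i)"
proof -
  have "((\<lambda>x. K * x ^ Suc i / fact (Suc i)) has_real_derivative K * x ^ i / fact i) (at x)" for i and x :: real
    by (rule derivative_eq_intros refl | simp add: field_simps del: of_nat_Suc)+
  then show ?thesis unfolding antideriv_chain_def by simp
qed

text \<open>The top member is \<open>p\<close> itself, so the values at the knots can be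
  prescribed.\<close>

lemma antideriv_chain_poly: "antideriv_chain l (\<lambda>i. poly ((pderiv ^^ (l - i)) p))"
proof -
  have "(poly ((pderiv ^^ (l - Suc i)) p) has_real_derivative poly ((pderiv ^^ (l - i)) p) x) (at x)"
    if "i < l" for i x
  proof -
    have "l - i = Suc (l - Suc i)" using that by simp
    then show ?thesis using poly_DERIV[of "(pderiv ^^ (l - Suc i)) p" x] by simp
  qed
  then show ?thesis unfolding antideriv_chain_def by (simp add: continuous_on_poly continuous_on_id)
qed

lemma is_spline_cong:
  assumes "is_spline l J T I c" "\<And>g. continuous_on UNIV g \<Longrightarrow> I' g = I g"
  shows "is_spline l J T I' c"
  using assms unfolding is_spline_def antideriv_chain_def by auto

text \<open>Different facets have different vertices; padding with zero coefficients lets their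
  formulas be added over one common set of knots.\<close>

lemma is_spline_mono:
  assumes "is_spline l J T I c" "T \<subseteq> T'" "finite T'"
  shows "is_spline l J T' I (\<lambda>t. if t \<in> T then c t else 0)"
proof -
  have "(\<Sum>t\<in>T'. (if t \<in> T then c t else 0) * G l t) = (\<Sum>t\<in>T. c t * G l t)" for G :: "nat \<Rightarrow> real \<Rightarrow> real"
    using assms(2,3) by (intro sum.mono_neutral_cong_right) auto
  then show ?thesis using assms(1) by (simp add: is_spline_def)
qed

lemma is_spline_cmult:
  assumes "is_spline l J T I c" "0 \<le> k"
  shows "is_spline l J T (\<lambda>g. ennreal k * I g) (\<lambda>t. k * c t)"
proof -
  have "(\<Sum>t\<in>T. k * c t * G l t) = k * (\<Sum>t\<in>T. c t * G l t)" for G :: "nat \<Rightarrow> real \<Rightarrow> real"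
    by (simp add: sum_distrib_left mult.assoc)
  then show ?thesis using assms by (simp add: is_spline_def ennreal_mult)
qed

lemma is_spline_sum:
  assumes "\<And>i. i \<in> A \<Longrightarrow> is_spline l J T (I i) (c i)"
  shows "is_spline l J T (\<lambda>g. \<Sum>i\<in>A. I i g) (\<lambda>t. \<Sum>i\<in>A. c i t)"
proof -
  have swap: "(\<Sum>t\<in>T. (\<Sum>i\<in>A. c i t) * G l t) = (\<Sum>i\<in>A. \<Sum>t\<in>T. c i t * G l t)" for G :: "nat \<Rightarrow> real \<Rightarrow> real"
    unfolding sum_distrib_right by (rule sum.swap)
  show ?thesis unfolding is_spline_def swap
  proof (intro allI impI conjI)
    fix G assume G: "antideriv_chain l G" "\<forall>x\<in>J. 0 \<le> G 0 x"
    have *: "0 \<le> (\<Sum>t\<in>T. c i t * G l t)" "I i (G 0) = ennreal (\<Sum>t\<in>T. c i t * G l t)" if "i \<in> A" for i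
      using is_splineD[OF assms[OF that] G(1)] G(2) by auto
    show "0 \<le> (\<Sum>i\<in>A. \<Sum>t\<in>T. c i t * G l t)" by (intro sum_nonneg *)
    show "(\<Sum>i\<in>A. I i (G 0)) = ennreal (\<Sum>i\<in>A. \<Sum>t\<in>T. c i t * G l t)"
      using * by (simp add: sum_ennreal)
  qed
qed

text \<open>Integration over a pyramid with apex height \<open>\<tau>\<close>: the integral over the section at parameter
  \<open>s\<close> uses the rescaled chain \<open>s\<^sup>-\<^sup>i G\<^sub>i (\<tau> + s (\<cdot> - \<tau>))\<close>, whose top member no longer carries
  the weight \<open>s\<^sup>l\<close>, so that the outer integral is a difference quotient of \<open>G\<^sub>l\<^sub>+\<^sub>1\<close>.\<close>

lemma is_spline_pyramid:
  assumes sp: "is_spline l {a..b} T I c" and T: "finite T" "\<tau> \<notin> T" and \<tau>: "\<tau> \<in> {a..b}"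
  shows "is_spline (Suc l) {a..b} (insert \<tau> T)
      (\<lambda>g. \<integral>\<^sup>+s. indicator {0..1} s * (ennreal (s ^ l) * I (\<lambda>u. g (\<tau> + s * (u - \<tau>)))) \<partial>lborel)
      (\<lambda>t. if t = \<tau> then - (\<Sum>t\<in>T. c t / (t - \<tau>)) else c t / (t - \<tau>))"
  unfolding is_spline_def
proof (intro allI impI)
  fix G assume G: "antideriv_chain (Suc l) G" "\<forall>x\<in>{a..b}. 0 \<le> G 0 x"
  define h where "h s = (\<Sum>t\<in>T. c t * G l (\<tau> + s * (t - \<tau>)))" for s
  define F where "F s = (\<Sum>t\<in>T. c t / (t - \<tau>) * G (Suc l) (\<tau> + s * (t - \<tau>)))" for s
  have cont: "continuous_on UNIV (G l)" using antideriv_chain_continuous[OF G(1)] by simp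
  have conth: "continuous_on UNIV h" unfolding h_def
    by (intro continuous_intros continuous_on_compose2[OF cont]) auto
  have der: "(G (Suc i) has_real_derivative G i x) (at x)" if "i \<le> l" for i x
    using G(1) that by (auto simp: antideriv_chain_def)
  have derF: "(F has_real_derivative h s) (at s)" for s
  proof -
    have "((\<lambda>s. c t / (t - \<tau>) * G (Suc l) (\<tau> + s * (t - \<tau>))) has_real_derivative
            c t * G l (\<tau> + s * (t - \<tau>))) (at s)" if "t \<in> T" for t
    proof -
      have "((\<lambda>s. \<tau> + s * (t - \<tau>)) has_real_derivative (t - \<tau>)) (at s)"
        by (auto intro!: derivative_eq_intros)
      from DERIV_chain2[OF der[of l] this]
      have "((\<lambda>s. c t / (t - \<tau>) * G (Suc l) (\<tau> + s * (t - \<tau>))) has_real_derivative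
            c t / (t - \<tau>) * (G l (\<tau> + s * (t - \<tau>)) * (t - \<tau>))) (at s)"
        by (intro DERIV_cmult) simp
      moreover have "t \<noteq> \<tau>" using that T(2) by auto
      ultimately show ?thesis by simp
    qed
    then show ?thesis unfolding F_def h_def by (rule DERIV_sum)
  qed
  have seg: "\<tau> + s * (x - \<tau>) \<in> {a..b}" if "x \<in> {a..b}" "0 \<le> s" "s \<le> 1" for x s
  proof -
    have "\<tau> + s * (x - \<tau>) = (1 - s) * \<tau> + s * x" by (simp add: algebra_simps)
    moreover have "(1 - s) *\<^sub>R \<tau> + s *\<^sub>R x \<in> {a..b}"
      using that \<tau> by (intro convexD[OF convex_real_interval(5)]) auto
    ultimately show ?thesis by simp
  qed
  have pos: "0 \<le> h s \<and> ennreal (s ^ l) * I (\<lambda>u. G 0 (\<tau> + s * (u - \<tau>))) = ennreal (h s)"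
    if s: "0 < s" "s \<le> 1" for s
  proof -
    define H where "H i u = G i (\<tau> + s * (u - \<tau>)) / s ^ i" for i u
    have "antideriv_chain l H" unfolding antideriv_chain_def
    proof (intro conjI allI impI)
      have c0: "continuous_on UNIV (G 0)" using antideriv_chain_continuous[OF G(1)] by simp
      have "continuous_on UNIV (\<lambda>u. \<tau> + s * (u - \<tau>))" by (intro continuous_intros)
      from continuous_on_compose2[OF c0 this]
      show "continuous_on UNIV (H 0)" by (simp add: H_def[abs_def])
      fix i u assume i: "i < l"
      have "((\<lambda>u. \<tau> + s * (u - \<tau>)) has_real_derivative s) (at u)"
        by (auto intro!: derivative_eq_intros)
      from DERIV_cdivide[OF DERIV_chain2[OF der[of i] this], of "s ^ Suc i"]
      show "(H (Suc i) has_real_derivative H i u) (at u)"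
        using s i by (simp add: H_def[abs_def])
    qed
    moreover have "0 \<le> H 0 x" if "x \<in> {a..b}" for x
      using seg[OF that] G(2) s by (simp add: H_def)
    ultimately have "0 \<le> (\<Sum>t\<in>T. c t * H l t)" "I (H 0) = ennreal (\<Sum>t\<in>T. c t * H l t)"
      using is_splineD[OF sp] by auto
    moreover have "(\<Sum>t\<in>T. c t * H l t) = h s / s ^ l"
      by (simp add: H_def h_def sum_divide_distrib)
    moreover have "H 0 = (\<lambda>u. G 0 (\<tau> + s * (u - \<tau>)))" by (simp add: H_def fun_eq_iff)
    ultimately have *: "0 \<le> h s / s ^ l" "I (\<lambda>u. G 0 (\<tau> + s * (u - \<tau>))) = ennreal (h s / s ^ l)"
      by simp_all
    have "0 < s ^ l" using s by simp
    then have "s ^ l * (h s / s ^ l) = h s" using s by simp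
    moreover have "0 \<le> s ^ l * (h s / s ^ l)" using *(1) \<open>0 < s ^ l\<close> by (intro mult_nonneg_nonneg) auto
    ultimately have "s ^ l * (h s / s ^ l) = h s" "0 \<le> h s" by simp_all
    then show ?thesis using *(2) ennreal_mult[of "s ^ l" "h s / s ^ l"] *(1) \<open>0 < s ^ l\<close> by simp
  qed
  \<comment> \<open>At \<open>s = 0\<close> the rescaled chain would divide by 0, so the sign there
    comes from continuity; the integral itself ignores this point.\<close>
  have h0: "0 \<le> h s" if "s \<in> {0..1}" for s
  proof -
    have cl: "closure {0<..1} = {0..1::real}" by simp
    show ?thesis
      by (rule continuous_ge_on_closure[of "{0<..1}" h s 0])
        (use that pos continuous_on_subset[OF conth] cl in auto)
  qed
  have "(\<integral>\<^sup>+s. indicator {0..1} s * (ennreal (s ^ l) * I (\<lambda>u. G 0 (\<tau> + s * (u - \<tau>)))) \<partial>lborel)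
      = (\<integral>\<^sup>+s. ennreal (h s) * indicator {0..1} s \<partial>lborel)"
    by (intro nn_integral_cong_AE eventually_mono[OF AE_lborel_singleton[of 0]])
      (use pos in \<open>auto simp: indicator_def\<close>)
  also have "\<dots> = ennreal (F 1 - F 0)"
    using conth derF h0 by (intro nn_integral_FTC_Icc) (auto simp: borel_measurable_continuous_onI)
  also have F10: "F 1 - F 0 = (\<Sum>t\<in>insert \<tau> T. (if t = \<tau> then - (\<Sum>t\<in>T. c t / (t - \<tau>)) else c t / (t - \<tau>)) * G (Suc l) t)"
  proof -
    have "(\<Sum>t\<in>T. (if t = \<tau> then - (\<Sum>t\<in>T. c t / (t - \<tau>)) else c t / (t - \<tau>)) * G (Suc l) t) = F 1"
      unfolding F_def using T(2) by (intro sum.cong) auto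
    then show ?thesis using T by (simp add: F_def sum_distrib_right)
  qed
  finally have 1: "(\<integral>\<^sup>+s. indicator {0..1} s * (ennreal (s ^ l) * I (\<lambda>u. G 0 (\<tau> + s * (u - \<tau>)))) \<partial>lborel)
    = ennreal (\<Sum>t\<in>insert \<tau> T. (if t = \<tau> then - (\<Sum>t\<in>T. c t / (t - \<tau>)) else c t / (t - \<tau>)) * G (Suc l) t)" .
  have "F 0 \<le> F 1"
    by (rule DERIV_nonneg_imp_nondecreasing) (use derF h0 in \<open>auto intro!: exI[of _ "h _"]\<close>)
  with 1 F10 show "0 \<le> (\<Sum>t\<in>insert \<tau> T. (if t = \<tau> then - (\<Sum>t\<in>T. c t / (t - \<tau>)) else c t / (t - \<tau>)) * G (Suc l) t) \<and>
    (\<integral>\<^sup>+s. indicator {0..1} s * (ennreal (s ^ l) * I (\<lambda>u. G 0 (\<tau> + s * (u - \<tau>)))) \<partial>lborel)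
    = ennreal (\<Sum>t\<in>insert \<tau> T. (if t = \<tau> then - (\<Sum>t\<in>T. c t / (t - \<tau>)) else c t / (t - \<tau>)) * G (Suc l) t)"
    by simp
qed

text \<open>The polynomial vanishing at \<open>T\<close> and \<open>\<tau>'\<close> but not at \<open>\<tau>\<close> shows that the coefficient at the
  auxiliary knot \<open>\<tau>\<close> is zero.\<close>

lemma is_spline_remove_knot:
  assumes sp: "is_spline l {a..b} (insert \<tau> T) I c" and sp': "is_spline l {a..b} (insert \<tau>' T) I c'"
    and T: "finite T" "\<tau> \<notin> T" "\<tau>' \<noteq> \<tau>"
  shows "is_spline l {a..b} T I c"
proof -
  define p where "p = (\<Prod>t\<in>insert \<tau>' T. [:-t, 1:])"
  have p0: "poly p t = 0" if "t \<in> insert \<tau>' T" for t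
    using that T(1) by (auto simp: p_def poly_prod)
  have p1: "poly p \<tau> \<noteq> 0"
    using T by (auto simp: p_def poly_prod)
  define G where "G i = poly ((pderiv ^^ (l - i)) p)" for i
  have chG: "antideriv_chain l G" unfolding G_def by (rule antideriv_chain_poly)
  have "continuous_on UNIV (G 0)" using chG by (simp add: antideriv_chain_def)
  then have "continuous_on {a..b} (G 0)" by (rule continuous_on_subset) simp
  then have "compact (G 0 ` {a..b})" by (rule compact_continuous_image) simp
  then have "bounded (G 0 ` {a..b})" by (rule compact_imp_bounded)
  then obtain K where K: "K > 0" "\<And>x. x \<in> {a..b} \<Longrightarrow> \<bar>G 0 x\<bar> \<le> K"
    unfolding bounded_pos by auto
  \<comment> \<open>\<open>G 0\<close> may be negative somewhere and is then not admissible as a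
    test function. \<open>H\<close> and \<open>G + H\<close> are admissible, and subtracting their
    identities gives the one for \<open>G\<close>.\<close>
  define H where "H i x = K * x ^ i / fact i" for i :: nat and x :: real
  have chH: "antideriv_chain l H" unfolding H_def by (rule antideriv_chain_power)
  have H0: "0 \<le> H 0 x" for x using K(1) by (simp add: H_def)
  have GH0: "0 \<le> G 0 x + H 0 x" if "x \<in> {a..b}" for x using K(2)[OF that] by (simp add: H_def)
  have "(\<Sum>t\<in>insert \<tau> T. c t * H l t) = (\<Sum>t\<in>insert \<tau>' T. c' t * H l t)"
    using is_splineD[OF sp chH] is_splineD[OF sp' chH] H0 by simp
  moreover have "(\<Sum>t\<in>insert \<tau> T. c t * (G l t + H l t)) = (\<Sum>t\<in>insert \<tau>' T. c' t * (G l t + H l t))"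
    using is_splineD[OF sp antideriv_chain_add[OF chG chH]] is_splineD[OF sp' antideriv_chain_add[OF chG chH]] GH0
    by simp
  ultimately have "(\<Sum>t\<in>insert \<tau> T. c t * G l t) = (\<Sum>t\<in>insert \<tau>' T. c' t * G l t)"
    by (simp add: distrib_left sum.distrib del: sum.insert)
  also have "\<dots> = 0" using p0 by (intro sum.neutral) (auto simp: G_def)
  also have "(\<Sum>t\<in>insert \<tau> T. c t * G l t) = c \<tau> * poly p \<tau>"
    using T p0 by (simp add: G_def)
  finally have "c \<tau> = 0" using p1 by simp
  then have "(\<Sum>t\<in>insert \<tau> T. c t * G l t) = (\<Sum>t\<in>T. c t * G l t)" for G :: "nat \<Rightarrow> real \<Rightarrow> real"
    using T by simp
  then show ?thesis using sp by (simp add: is_spline_def)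
qed

section \<open>Pyramids over the facets of a polytope\<close>

lemma flat_integral_add:
  assumes [measurable]: "f \<in> borel_measurable borel" "g \<in> borel_measurable borel"
  shows "flat_integral B (\<lambda>x. f x + g x) q = flat_integral B f q + flat_integral B g q"
  unfolding flat_integral_def by (rule nn_integral_add) measurable

text \<open>The auxiliary function \<open>h\<close> is infinite on the exceptional flats and 0
  elsewhere. Thus \<open>f \<le> g + h\<close> holds everywhere, while \<open>h\<close> integrates
  to 0.\<close>

lemma flat_integral_le_null:
  fixes B :: "'a::euclidean_space set"
  assumes B: "independent B" and N: "finite N" "\<And>T. T \<in> N \<Longrightarrow> affine T \<and> aff_dim T < int (card B)"
    and [measurable]: "f \<in> borel_measurable borel" "g \<in> borel_measurable borel"
    and le: "\<And>x. x \<notin> \<Union>N \<Longrightarrow> f x \<le> g x"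
  shows "flat_integral B f q \<le> flat_integral B g q"
proof -
  have [measurable]: "T \<in> sets borel" if "T \<in> N" for T
    using N(2)[OF that] by (intro borel_closed affine_closed) simp
  define h :: "'a \<Rightarrow> ennreal" where "h x = (\<Sum>T\<in>N. top * indicator T x)" for x
  have h [measurable]: "h \<in> borel_measurable borel" unfolding h_def by measurable
  have "flat_integral B f q \<le> flat_integral B (\<lambda>x. g x + h x) q"
  proof (rule flat_integral_mono)
    fix x
    show "f x \<le> g x + h x"
    proof (cases "x \<in> \<Union>N")
      case True
      then obtain T where T: "T \<in> N" "x \<in> T" by auto
      then have "top * indicator T x \<le> h x" unfolding h_def using N(1) by (intro member_le_sum) auto
      then have "h x = top" using T by (simp add: top_unique)
      then show ?thesis by simp
    qed (use le in \<open>simp add: add_increasing2\<close>)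
  qed
  also have "\<dots> = flat_integral B g q + flat_integral B h q"
    by (rule flat_integral_add) measurable
  also have "flat_integral B h q = (\<Sum>T\<in>N. flat_integral B (\<lambda>x. top * indicator T x) q)"
    unfolding h_def by (rule flat_integral_sum) measurable
  also have "\<dots> = 0"
    using N(2) by (intro sum.neutral ballI flat_integral_null[OF B]) (auto simp: indicator_def)
  finally show ?thesis by simp
qed

lemma flat_integral_cong_null:
  fixes B :: "'a::euclidean_space set"
  assumes "independent B" "finite N" "\<And>T. T \<in> N \<Longrightarrow> affine T \<and> aff_dim T < int (card B)"
    and "f \<in> borel_measurable borel" "g \<in> borel_measurable borel"
    and "\<And>x. x \<notin> \<Union>N \<Longrightarrow> f x = g x"
  shows "flat_integral B f q = flat_integral B g q"
  by (intro antisym flat_integral_le_null[OF assms(1-3)]) (use assms(4-6) in auto)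

definition pyramid :: "'a::real_vector \<Rightarrow> 'a set \<Rightarrow> 'a set" where
  "pyramid p F = {p + s *\<^sub>R (y - p) | s y. s \<in> {0..1} \<and> y \<in> F}"

lemma compact_pyramid:
  fixes F :: "'a::euclidean_space set"
  assumes "compact F" shows "compact (pyramid p F)"
proof -
  have "pyramid p F = (\<lambda>(s, y). p + s *\<^sub>R (y - p)) ` ({0..1} \<times> F)"
    by (force simp: pyramid_def)
  moreover have "compact \<dots>"
    using assms by (intro compact_continuous_image compact_Times)
      (auto simp: case_prod_unfold intro!: continuous_intros)
  ultimately show ?thesis by simp
qed

lemma pyramid_subset:
  assumes "convex S" "p \<in> S" "F \<subseteq> S" shows "pyramid p F \<subseteq> S"
proof
  fix x assume "x \<in> pyramid p F"
  then obtain s y where s: "x = p + s *\<^sub>R (y - p)" "s \<in> {0..1}" "y \<in> F" by (auto simp: pyramid_def)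
  have "x = (1 - s) *\<^sub>R p + s *\<^sub>R y" by (simp add: s algebra_simps)
  then show "x \<in> S" using s assms by (auto intro!: convexD)
qed

text \<open>For \<open>0 < s \<le> 1\<close> the section at parameter \<open>s\<close> is the image
  of \<open>F\<close> under the homothety with centre \<open>p\<close> and factor \<open>s\<close>,
  whence the weight \<open>s ^ card B\<close>. The apex lies off the flat of \<open>F\<close>
  because \<open>w \<notin> span B\<close>.\<close>

lemma flat_integral_pyramid:
  fixes B F :: "'a::euclidean_space set"
  assumes B: "finite B" "w \<notin> span B" and F: "compact F" "\<And>y. y \<in> F \<Longrightarrow> y - (p + w) \<in> span B"
    and f[measurable]: "f \<in> borel_measurable borel"
  shows "flat_integral (insert w B) (\<lambda>x. indicator (pyramid p F) x * f x) p =
     (\<integral>\<^sup>+s. indicator {0..1} s * (ennreal (s ^ card B) *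
        flat_integral B (\<lambda>y. indicator F y * f (p + s *\<^sub>R (y - p))) (p + w)) \<partial>lborel)"
proof -
  have [measurable]: "pyramid p F \<in> sets borel" "F \<in> sets borel"
    using F(1) compact_pyramid by (auto intro: borel_compact)
  have wB: "w \<notin> B" using B(2) by (auto intro: span_base)
  \<comment> \<open>The component along \<open>w\<close> modulo \<open>span B\<close> recovers the
    parameter from the point.\<close>
  have same: "s = s'" if "p + s *\<^sub>R (y - p) = p + s' *\<^sub>R (y' - p)" "y - (p + w) \<in> span B" "y' - (p + w) \<in> span B" for s s' y y'
  proof (rule ccontr)
    assume "s \<noteq> s'"
    have "(s - s') *\<^sub>R w = s' *\<^sub>R (y' - (p + w)) - s *\<^sub>R (y - (p + w))"
      using that(1) by (simp add: algebra_simps)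
    also have "\<dots> \<in> span B" using span_diff[OF span_scale[OF that(3)] span_scale[OF that(2)]] .
    finally have "(1 / (s - s')) *\<^sub>R ((s - s') *\<^sub>R w) \<in> span B" by (rule span_scale)
    then show False using B(2) \<open>s \<noteq> s'\<close> by simp
  qed
  have pos: "flat_integral B (\<lambda>x. indicator (pyramid p F) x * f x) (p + s *\<^sub>R w) =
     ennreal (s ^ card B) * flat_integral B (\<lambda>y. indicator F y * f (p + s *\<^sub>R (y - p))) (p + w)"
    if s: "0 < s" "s \<le> 1" for s
  proof -
    have "flat_integral B (\<lambda>x. indicator (pyramid p F) x * f x) (p + s *\<^sub>R ((p + w) - p)) =
      ennreal (s ^ card B) * flat_integral B
        (\<lambda>y. indicator (pyramid p F) (p + s *\<^sub>R (y - p)) * f (p + s *\<^sub>R (y - p))) (p + w)"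
      using B(1) s by (intro flat_integral_scale) auto
    also have "flat_integral B (\<lambda>y. indicator (pyramid p F) (p + s *\<^sub>R (y - p)) * f (p + s *\<^sub>R (y - p))) (p + w)
      = flat_integral B (\<lambda>y. indicator F y * f (p + s *\<^sub>R (y - p))) (p + w)"
    proof (rule flat_integral_cong)
      fix y assume y: "y - (p + w) \<in> span B"
      have "p + s *\<^sub>R (y - p) \<in> pyramid p F \<longleftrightarrow> y \<in> F"
      proof
        assume "p + s *\<^sub>R (y - p) \<in> pyramid p F"
        then obtain s' y' where s': "p + s *\<^sub>R (y - p) = p + s' *\<^sub>R (y' - p)" "y' \<in> F"
          by (auto simp: pyramid_def)
        then have "s = s'" using same y F(2) by blast
        then show "y \<in> F" using s' s by simp
      qed (use s in \<open>auto simp: pyramid_def intro!: exI[of _ s] exI[of _ y]\<close>)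
      then show "indicator (pyramid p F) (p + s *\<^sub>R (y - p)) * f (p + s *\<^sub>R (y - p)) =
          indicator F y * f (p + s *\<^sub>R (y - p))" by (simp add: indicator_def)
    qed
    finally show ?thesis by simp
  qed
  have zero: "flat_integral B (\<lambda>x. indicator (pyramid p F) x * f x) (p + s *\<^sub>R w) = 0"
    if s: "s < 0 \<or> 1 < s" for s
  proof -
    have "x \<notin> pyramid p F" if x: "x - (p + s *\<^sub>R w) \<in> span B" for x
    proof
      assume "x \<in> pyramid p F"
      then obtain s' y' where s': "x = p + s' *\<^sub>R (y' - p)" "y' \<in> F" "s' \<in> {0..1}"
        by (auto simp: pyramid_def)
      define y where "y = p + (1 / s) *\<^sub>R (x - p)"
      have "y - (p + w) = (1 / s) *\<^sub>R (x - (p + s *\<^sub>R w))"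
        using s by (auto simp: y_def algebra_simps)
      then have "y - (p + w) \<in> span B" using x by (simp add: span_scale)
      moreover have "p + s *\<^sub>R (y - p) = p + s' *\<^sub>R (y' - p)" using s s' by (auto simp: y_def)
      ultimately have "s = s'" using same F(2) s'(2) by blast
      then show False using s s' by auto
    qed
    then have "flat_integral B (\<lambda>x. indicator (pyramid p F) x * f x) (p + s *\<^sub>R w) =
       flat_integral B (\<lambda>_. 0) (p + s *\<^sub>R w)"
      by (intro flat_integral_cong) auto
    then show ?thesis by (simp add: flat_integral_def)
  qed
  have "flat_integral (insert w B) (\<lambda>x. indicator (pyramid p F) x * f x) p =
     (\<integral>\<^sup>+s. flat_integral B (\<lambda>x. indicator (pyramid p F) x * f x) (p + s *\<^sub>R w) \<partial>lborel)"
    using B(1) wB by (intro flat_integral_insert) auto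
  also have "\<dots> = (\<integral>\<^sup>+s. indicator {0..1} s * (ennreal (s ^ card B) *
        flat_integral B (\<lambda>y. indicator F y * f (p + s *\<^sub>R (y - p))) (p + w)) \<partial>lborel)"
  proof (intro nn_integral_cong_AE eventually_mono[OF AE_lborel_singleton[of 0]])
    fix s :: real assume "s \<noteq> 0"
    then consider "0 < s" "s \<le> 1" | "s < 0 \<or> 1 < s" by linarith
    then show "flat_integral B (\<lambda>x. indicator (pyramid p F) x * f x) (p + s *\<^sub>R w) =
      indicator {0..1} s * (ennreal (s ^ card B) *
        flat_integral B (\<lambda>y. indicator F y * f (p + s *\<^sub>R (y - p))) (p + w))"
    proof cases
      case 1
      then show ?thesis by (simp add: pos)
    next
      case 2
      then have "indicator {0..1} s = (0::ennreal)" by auto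
      then show ?thesis using zero[OF 2] by simp
    qed
  qed
  finally show ?thesis .
qed

text \<open>The ray from \<open>p\<close> through \<open>x\<close> reaches the relative frontier no
  earlier than at \<open>x\<close>, and the point reached lies in a facet.\<close>

lemma polytope_in_facet_pyramid:
  fixes P :: "'a::euclidean_space set"
  assumes P: "polytope P" and p: "p \<in> rel_interior P" and x: "x \<in> P" "x \<noteq> p"
  obtains F where "F facet_of P" "x \<in> pyramid p F"
proof -
  have cl: "closed P" "convex P" "bounded P" "polyhedron P"
    using P by (auto simp: polytope_imp_closed polytope_imp_convex polytope_imp_bounded polytope_imp_polyhedron)
  obtain d where d: "0 < d" "p + d *\<^sub>R (x - p) \<in> rel_frontier P"
  proof -
    have "p + (x - p) \<in> affine hull P" "x - p \<noteq> 0" using x by (simp_all add: hull_inc)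
    then show thesis using ray_to_rel_frontier[OF cl(3) p] that by blast
  qed
  let ?y = "p + d *\<^sub>R (x - p)"
  have "1 \<le> d"
  proof (rule ccontr)
    assume "\<not> 1 \<le> d"
    moreover have "?y = (1 - d) *\<^sub>R p + d *\<^sub>R x" by (simp add: algebra_simps)
    ultimately have "?y \<in> open_segment p x" using d(1) x(2) by (auto simp: in_segment intro!: exI[of _ d])
    then have "?y \<in> rel_interior P"
      using rel_interior_closure_convex_segment[OF cl(2) p, of x] x(1) closure_subset by blast
    then show False using d(2) by (simp add: rel_frontier_def)
  qed
  obtain F where F: "F facet_of P" "?y \<in> F"
    using d(2) rel_frontier_of_polyhedron[OF cl(4)] by auto
  have "x = p + (1 / d) *\<^sub>R (?y - p)" using d(1) by simp
  then have "x \<in> pyramid p F" using F(2) \<open>1 \<le> d\<close> unfolding pyramid_def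
    by (intro CollectI exI[of _ "1 / d"] exI[of _ ?y]) auto
  then show thesis using F(1) that by blast
qed

text \<open>Used in both directions, this says that a ray from a relative interior point meets the
  relative frontier only once: a nearer frontier point would lie strictly between \<open>p\<close>
  and a farther one, hence in the relative interior.\<close>

lemma rel_frontier_ray_le:
  fixes P :: "'a::euclidean_space set"
  assumes P: "convex P" and p: "p \<in> rel_interior P" and y: "y \<in> rel_frontier P" "y' \<in> rel_frontier P"
    and eq: "p + s *\<^sub>R (y - p) = p + s' *\<^sub>R (y' - p)" and s: "0 < s" "0 < s'" 
  shows "s' \<le> s"
proof (rule ccontr)
  assume "\<not> s' \<le> s"
  have "y' - p = (1 / s') *\<^sub>R (s' *\<^sub>R (y' - p))" using s by simp
  also have "s' *\<^sub>R (y' - p) = s *\<^sub>R (y - p)" using eq by simp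
  finally have "y' = (1 - s / s') *\<^sub>R p + (s / s') *\<^sub>R y" by (simp add: algebra_simps)
  moreover have "p \<noteq> y" using p y by (auto simp: rel_frontier_def)
  ultimately have "y' \<in> open_segment p y"
    using s \<open>\<not> s' \<le> s\<close> by (auto simp: in_segment intro!: exI[of _ "s / s'"])
  moreover have "y \<in> closure P" using y by (simp add: rel_frontier_def)
  ultimately have "y' \<in> rel_interior P"
    using rel_interior_closure_convex_segment[OF P p] by blast
  then show False using y by (simp add: rel_frontier_def)
qed

text \<open>Both pyramids contain the segment from \<open>p\<close> to the unique frontier point on
  the ray through \<open>x\<close>, so that point belongs to both facets. For distinct facets the
  hull in the conclusion has smaller dimension than \<open>P\<close> and is therefore
  negligible.\<close>

lemma facet_pyramids_Int:
  fixes P :: "'a::euclidean_space set"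
  assumes P: "polytope P" and p: "p \<in> rel_interior P" and x: "x \<noteq> p"
    and F: "F facet_of P" "F' facet_of P" "x \<in> pyramid p F" "x \<in> pyramid p F'"
  shows "x \<in> affine hull (insert p (F \<inter> F'))"
proof -
  have cl: "convex P" "polyhedron P"
    using P by (auto simp: polytope_imp_convex polytope_imp_polyhedron)
  obtain s y where s: "x = p + s *\<^sub>R (y - p)" "y \<in> F" "s \<in> {0..1}" using F by (auto simp: pyramid_def)
  obtain s' y' where s': "x = p + s' *\<^sub>R (y' - p)" "y' \<in> F'" "s' \<in> {0..1}" using F by (auto simp: pyramid_def)
  have fr: "y \<in> rel_frontier P" "y' \<in> rel_frontier P"
    using s s' F rel_frontier_of_polyhedron[OF cl(2)] by auto
  have pos: "0 < s" "0 < s'" using s s' x by (auto simp: less_le)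
  have "s = s'"
    using rel_frontier_ray_le[OF cl(1) p fr _ pos] rel_frontier_ray_le[OF cl(1) p fr(2,1) _ pos(2,1)] s(1) s'(1)
    by force
  then have "y = y'" using s s' pos by simp
  then have "y \<in> F \<inter> F'" using s s' by simp
  moreover have "x = (1 - s) *\<^sub>R p + s *\<^sub>R y" by (simp add: s algebra_simps)
  ultimately show ?thesis
    using mem_affine[OF affine_affine_hull, of p "insert p (F \<inter> F')" y "1 - s" s] by (simp add: hull_inc)
qed

lemma flat_integral_facet_pyramids:
  fixes P B :: "'a::euclidean_space set"
  assumes P: "polytope P" "aff_dim P = int (card B)" "card B \<ge> 1" and B: "independent B"
    and p: "p \<in> rel_interior P" and f[measurable]: "f \<in> borel_measurable borel"
  shows "flat_integral B (\<lambda>x. indicator P x * f x) q =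
    (\<Sum>F\<in>{F. F facet_of P}. flat_integral B (\<lambda>x. indicator (pyramid p F) x * f x) q)"
proof -
  have fin: "finite {F. F facet_of P}" using P(1) by (rule finite_polytope_facets)
  have cl: "convex P" "closed P"
    using P by (auto simp: polytope_imp_convex polytope_imp_closed)
  have Fc: "compact F" "F face_of P" "F \<subseteq> P" if "F facet_of P" for F
    using that P(1) by (auto simp: facet_of_imp_face_of facet_of_imp_subset
        intro: face_of_imp_compact polytope_imp_compact polytope_imp_convex)
  have [measurable]: "P \<in> sets borel" using cl by (simp add: borel_closed)
  have [measurable]: "pyramid p F \<in> sets borel" if "F \<in> {F. F facet_of P}" for F
    using Fc(1) that compact_pyramid by (auto intro: borel_compact)
  \<comment> \<open>The exceptional points: the apex, and the flats spanned by the apex and the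
    intersection of two distinct facets.\<close>
  define N where "N = insert {p} ((\<lambda>(F, F'). affine hull (insert p (F \<inter> F'))) `
     {(F, F'). F facet_of P \<and> F' facet_of P \<and> F \<noteq> F'})"
  have "flat_integral B (\<lambda>x. indicator P x * f x) q =
        flat_integral B (\<lambda>x. \<Sum>F\<in>{F. F facet_of P}. indicator (pyramid p F) x * f x) q"
  proof (rule flat_integral_cong_null[OF B])
    have "{(F, F'). F facet_of P \<and> F' facet_of P \<and> F \<noteq> F'} \<subseteq> {F. F facet_of P} \<times> {F. F facet_of P}" by auto
    then show "finite N" unfolding N_def using fin by (meson finite_SigmaI finite_imageI finite_insert finite_subset)
    fix T assume "T \<in> N"
    then consider "T = {p}" | F F' where "F facet_of P" "F' facet_of P" "F \<noteq> F'" "T = affine hull (insert p (F \<inter> F'))"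
      by (auto simp: N_def)
    then show "affine T \<and> aff_dim T < int (card B)"
    proof cases
      case 1 then show ?thesis using P(3) by simp
    next
      case (2 F F')
      have "F \<inter> F' face_of F" using Fc 2 by (meson face_of_Int face_of_face inf_le1)
      moreover have "F \<inter> F' \<noteq> F"
      proof
        assume "F \<inter> F' = F"
        then have "F face_of F'" using Fc(2) 2 by (metis face_of_face inf.orderI)
        moreover have "convex F'" using Fc(2) 2 by (meson face_of_imp_convex)
        ultimately have "aff_dim F < aff_dim F'" using 2(3) by (intro face_of_aff_dim_lt) auto
        then show False using 2 by (simp add: facet_of_def)
      qed
      ultimately have "aff_dim (F \<inter> F') < aff_dim F"
        using Fc(2) 2 by (intro face_of_aff_dim_lt) (auto intro: face_of_imp_convex)
      then have "aff_dim (insert p (F \<inter> F')) < aff_dim P"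
        using 2 by (simp add: facet_of_def aff_dim_insert)
      then show ?thesis using 2 P(2) by simp
    qed
  next
    fix x assume x: "x \<notin> \<Union>N"
    then have xp: "x \<noteq> p" by (auto simp: N_def)
    show "indicator P x * f x = (\<Sum>F\<in>{F. F facet_of P}. indicator (pyramid p F) x * f x)"
    proof (cases "x \<in> P")
      case False
      then have "x \<notin> pyramid p F" if "F facet_of P" for F
        using pyramid_subset[OF cl(1), of p F] p Fc(3)[OF that] rel_interior_subset[of P] by auto
      then show ?thesis using False by (intro trans[OF _ sum.neutral[symmetric]]) auto
    next
      case True
      obtain F where F: "F facet_of P" "x \<in> pyramid p F"
        using polytope_in_facet_pyramid[OF P(1) p True xp] .
      have "x \<notin> pyramid p F'" if "F' facet_of P" "F' \<noteq> F" for F'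
        using facet_pyramids_Int[OF P(1) p xp F(1) that(1) F(2)] x that F(1) unfolding N_def by blast
      then have "(\<Sum>F\<in>{F. F facet_of P}. indicator (pyramid p F) x * f x) =
        (\<Sum>F'\<in>{F. F facet_of P}. if F' = F then f x else 0)"
        using F(2) by (intro sum.cong) auto
      then show ?thesis using fin F True by simp
    qed
  qed measurable
  also have "\<dots> = (\<Sum>F\<in>{F. F facet_of P}. flat_integral B (\<lambda>x. indicator (pyramid p F) x * f x) q)"
    by (rule flat_integral_sum) measurable
  finally show ?thesis .
qed

section \<open>Integrals of functions of the height over a polytope\<close>

lemma polytope_has_face:
  fixes P :: "'a::euclidean_space set"
  assumes "polytope P" "int m \<le> aff_dim P"
  obtains F where "F face_of P" "aff_dim F = int m"
proof -
  have "\<exists>F. F face_of P \<and> aff_dim F = int m"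
    using assms
  proof (induction "nat (aff_dim P)" arbitrary: P rule: less_induct)
    case less
    show ?case
    proof (cases "aff_dim P = int m")
      case True
      then show ?thesis using less.prems by (auto intro: face_of_refl polytope_imp_convex)
    next
      case False
      then have "0 < aff_dim P" "int m < aff_dim P" using less.prems by auto
      then obtain F where F: "F facet_of P" using polytope_facet_exists less.prems(1) by blast
      then have dF: "aff_dim F = aff_dim P - 1" by (simp add: facet_of_def)
      have "polytope F" using F less.prems(1) by (meson face_of_polytope_polytope facet_of_imp_face_of)
      then obtain E where "E face_of F" "aff_dim E = int m"
        using less.hyps[of F] dF \<open>int m < aff_dim P\<close> by auto
      then show ?thesis using F face_of_trans facet_of_imp_face_of by blast
    qed
  qed
  then show thesis using that by blast
qed

lemma translate_basis:
  fixes S :: "'a::euclidean_space set"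
  assumes "q \<in> S"
  obtains B where "independent B" "aff_dim S = int (card B)" "\<And>x. x \<in> S \<Longrightarrow> x - q \<in> span B"
    "B \<subseteq> (\<lambda>x. x - q) ` S" "\<And>v. v \<in> span B \<Longrightarrow> q + v \<in> affine hull S"
proof -
  let ?D = "(\<lambda>x. x - q) ` S"
  have D: "?D = (+) (- q) ` S" by auto
  obtain B where B: "B \<subseteq> ?D" "independent B" "?D \<subseteq> span B" "card B = dim ?D"
    using basis_exists by blast
  have "span B = span ?D" using B by (metis span_eq span_superset subset_trans)
  have hull: "q \<in> affine hull S" using assms by (rule hull_inc)
  show thesis
  proof (rule that[OF B(2)])
    show "aff_dim S = int (card B)" using aff_dim_eq_dim[OF hull] B(4) unfolding D by simp
    show "q + v \<in> affine hull S" if "v \<in> span B" for v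
    proof -
      have "affine hull S = (+) q ` span B"
        using affine_hull_span_gen[OF hull] unfolding \<open>span B = span ?D\<close> D .
      then show ?thesis using that by (simp only: image_eqI)
    qed
  qed (use B in auto)
qed

text \<open>The edge condition makes \<open>\<phi>\<close> nonconstant on every face of positive dimension, so that interior
  apices of generic height exist and the pyramids over the facets reduce the dimension.\<close>

theorem polytope_height_spline:
  fixes P B :: "'a::euclidean_space set" and \<phi> :: "'a \<Rightarrow> real"
  assumes "polytope P" "aff_dim P = int l" "linear \<phi>"
    and "\<And>E. E face_of P \<Longrightarrow> aff_dim E = 1 \<Longrightarrow> \<not> \<phi> constant_on E"
    and "independent B" "card B = l" "\<And>x. x \<in> P \<Longrightarrow> x - q \<in> span B" "\<phi> ` P \<subseteq> {a..b}"
  shows "\<exists>c. is_spline l {a..b} (\<phi> ` {v. v extreme_point_of P})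
      (\<lambda>g. flat_integral B (\<lambda>x. indicator P x * ennreal (g (\<phi> x))) q) c"
  using assms
proof (induction l arbitrary: P B q)
  case 0
  then obtain v where P: "P = {v}" by (auto simp: aff_dim_eq_0)
  have B: "B = {}" using "0.prems" by (metis card_eq_0_iff independent_imp_finite)
  have "q = v" using "0.prems"(7) by (simp add: P B)
  have "{u. u extreme_point_of P} = {v}" using P by (auto simp: extreme_point_of_singleton)
  moreover have "is_spline 0 {a..b} {\<phi> v} (\<lambda>g. flat_integral B (\<lambda>x. indicator P x * ennreal (g (\<phi> x))) q) (\<lambda>_. 1)"
    unfolding is_spline_def using "0.prems"(8) by (auto simp: P B \<open>q = v\<close>)
  ultimately show ?case by auto
next
  case (Suc l)
  note P = Suc.prems(1) and dimP = Suc.prems(2) and lin = Suc.prems(3) and edges = Suc.prems(4)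
    and B = Suc.prems(5,6,7) and ab = Suc.prems(8)
  have cl: "convex P" "closed P"
    using P by (auto simp: polytope_imp_convex polytope_imp_closed)
  have cont: "continuous_on A \<phi>" for A using lin by (simp add: linear_continuous_on linear_linear)
  have [measurable]: "\<phi> \<in> borel_measurable borel" using cont by (simp add: borel_measurable_continuous_onI)
  let ?T = "\<phi> ` {v. v extreme_point_of P}"
  have finT: "finite ?T"
    using P by (intro finite_imageI finite_polyhedron_extreme_points polytope_imp_polyhedron)
  have finF: "finite {F. F facet_of P}" using P by (rule finite_polytope_facets)
  have finB: "finite B" using B(1) by (rule independent_imp_finite)
  \<comment> \<open>The apices are taken from the relative interior, so \<phi> must vary there. A
    constant value would spread to the closure, hence to all of \<open>P\<close> and to one of its
    edges.\<close>
  have nonconst: "\<not> \<phi> constant_on rel_interior P"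
  proof
    assume "\<phi> constant_on rel_interior P"
    then obtain c where c: "\<And>x. x \<in> rel_interior P \<Longrightarrow> \<phi> x = c" by (auto simp: constant_on_def)
    have "\<phi> x = c" if "x \<in> P" for x
    proof -
      have "x \<in> closure (rel_interior P)"
        using that convex_closure_rel_interior[OF cl(1)] closure_subset by blast
      from continuous_constant_on_closure[OF cont c this] show ?thesis .
    qed
    moreover obtain E where E: "E face_of P" "aff_dim E = 1"
      using polytope_has_face[OF P, of 1] dimP by auto
    ultimately have "\<phi> constant_on E" unfolding constant_on_def using face_of_imp_subset by blast
    then show False using edges E by blast
  qed
  \<comment> \<open>A connected set of reals with more than one point is infinite, so it contains
    values different from the finitely many vertex heights.\<close>
  have inf: "infinite (\<phi> ` rel_interior P)"
  proof
    assume "finite (\<phi> ` rel_interior P)"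
    moreover have "connected (\<phi> ` rel_interior P)"
      using cl(1) by (intro connected_continuous_image cont convex_connected convex_rel_interior)
    ultimately consider "\<phi> ` rel_interior P = {}" | c where "\<phi> ` rel_interior P = {c}"
      using connected_finite_iff_sing by blast
    then have "\<phi> constant_on rel_interior P" unfolding constant_on_def by cases blast+
    then show False using nonconst by simp
  qed
  \<comment> \<open>The pyramid step brings in the height of the apex as an additional knot, and it
    requires this height to be new because of the division by \<open>t - \<tau>\<close>.\<close>
  have cone: "\<exists>c. is_spline (Suc l) {a..b} (insert (\<phi> p) ?T)
      (\<lambda>g. flat_integral B (\<lambda>x. indicator P x * ennreal (g (\<phi> x))) q) c"
    if p: "p \<in> rel_interior P" "\<phi> p \<notin> ?T" for p
  proof -
    have pP: "p \<in> P" using p(1) rel_interior_subset by auto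
    have "\<exists>c. is_spline (Suc l) {a..b} (insert (\<phi> p) ?T)
        (\<lambda>g. flat_integral B (\<lambda>x. indicator (pyramid p F) x * ennreal (g (\<phi> x))) q) c"
      if F: "F facet_of P" for F
    proof -
      have FP: "F face_of P" "F \<subseteq> P" "polytope F" "compact F" "F \<noteq> P" "F \<noteq> {}"
        using F P by (auto simp: facet_of_def face_of_imp_subset
          intro: face_of_polytope_polytope polytope_imp_compact)
      have dimF: "aff_dim F = int l" using F dimP by (simp add: facet_of_def)
      obtain r where r: "r \<in> F" using FP by auto
      obtain C where C: "independent C" "aff_dim F = int (card C)" "\<And>x. x \<in> F \<Longrightarrow> x - r \<in> span C"
          "C \<subseteq> (\<lambda>x. x - r) ` F" "\<And>v. v \<in> span C \<Longrightarrow> r + v \<in> affine hull F"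
        using translate_basis[OF r] by blast
      have finC: "finite C" using C(1) by (rule independent_imp_finite)
      have cardC: "card C = l" using C(2) dimF by simp
      define w where "w = r - p"
      have w: "w \<notin> span C"
      proof
        assume "w \<in> span C"
        then have "- w \<in> span C" by (rule span_neg)
        then have "p \<in> affine hull F" using C(5)[of "- w"] by (simp add: w_def)
        then show False using p(1) affine_hull_face_of_disjoint_rel_interior[OF cl(1) FP(1,5)] by auto
      qed
      have wC: "w \<notin> C" using w by (auto intro: span_base)
      have ind: "independent (insert w C)" using C(1) w wC by (simp add: independent_insert)
      have "insert w C \<subseteq> span B"
      proof -
        have "x - y \<in> span B" if "x \<in> P" "y \<in> P" for x y
          using span_diff[OF B(3)[OF that(1)] B(3)[OF that(2)]] by simp
        then have "(\<lambda>x. x - r) ` F \<subseteq> span B" "w \<in> span B" using FP(2) r pP by (auto simp: w_def)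
        then show ?thesis using C(4) by blast
      qed
      then have "span (insert w C) \<subseteq> span B" by (simp add: span_minimal)
      moreover have "dim (span (insert w C)) = dim (span B)"
        using ind B(1,2) finC wC cardC by (simp add: dim_eq_card_independent)
      ultimately have sp: "span (insert w C) = span B"
        by (metis dim_eq_span dim_span order_refl span_span)
      \<comment> \<open>The basis adapted to the facet and the apex is normalised differently from
        \<open>B\<close>; the ratio \<open>k\<close> is absorbed into the coefficients.\<close>
      obtain k where k: "k > 0" "\<And>f q. f \<in> borel_measurable borel \<Longrightarrow>
          flat_integral B f q = ennreal k * flat_integral (insert w C) f q"
        using flat_integral_change_basis[OF B(1) ind sp[symmetric]] by blast
      have edgesF: "\<not> \<phi> constant_on E" if "E face_of F" "aff_dim E = 1" for E
        using edges that FP(1) face_of_trans by blast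
      have "\<phi> ` F \<subseteq> {a..b}" using FP(2) ab by auto
      from Suc.IH[OF FP(3) dimF lin edgesF C(1) cardC C(3) this]
      obtain c where c: "is_spline l {a..b} (\<phi> ` {v. v extreme_point_of F})
          (\<lambda>g. flat_integral C (\<lambda>x. indicator F x * ennreal (g (\<phi> x))) r) c" by auto
      have sub: "\<phi> ` {v. v extreme_point_of F} \<subseteq> ?T"
        using extreme_point_of_face[OF FP(1)] by auto
      from is_spline_mono[OF c sub finT] obtain c' where
        c': "is_spline l {a..b} ?T (\<lambda>g. flat_integral C (\<lambda>x. indicator F x * ennreal (g (\<phi> x))) r) c'" by blast
      have "\<phi> p \<in> {a..b}" using pP ab by auto
      from is_spline_cmult[OF is_spline_pyramid[OF c' finT p(2) this], of k] k(1) obtain c'' where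
        c'': "is_spline (Suc l) {a..b} (insert (\<phi> p) ?T) (\<lambda>g. ennreal k *
         (\<integral>\<^sup>+s. indicator {0..1} s * (ennreal (s ^ l) *
           flat_integral C (\<lambda>x. indicator F x * ennreal (g (\<phi> p + s * (\<phi> x - \<phi> p)))) r) \<partial>lborel)) c''"
        by auto
      show ?thesis
      proof (intro exI, rule is_spline_cong[OF c''])
        fix g :: "real \<Rightarrow> real" assume "continuous_on UNIV g"
        then have [measurable]: "g \<in> borel_measurable borel" by (rule borel_measurable_continuous_onI)
        have [measurable]: "pyramid p F \<in> sets borel"
          using compact_pyramid[OF FP(4)] by (rule borel_compact)
        have phi: "\<phi> (p + s *\<^sub>R (y - p)) = \<phi> p + s * (\<phi> y - \<phi> p)" for s y
          by (simp add: linear_add[OF lin] linear_diff[OF lin] linear_cmul[OF lin])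
        have "flat_integral B (\<lambda>x. indicator (pyramid p F) x * ennreal (g (\<phi> x))) q =
              flat_integral B (\<lambda>x. indicator (pyramid p F) x * ennreal (g (\<phi> x))) p"
          using finB B(3)[OF pP] by (intro flat_integral_shift[symmetric]) auto
        also have "\<dots> = ennreal k * flat_integral (insert w C) (\<lambda>x. indicator (pyramid p F) x * ennreal (g (\<phi> x))) p"
          by (rule k(2)) measurable
        also have "flat_integral (insert w C) (\<lambda>x. indicator (pyramid p F) x * ennreal (g (\<phi> x))) p =
          (\<integral>\<^sup>+s. indicator {0..1} s * (ennreal (s ^ card C) *
            flat_integral C (\<lambda>y. indicator F y * ennreal (g (\<phi> (p + s *\<^sub>R (y - p))))) (p + w)) \<partial>lborel)"
          using C(3) by (intro flat_integral_pyramid finC w FP(4)) (auto simp: w_def)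
        finally show "flat_integral B (\<lambda>x. indicator (pyramid p F) x * ennreal (g (\<phi> x))) q = ennreal k *
         (\<integral>\<^sup>+s. indicator {0..1} s * (ennreal (s ^ l) *
           flat_integral C (\<lambda>x. indicator F x * ennreal (g (\<phi> p + s * (\<phi> x - \<phi> p)))) r) \<partial>lborel)"
          by (simp add: cardC w_def phi)
      qed
    qed
    then have "\<exists>c. \<forall>F\<in>{F. F facet_of P}. is_spline (Suc l) {a..b} (insert (\<phi> p) ?T)
        (\<lambda>g. flat_integral B (\<lambda>x. indicator (pyramid p F) x * ennreal (g (\<phi> x))) q) (c F)"
      by (intro bchoice ballI) auto
    then obtain c where c: "\<And>F. F facet_of P \<Longrightarrow> is_spline (Suc l) {a..b} (insert (\<phi> p) ?T)
        (\<lambda>g. flat_integral B (\<lambda>x. indicator (pyramid p F) x * ennreal (g (\<phi> x))) q) (c F)"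
      by auto
    have "is_spline (Suc l) {a..b} (insert (\<phi> p) ?T)
        (\<lambda>g. \<Sum>F\<in>{F. F facet_of P}. flat_integral B (\<lambda>x. indicator (pyramid p F) x * ennreal (g (\<phi> x))) q)
        (\<lambda>t. \<Sum>F\<in>{F. F facet_of P}. c F t)"
      by (rule is_spline_sum) (use c in auto)
    then show ?thesis
    proof (intro exI, rule is_spline_cong)
      fix g :: "real \<Rightarrow> real" assume "continuous_on UNIV g"
      then have [measurable]: "g \<in> borel_measurable borel" by (rule borel_measurable_continuous_onI)
      show "flat_integral B (\<lambda>x. indicator P x * ennreal (g (\<phi> x))) q =
        (\<Sum>F\<in>{F. F facet_of P}. flat_integral B (\<lambda>x. indicator (pyramid p F) x * ennreal (g (\<phi> x))) q)"
        using dimP B by (intro flat_integral_facet_pyramids P p(1)) auto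
    qed
  qed
  \<comment> \<open>Two apices of different heights give two formulas for the same integral, each
    with one extra knot. Comparing them shows that the extra knot carries no weight.\<close>
  define X where "X = \<phi> ` rel_interior P - ?T"
  have X: "infinite X" unfolding X_def using inf finT by (simp add: Diff_infinite_finite)
  then obtain \<tau> where \<tau>: "\<tau> \<in> X" using infinite_imp_nonempty by blast
  have "infinite (X - {\<tau>})" using X by simp
  then obtain \<tau>' where \<tau>': "\<tau>' \<in> X" "\<tau>' \<noteq> \<tau>" using infinite_imp_nonempty by blast
  have ex: "\<exists>c. is_spline (Suc l) {a..b} (insert t ?T)
      (\<lambda>g. flat_integral B (\<lambda>x. indicator P x * ennreal (g (\<phi> x))) q) c"
    if t: "t \<in> X" for t
  proof -
    obtain p where "p \<in> rel_interior P" "t = \<phi> p" "\<phi> p \<notin> ?T" using t by (auto simp: X_def)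
    then show ?thesis using cone by simp
  qed
  obtain c c' where
    "is_spline (Suc l) {a..b} (insert \<tau> ?T) (\<lambda>g. flat_integral B (\<lambda>x. indicator P x * ennreal (g (\<phi> x))) q) c"
    "is_spline (Suc l) {a..b} (insert \<tau>' ?T) (\<lambda>g. flat_integral B (\<lambda>x. indicator P x * ennreal (g (\<phi> x))) q) c'"
    using ex[OF \<tau>] ex[OF \<tau>'(1)] by blast
  then have "is_spline (Suc l) {a..b} ?T (\<lambda>g. flat_integral B (\<lambda>x. indicator P x * ennreal (g (\<phi> x))) q) c"
    by (rule is_spline_remove_knot) (use finT \<tau> \<tau>' in \<open>auto simp: X_def\<close>)
  then show ?case by blast
qed

section \<open>Periodic test functions\<close>

lemma antiderivative_exists:
  fixes g :: "real \<Rightarrow> real"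
  assumes "continuous_on UNIV g"
  obtains F where "\<And>x. (F has_real_derivative g x) (at x)"
proof -
  have "((\<lambda>u. LBINT y=0..u. g y) has_real_derivative g x) (at x)" for x
  proof -
    let ?a = "- \<bar>x\<bar> - 1" and ?b = "\<bar>x\<bar> + 1"
    have "((\<lambda>u. LBINT y=(0::real)..u. g y) has_vector_derivative g x) (at x within {?a..?b})"
      by (intro interval_integral_FTC2 continuous_on_subset[OF assms]) auto
    moreover have "at x within {?a..?b} = at x" by (rule at_within_Icc_at) auto
    ultimately show ?thesis by (simp add: has_real_derivative_iff_has_vector_derivative zero_ereal_def)
  qed
  then show thesis by (rule that)
qed

definition periodic1 :: "(real \<Rightarrow> real) \<Rightarrow> bool" where
  "periodic1 g \<longleftrightarrow> (\<forall>x. g (x + 1) = g x)"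

lemma periodic1_int:
  assumes "periodic1 g" shows "g (of_int n) = g 0"
proof (induction n rule: int_induct[where k = 0])
  case (step1 i)
  have "g (of_int i + 1) = g (of_int i)" using assms by (simp add: periodic1_def)
  then show ?case using step1 by simp
next
  case (step2 i)
  have "g (of_int (i - 1) + 1) = g (of_int (i - 1))" using assms unfolding periodic1_def by blast
  then show ?case using step2 by simp
qed simp

lemma antiderivative_periodic1:
  assumes "periodic1 g" "\<And>x. (F has_real_derivative g x) (at x)" "F 1 = F 0"
  shows "periodic1 F"
proof -
  have "((\<lambda>x. F (x + 1) - F x) has_real_derivative 0) (at x)" for x
  proof -
    have "((\<lambda>x. F (x + 1)) has_real_derivative g (x + 1)) (at x)"
      using assms(2)[of "x + 1"] by (simp add: DERIV_shift)
    from DERIV_diff[OF this assms(2)[of x]] show ?thesis using assms(1) by (simp add: periodic1_def)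
  qed
  then have "F (x + 1) - F x = F (0 + 1) - F 0" for x by (intro DERIV_isconst_all) auto
  then show ?thesis using assms(3) by (simp add: periodic1_def)
qed

text \<open>\<open>F 1 = F 0\<close> says that \<open>g\<close> has mean zero over a period. Each
  antiderivative is shifted by its own mean, so that the next one is periodic again; the Bernoulli
  polynomials arise in the same way.\<close>

lemma periodic1_antideriv_chain:
  assumes "continuous_on UNIV g" "periodic1 g" "\<And>x. (F has_real_derivative g x) (at x)" "F 1 = F 0"
  obtains H where "H 0 = g" "\<And>i x. (H (Suc i) has_real_derivative H i x) (at x)"
    "\<And>i. periodic1 (H i)"
proof -
  define P where "P h \<longleftrightarrow> periodic1 h \<and> continuous_on UNIV h \<and>
      (\<exists>F. (\<forall>x. (F has_real_derivative h x) (at x)) \<and> F 1 = F 0)" for h :: "real \<Rightarrow> real"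
  have Pg: "P g" using assms by (auto simp: P_def)
  have step: "\<exists>h'. P h' \<and> (\<forall>x. (h' has_real_derivative h x) (at x))" if "P h" for h
  proof -
    obtain F where F: "\<And>x. (F has_real_derivative h x) (at x)" "F 1 = F 0"
      using \<open>P h\<close> by (auto simp: P_def)
    have contF: "continuous_on UNIV F" using F(1) DERIV_continuous_on by blast
    obtain E where E: "\<And>x. (E has_real_derivative F x) (at x)" using antiderivative_exists[OF contF] by blast
    define m where "m = E 1 - E 0"
    have "periodic1 (\<lambda>x. F x - m)"
      using antiderivative_periodic1[OF _ F] \<open>P h\<close> by (auto simp: P_def periodic1_def)
    moreover have "continuous_on UNIV (\<lambda>x. F x - m)" using contF by (intro continuous_intros)
    moreover have "((\<lambda>x. E x - m * x) has_real_derivative F x - m) (at x)" for x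
      by (rule derivative_eq_intros E refl | simp)+
    moreover have "E 1 - m * 1 = E 0 - m * 0" by (simp add: m_def)
    ultimately have "P (\<lambda>x. F x - m)" unfolding P_def by blast
    moreover have "((\<lambda>x. F x - m) has_real_derivative h x) (at x)" for x
      by (rule derivative_eq_intros F refl | simp)+
    ultimately show ?thesis by blast
  qed
  obtain H where H: "H 0 = g" "\<And>n. P (H n)" "\<And>n x. (H (Suc n) has_real_derivative H n x) (at x)"
  proof (rule exE[OF dependent_nat_choice[of "\<lambda>n h. P h \<and> (n = 0 \<longrightarrow> h = g)" "\<lambda>n h h'. \<forall>x. (h' has_real_derivative h x) (at x)"]])
    show "\<exists>h. P h \<and> (0 = (0::nat) \<longrightarrow> h = g)" using Pg by auto
  qed (use step that in auto)
  show thesis by (rule that[of H]) (use H in \<open>auto simp: P_def\<close>)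
qed

text \<open>The knots lie in \<sigma> plus the integers. The mean \<open>m\<close> of
  \<open>g\<close> contributes \<open>m\<close> times the total volume; the top antiderivative of
  \<open>g - m\<close> has the single value \<open>H l 0\<close> at all shifted knots, and the
  coefficients sum to 0.\<close>

lemma is_spline_periodic:
  assumes sp: "is_spline l J T I c" and l: "l \<ge> 1" and T: "\<And>t. t \<in> T \<Longrightarrow> t - \<sigma> \<in> \<int>"
    and g: "continuous_on UNIV g" "periodic1 g" "\<And>x. 0 \<le> g x" and F: "\<And>x. (F has_real_derivative g x) (at x)"
    and V: "I (\<lambda>_. 1) = ennreal V" "0 \<le> V"
  shows "I (\<lambda>x. g (x - \<sigma>)) = ennreal ((F 1 - F 0) * V)"
proof -
  have shift: "antideriv_chain l (\<lambda>i x. G i (x - \<sigma>))" if "antideriv_chain l G" for G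
    unfolding antideriv_chain_def
  proof (intro conjI allI impI)
    have "continuous_on UNIV (G 0)" using that by (simp add: antideriv_chain_def)
    moreover have "continuous_on UNIV (\<lambda>x. x - \<sigma>)" by (intro continuous_intros)
    ultimately show "continuous_on UNIV (\<lambda>x. G 0 (x - \<sigma>))" by (rule continuous_on_compose2) auto
    fix i x assume "i < l"
    then have "(G (Suc i) has_real_derivative G i (x - \<sigma>)) (at (x + (- \<sigma>)))"
      using that by (simp add: antideriv_chain_def)
    then show "((\<lambda>x. G (Suc i) (x - \<sigma>)) has_real_derivative G i (x - \<sigma>)) (at x)"
      by (subst (asm) DERIV_shift) simp
  qed
  define S where "S = (\<Sum>t\<in>T. c t * ((t - \<sigma>) ^ l / fact l))"
  have ch1: "antideriv_chain l (\<lambda>i x. 1 * x ^ i / fact i)" by (rule antideriv_chain_power)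
  \<comment> \<open>Adding 1 to the top member alone leaves the bottom member unchanged since
    \<open>l \<ge> 1\<close>. Comparing the two resulting formulas for the same integral shows that
    the coefficients sum to 0.\<close>
  have "antideriv_chain l (\<lambda>i x. if i = l then 1 else 0)"
    using l unfolding antideriv_chain_def by (auto intro!: derivative_eq_intros)
  from is_splineD[OF sp shift[OF antideriv_chain_add[OF ch1 this]]] l
  have a: "0 \<le> (\<Sum>t\<in>T. c t * ((t - \<sigma>) ^ l / fact l + 1))"
      "I (\<lambda>_. 1) = ennreal (\<Sum>t\<in>T. c t * ((t - \<sigma>) ^ l / fact l + 1))" by auto
  from is_splineD[OF sp shift[OF ch1]]
  have b: "0 \<le> S" "I (\<lambda>_. 1) = ennreal S" by (auto simp: S_def)
  have SV: "S = V" using b V by simp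
  have c0: "(\<Sum>t\<in>T. c t) = 0" using a b by (simp add: S_def distrib_left sum.distrib)
  define m where "m = F 1 - F 0"
  have F': "((\<lambda>x. F x - m * x) has_real_derivative g x - m) (at x)" for x
    by (rule derivative_eq_intros F refl | simp)+
  obtain H where H: "H 0 = (\<lambda>x. g x - m)" "\<And>i x. (H (Suc i) has_real_derivative H i x) (at x)"
    "\<And>i. periodic1 (H i)"
    by (rule periodic1_antideriv_chain[OF _ _ F'])
      (use g in \<open>auto simp: m_def periodic1_def intro!: continuous_intros\<close>)
  have "continuous_on UNIV (H 0)" using g(1) by (auto simp: H(1) intro!: continuous_intros)
  then have "antideriv_chain l H" using H(2) by (simp add: antideriv_chain_def)
  from is_splineD[OF sp shift[OF antideriv_chain_add[OF antideriv_chain_power[of l m] this]]]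
  have "I (\<lambda>x. g (x - \<sigma>)) = ennreal (\<Sum>t\<in>T. c t * (m * (t - \<sigma>) ^ l / fact l + H l (t - \<sigma>)))"
    using g(3) by (simp add: H(1))
  also have "(\<Sum>t\<in>T. c t * (m * (t - \<sigma>) ^ l / fact l + H l (t - \<sigma>))) =
      (\<Sum>t\<in>T. m * (c t * ((t - \<sigma>) ^ l / fact l)) + H l 0 * c t)"
  proof (rule sum.cong)
    fix t assume "t \<in> T"
    then obtain n :: int where "t - \<sigma> = of_int n" using T by (auto elim: Ints_cases)
    then have "H l (t - \<sigma>) = H l 0" using periodic1_int[OF H(3)] by simp
    then show "c t * (m * (t - \<sigma>) ^ l / fact l + H l (t - \<sigma>)) =
       m * (c t * ((t - \<sigma>) ^ l / fact l)) + H l 0 * c t" by (simp add: algebra_simps)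
  qed simp
  also have "\<dots> = m * S + H l 0 * (\<Sum>t\<in>T. c t)" by (simp add: sum.distrib S_def sum_distrib_left)
  finally show ?thesis using c0 SV by (simp add: m_def)
qed

text \<open>The periodization \<open>B\<close> of \<open>A\<close> satisfies \<open>\<integral> B = V\<close> and \<open>\<integral> B\<^sup>2 = V\<^sup>2\<close> over a period (take \<open>g = 1\<close>
  and \<open>g = B\<close>), so that \<open>\<integral> (B - V)\<^sup>2 = 0\<close> and \<open>B\<close> is constant.\<close>

lemma sum_integers_eq_integral:
  fixes A :: "real \<Rightarrow> real"
  assumes cont: "continuous_on UNIV A" and nonneg: "\<And>t. 0 \<le> A t"
    and supp: "\<And>t. \<bar>t\<bar> > N \<Longrightarrow> A t = 0" and V: "0 \<le> V"
    and key: "\<And>g F. continuous_on UNIV g \<Longrightarrow> periodic1 g \<Longrightarrow> (\<And>x. 0 \<le> g x) \<Longrightarrow>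
       (\<And>x. (F has_real_derivative g x) (at x)) \<Longrightarrow>
       (\<integral>\<^sup>+t. ennreal (A t) * ennreal (g t) \<partial>lborel) = ennreal ((F 1 - F 0) * V)"
  shows "((\<lambda>n::int. A (of_int n)) has_sum V) UNIV"
proof -
  define B where "B s = (\<Sum>\<^sub>\<infinity>n::int. A (s + of_int n))" for s
  have B_fin: "((\<lambda>n::int. A (s + of_int n)) has_sum (\<Sum>n\<in>{-M..M}. A (s + of_int n))) UNIV"
    if "\<bar>s\<bar> + N \<le> of_int M" for s M
  proof -
    have "((\<lambda>n::int. A (s + of_int n)) has_sum (\<Sum>n\<in>{-M..M}. A (s + of_int n))) {-M..M}"
      by (rule has_sum_finite) simp
    moreover have "A (s + of_int n) = 0" if "n \<notin> {-M..M}" for n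
    proof -
      have "of_int n > (of_int M :: real) \<or> of_int n < (- of_int M :: real)" using that by auto
      then have "\<bar>s + of_int n\<bar> > N" using \<open>\<bar>s\<bar> + N \<le> of_int M\<close> by linarith
      then show ?thesis by (rule supp)
    qed
    ultimately show ?thesis by (subst has_sum_cong_neutral[where S = UNIV and T = "{-M..M}" and g = "\<lambda>n. A (s + of_int n)"]) auto
  qed
  have B_eq: "B s = (\<Sum>n\<in>{-M..M}. A (s + of_int n))" if "\<bar>s\<bar> + N \<le> of_int M" for s M
    unfolding B_def by (rule infsumI[OF B_fin[OF that]])
  have contB: "continuous_on UNIV B"
  proof -
    have "isCont B s" for s
    proof -
      obtain M :: int where M: "\<bar>s\<bar> + 1 + N \<le> of_int M" using ex_le_of_int by blast
      have "isCont (\<lambda>s. \<Sum>n\<in>{-M..M}. A (s + of_int n)) s"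
      proof (intro continuous_sum)
        fix n :: int
        have "isCont A (s + of_int n)" using cont by (simp add: continuous_on_eq_continuous_at)
        moreover have "isCont (\<lambda>s. s + of_int n) s" by simp
        ultimately show "isCont (\<lambda>s. A (s + of_int n)) s" using isCont_o2 by blast
      qed
      moreover have "\<forall>\<^sub>F x in nhds s. B x = (\<Sum>n\<in>{-M..M}. A (x + of_int n))"
      proof (rule eventually_mono[OF eventually_nhds_in_open[of "{s - 1<..<s + 1}"]])
        fix x assume "x \<in> {s - 1<..<s + 1}"
        then show "B x = (\<Sum>n\<in>{-M..M}. A (x + of_int n))" using M by (intro B_eq) auto
      qed auto
      ultimately show ?thesis using isCont_cong by fastforce
    qed
    then show ?thesis by (simp add: continuous_on_eq_continuous_at)
  qed
  have B0: "0 \<le> B s" for s unfolding B_def using nonneg by (intro infsum_nonneg) auto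
  have perB: "periodic1 B"
    unfolding periodic1_def
  proof
    fix s
    have "B (s + 1) = (\<Sum>\<^sub>\<infinity>n::int. A (s + of_int (n + 1)))" unfolding B_def by (simp add: algebra_simps)
    also have "\<dots> = (\<Sum>\<^sub>\<infinity>n\<in>range (\<lambda>n::int. n + 1). A (s + of_int n))"
      by (subst infsum_reindex) (auto simp: o_def)
    also have "range (\<lambda>n::int. n + 1) = UNIV" by (rule surjI[of _ "\<lambda>n. n - 1"]) simp
    finally show "B (s + 1) = B s" by (simp add: B_def)
  qed
  have [measurable]: "A \<in> borel_measurable borel" using cont by (rule borel_measurable_continuous_onI)
  \<comment> \<open>Unfolding: the line is cut into unit intervals, which are all translated onto
    the first one. As \<open>g\<close> is unchanged by this, the values of \<open>A\<close> add up
    to \<open>B\<close>.\<close>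
  have fold: "(\<integral>\<^sup>+t. ennreal (A t) * ennreal (g t) \<partial>lborel) = ennreal (F 1 - F 0)"
    if g: "continuous_on UNIV g" "periodic1 g" "\<And>x. 0 \<le> g x"
      and F: "\<And>x. (F has_real_derivative B x * g x) (at x)" for g F
  proof -
    have [measurable]: "g \<in> borel_measurable borel" using g(1) by (rule borel_measurable_continuous_onI)
    have gn: "g (t + of_int n) = g t" for t n
      using periodic1_int[of "\<lambda>x. g (t + x)" n] g(2) by (simp add: periodic1_def add.assoc[symmetric])
    \<comment> \<open>This \<open>M\<close> bounds both the unit intervals that meet the support of
      \<open>A\<close> and, for \<open>t\<close> in the first unit interval, the translates that
      contribute to \<open>B t\<close>.\<close>
    obtain M :: int where M: "2 + \<bar>N\<bar> \<le> of_int M" using ex_le_of_int by blast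
    have "(\<integral>\<^sup>+t. ennreal (A t) * ennreal (g t) \<partial>lborel) =
       (\<integral>\<^sup>+t. (\<Sum>n\<in>{-M..M}. indicator {of_int n..<of_int n + 1} t * (ennreal (A t) * ennreal (g t))) \<partial>lborel)"
    proof (rule nn_integral_cong)
      fix t :: real
      have ind: "indicator {of_int n..<of_int n + 1} t = (if n = \<lfloor>t\<rfloor> then 1 else (0::ennreal))" for n
        by (auto simp: indicator_def floor_unique)
      show "ennreal (A t) * ennreal (g t) =
        (\<Sum>n\<in>{-M..M}. indicator {of_int n..<of_int n + 1} t * (ennreal (A t) * ennreal (g t)))"
      proof (cases "\<bar>t\<bar> > N")
        case True
        then show ?thesis by (simp add: supp)
      next
        case False
        then have "\<lfloor>t\<rfloor> \<in> {-M..M}" using M by (auto simp: le_floor_iff floor_le_iff)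
        then show ?thesis unfolding ind by (simp add: if_distrib[of "\<lambda>x. x * _"] cong: if_cong)
      qed
    qed
    also have "\<dots> = (\<Sum>n\<in>{-M..M}. \<integral>\<^sup>+t. indicator {of_int n..<of_int n + 1} t * (ennreal (A t) * ennreal (g t)) \<partial>lborel)"
      by (rule nn_integral_sum) measurable
    also have "\<dots> = (\<Sum>n\<in>{-M..M}. \<integral>\<^sup>+t. indicator {0..<1} t * (ennreal (A (t + of_int n)) * ennreal (g t)) \<partial>lborel)"
    proof (rule sum.cong)
      fix n :: int
      have "(\<integral>\<^sup>+t. indicator {of_int n..<of_int n + 1} t * (ennreal (A t) * ennreal (g t)) \<partial>lborel) =
         (\<integral>\<^sup>+t. indicator {of_int n..<of_int n + 1} (t + of_int n) * (ennreal (A (t + of_int n)) * ennreal (g (t + of_int n))) \<partial>lborel)"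
        by (rule nn_integral_lborel_shift[symmetric]) measurable
      then show "(\<integral>\<^sup>+t. indicator {of_int n..<of_int n + 1} t * (ennreal (A t) * ennreal (g t)) \<partial>lborel) =
        (\<integral>\<^sup>+t. indicator {0..<1} t * (ennreal (A (t + of_int n)) * ennreal (g t)) \<partial>lborel)"
        unfolding gn by (simp add: indicator_def)
    qed simp
    also have "\<dots> = (\<integral>\<^sup>+t. (\<Sum>n\<in>{-M..M}. indicator {0..<1} t * (ennreal (A (t + of_int n)) * ennreal (g t))) \<partial>lborel)"
      by (rule nn_integral_sum[symmetric]) measurable
    also have "\<dots> = (\<integral>\<^sup>+t. ennreal (B t * g t) * indicator {0..1} t \<partial>lborel)"
    proof (intro nn_integral_cong_AE eventually_mono[OF AE_lborel_singleton[of 1]])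
      fix t :: real assume "t \<noteq> 1"
      show "(\<Sum>n\<in>{-M..M}. indicator {0..<1} t * (ennreal (A (t + of_int n)) * ennreal (g t))) =
        ennreal (B t * g t) * indicator {0..1} t"
      proof (cases "t \<in> {0..<1}")
        case True
        then have "B t = (\<Sum>n\<in>{-M..M}. A (t + of_int n))" using M by (intro B_eq) auto
        then have "ennreal (B t * g t) = (\<Sum>n\<in>{-M..M}. ennreal (A (t + of_int n))) * ennreal (g t)"
          using nonneg g(3) by (simp add: ennreal_mult sum_nonneg sum_ennreal)
        then show ?thesis using True by (simp add: sum_distrib_right)
      qed (use \<open>t \<noteq> 1\<close> in auto)
    qed
    also have "\<dots> = ennreal (F 1 - F 0)"
      using F B0 g(3) contB g(1)
      by (intro nn_integral_FTC_Icc) (auto intro!: borel_measurable_continuous_onI continuous_intros)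
    finally show ?thesis .
  qed
  have mono: "F 0 \<le> F 1" if "\<And>x. (F has_real_derivative f x) (at x)" "\<And>x. 0 \<le> f x" for F f :: "real \<Rightarrow> real"
    by (rule DERIV_nonneg_imp_nondecreasing) (use that in auto)
  obtain F1 where F1: "\<And>x. (F1 has_real_derivative B x) (at x)" using antiderivative_exists[OF contB] by blast
  have "continuous_on UNIV (\<lambda>x. B x * B x)" using contB by (intro continuous_intros)
  then obtain F2 where F2: "\<And>x. (F2 has_real_derivative B x * B x) (at x)" using antiderivative_exists by blast
  have "ennreal ((1 - 0) * V) = ennreal (F1 1 - F1 0)"
    using key[of "\<lambda>_. 1" "\<lambda>x. x"] fold[of "\<lambda>_. 1" F1] F1 by (simp add: periodic1_def)
  then have e1: "V = F1 1 - F1 0" using V mono[OF F1 B0] by simp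
  have "ennreal ((F1 1 - F1 0) * V) = ennreal (F2 1 - F2 0)"
    using key[OF contB perB B0 F1] fold[OF contB perB B0 F2] by simp
  then have e2: "V * V = F2 1 - F2 0" using V mono[OF F2] B0 e1[symmetric] by simp
  \<comment> \<open>An antiderivative of the square of \<open>B - V\<close>. It is nondecreasing and
    has equal values at 0 and 1, hence is constant in between.\<close>
  define H where "H x = F2 x - 2 * V * F1 x + V * V * x" for x
  have H: "(H has_real_derivative (B x - V) * (B x - V)) (at x)" for x
    unfolding H_def by (rule derivative_eq_intros F1 F2 refl | simp add: algebra_simps)+
  have "H 1 - H 0 = (F2 1 - F2 0) - 2 * V * (F1 1 - F1 0) + V * V"
    by (simp add: H_def algebra_simps)
  then have H01: "H 1 = H 0" unfolding e1[symmetric] e2[symmetric] by simp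
  have Hmono: "H x \<le> H y" if "x \<le> y" for x y
    using that by (rule DERIV_nonneg_imp_nondecreasing) (use H in \<open>blast intro: zero_le_square\<close>)
  have BV: "B x = V" if x: "0 < x" "x < 1" for x
  proof -
    have "H y = H 0" if "0 < y" "y < 1" for y
      using Hmono[of 0 y] Hmono[of y 1] H01 that by simp
    then have "(H has_real_derivative 0) (at x)"
      using x by (intro has_field_derivative_transform_within_open[of "\<lambda>_. H 0" 0 x "{0<..<1}" H]) auto
    then have "(B x - V) * (B x - V) = 0" using H DERIV_unique by blast
    then show ?thesis by simp
  qed
  have "B 0 = V"
  proof -
    have cl: "closure {0<..<1} = {0..1::real}" by simp
    show ?thesis
      by (rule continuous_constant_on_closure[of "{0<..<1}" B V 0])
        (use continuous_on_subset[OF contB] BV in auto)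
  qed
  moreover obtain M :: int where "\<bar>0\<bar> + N \<le> of_int M" using ex_le_of_int by blast
  ultimately show ?thesis using B_fin[of 0 M] B_eq[of 0 M] by simp
qed

section \<open>Sections of a polytope at integral heights\<close>

text \<open>One slicing step: \<psi> is the height, scaled so that \<open>w\<close> has height 1,
  and the sections are parallel to \<open>span B\<close>. With \<open>B\<close> empty the section
  volume would be the indicator of a compact interval, which jumps at the ends;
  \<open>B \<noteq> {}\<close> is what makes continuity possible.\<close>

locale sliced_polytope =
  fixes Q B :: "'a::euclidean_space set" and w u :: 'a and \<psi> :: "'a \<Rightarrow> real"
  assumes Q: "polytope Q" and ind: "independent (insert w B)" and wB: "w \<notin> B" and ne: "B \<noteq> {}"
    and lin: "linear \<psi>" and \<psi>w: "\<psi> w = 1" and \<psi>B: "\<And>b. b \<in> B \<Longrightarrow> \<psi> b = 0"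
    and Qsp: "\<And>x. x \<in> Q \<Longrightarrow> x - u \<in> span (insert w B)"
    and edges: "\<And>E. E face_of Q \<Longrightarrow> aff_dim E = 1 \<Longrightarrow> \<not> \<psi> constant_on E"
begin

lemma indB: "independent B" using ind independent_mono by blast

lemma finB: "finite B" using indB by (rule independent_imp_finite)

lemma cardB: "card B \<ge> 1" using finB ne by (simp add: Suc_leI card_gt_0_iff)

lemma Qmeas [measurable]: "Q \<in> sets borel"
  using Q by (simp add: borel_closed polytope_imp_closed)

lemma cont_\<psi>: "continuous_on S \<psi>"
  using lin by (simp add: linear_continuous_on linear_linear)

lemma \<psi>meas [measurable]: "\<psi> \<in> borel_measurable borel"
  using cont_\<psi> by (rule borel_measurable_continuous_onI)

lemma \<psi>_span: "v \<in> span B \<Longrightarrow> \<psi> v = 0"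
  using linear_eq_0_on_span[OF lin \<psi>B] .

lemma height:
  assumes "x - (u + t *\<^sub>R w) \<in> span B" shows "\<psi> x = \<psi> u + t"
  using \<psi>_span[OF assms] by (simp add: linear_diff[OF lin] linear_add[OF lin] linear_cmul[OF lin] \<psi>w)

lemma height_converse:
  assumes "x \<in> Q" "\<psi> x = \<psi> u + t" shows "x - (u + t *\<^sub>R w) \<in> span B"
proof -
  obtain k where k: "x - u - k *\<^sub>R w \<in> span B"
    using Qsp[OF assms(1)] by (auto simp: span_breakdown_eq)
  then have "\<psi> x = \<psi> u + k" by (intro height) (simp add: algebra_simps)
  then show ?thesis using k assms(2) by (simp add: algebra_simps)
qed

section \<open>Continuity of the section volume\<close>

definition section_volume :: "real \<Rightarrow> ennreal" where
  "section_volume t = flat_integral B (indicator Q) (u + t *\<^sub>R w)"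

lemma section_finite: "section_volume t < \<infinity>"
  unfolding section_volume_def
  by (rule flat_integral_finite[OF indB, where S = Q and K = 1])
    (use Q in \<open>auto simp: polytope_imp_bounded indicator_def\<close>)

lemma section_null:
  assumes "aff_dim (Q \<inter> {x. \<psi> x = \<psi> u + t}) < int (card B)"
  shows "section_volume t = 0"
proof -
  let ?S = "Q \<inter> {x. \<psi> x = \<psi> u + t}"
  have "closed {x. \<psi> x = \<psi> u + t}"
    using cont_\<psi>[of UNIV] by (intro closed_Collect_eq) (auto intro!: continuous_intros)
  then have "?S \<in> sets borel" using Q by (simp add: borel_closed polytope_imp_closed closed_Int)
  then have [measurable]: "indicator ?S \<in> borel_measurable borel" by simp
  have "section_volume t = flat_integral B (indicator ?S) (u + t *\<^sub>R w)"
    unfolding section_volume_def by (intro flat_integral_cong) (auto simp: indicator_def dest: height)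
  also have "\<dots> = 0"
    by (rule flat_integral_null[OF indB affine_affine_hull[of ?S]])
      (use assms in \<open>auto simp: indicator_def hull_inc\<close>)
  finally show ?thesis .
qed

text \<open>A face of positive dimension contains an edge, and \<psi> is not constant on edges.
  Horizontal faces are therefore at most points.\<close>

lemma face_constant_dim:
  assumes "F face_of Q" "\<psi> constant_on F" shows "aff_dim F \<le> 0"
proof (rule ccontr)
  assume "\<not> aff_dim F \<le> 0"
  moreover have "polytope F" using assms(1) Q face_of_polytope_polytope by blast
  ultimately obtain E where E: "E face_of F" "aff_dim E = 1"
    using polytope_has_face[of F 1] by auto
  then have "E face_of Q" using assms(1) face_of_trans by blast
  moreover have "\<psi> constant_on E" using assms(2) face_of_imp_subset[OF E(1)] by (auto simp: constant_on_def)
  ultimately show False using edges E(2) by blast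
qed

lemma inner_repr: obtains a where "\<And>x. \<psi> x = a \<bullet> x"
proof -
  have "\<psi> x = adjoint \<psi> 1 \<bullet> x" for x
    using adjoint_works[OF lin, of x 1] by (simp add: inner_commute)
  then show thesis by (rule that)
qed

text \<open>A section at an extreme height is a face on which \<psi> is constant, hence at most a
  point, and it has volume 0 because \<open>card B \<ge> 1\<close>.\<close>

lemma section_pos_interior:
  assumes "section_volume t \<noteq> 0"
  shows "\<exists>x\<in>Q. \<psi> u + t < \<psi> x" "\<exists>x\<in>Q. \<psi> x < \<psi> u + t"
proof -
  obtain a where a: "\<And>x. \<psi> x = a \<bullet> x" using inner_repr by blast
  have conv: "convex Q" using Q by (rule polytope_imp_convex)
  let ?F = "Q \<inter> {x. \<psi> x = \<psi> u + t}"
  have "\<not> ?F face_of Q"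
  proof
    assume "?F face_of Q"
    then have "aff_dim ?F \<le> 0" by (rule face_constant_dim) (auto simp: constant_on_def)
    then show False using section_null assms cardB by force
  qed
  then show "\<exists>x\<in>Q. \<psi> u + t < \<psi> x" "\<exists>x\<in>Q. \<psi> x < \<psi> u + t"
    using face_of_Int_supporting_hyperplane_le[OF conv, where a = a and b = "\<psi> u + t"]
      face_of_Int_supporting_hyperplane_ge[OF conv, where a = a and b = "\<psi> u + t"]
    unfolding a[symmetric] by (auto simp: not_less[symmetric])
qed

text \<open>By convexity \<open>Q\<close> contains the section at \<open>t\<close> shrunk towards
  \<open>x\<close> by the factor \<open>1 - \<epsilon>\<close>, and the shrunken copy lies at the
  intermediate height. This simple bound suffices for semicontinuity.\<close>

lemma section_segment:
  assumes x: "x \<in> Q" "\<psi> x = \<psi> u + t1" and \<epsilon>: "0 \<le> \<epsilon>" "\<epsilon> < 1"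
  shows "ennreal ((1 - \<epsilon>) ^ card B) * section_volume t \<le> section_volume ((1 - \<epsilon>) * t + \<epsilon> * t1)"
proof -
  have "section_volume ((1 - \<epsilon>) * t + \<epsilon> * t1) =
     flat_integral B (indicator Q) (x + (1 - \<epsilon>) *\<^sub>R ((u + t *\<^sub>R w) - x))"
    unfolding section_volume_def
  proof (rule flat_integral_shift[OF finB])
    have "(u + ((1 - \<epsilon>) * t + \<epsilon> * t1) *\<^sub>R w) - (x + (1 - \<epsilon>) *\<^sub>R ((u + t *\<^sub>R w) - x)) =
      (- \<epsilon>) *\<^sub>R (x - (u + t1 *\<^sub>R w))" by (simp add: algebra_simps)
    also have "\<dots> \<in> span B" using height_converse[OF x] by (rule span_scale)
    finally show "(u + ((1 - \<epsilon>) * t + \<epsilon> * t1) *\<^sub>R w) - (x + (1 - \<epsilon>) *\<^sub>R ((u + t *\<^sub>R w) - x)) \<in> span B" .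
  qed simp
  also have "\<dots> = ennreal ((1 - \<epsilon>) ^ card B) *
      flat_integral B (\<lambda>y. indicator Q (x + (1 - \<epsilon>) *\<^sub>R (y - x))) (u + t *\<^sub>R w)"
    using \<epsilon> by (intro flat_integral_scale finB) auto
  also have "\<dots> \<ge> ennreal ((1 - \<epsilon>) ^ card B) * section_volume t"
    unfolding section_volume_def
  proof (intro mult_left_mono flat_integral_mono)
    fix y
    have "x + (1 - \<epsilon>) *\<^sub>R (y - x) \<in> Q" if "y \<in> Q"
    proof -
      have "x + (1 - \<epsilon>) *\<^sub>R (y - x) = \<epsilon> *\<^sub>R x + (1 - \<epsilon>) *\<^sub>R y" by (simp add: algebra_simps)
      then show ?thesis using that x(1) \<epsilon> Q by (auto intro!: convexD polytope_imp_convex)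
    qed
    then show "indicator Q y \<le> (indicator Q (x + (1 - \<epsilon>) *\<^sub>R (y - x)) :: ennreal)"
      by (auto simp: indicator_def)
  qed simp
  finally show ?thesis .
qed

text \<open>The reverse Fatou lemma, with the indicator of a large ball as dominating function; the
  pointwise estimate is the closedness of \<open>Q\<close>.\<close>

lemma section_usc:
  assumes X: "X \<longlonglongrightarrow> t"
  shows "limsup (\<lambda>n. section_volume (X n)) \<le> section_volume t"
proof -
  have "bounded Q" using Q by (rule polytope_imp_bounded)
  then obtain R where R: "\<And>x. x \<in> Q \<Longrightarrow> norm x \<le> R" by (auto simp: bounded_iff)
  have "Bseq X" using X by (meson convergentI convergent_imp_Bseq)
  then obtain K where K: "\<And>n. \<bar>X n\<bar> \<le> K" by (auto simp: Bseq_def)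
  let ?M = "Pi\<^sub>M B (\<lambda>_. lborel :: real measure)"
  let ?y = "\<lambda>s x. (u + s *\<^sub>R w) + (\<Sum>v\<in>B. x v *\<^sub>R v)"
  let ?D = "cball (0::'a) (R + K * norm w)"
  have [measurable]: "?D \<in> sets borel" by (simp add: borel_closed)
  have bound: "indicator Q (?y (X n) x) \<le> (indicator ?D (u + (\<Sum>v\<in>B. x v *\<^sub>R v)) :: ennreal)" for n x
  proof (cases "?y (X n) x \<in> Q")
    case True
    have "norm (u + (\<Sum>v\<in>B. x v *\<^sub>R v)) = norm (?y (X n) x - X n *\<^sub>R w)" by (simp add: algebra_simps)
    also have "\<dots> \<le> norm (?y (X n) x) + norm (X n *\<^sub>R w)" by (rule norm_triangle_ineq4)
    also have "\<dots> \<le> R + K * norm w"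
      using R[OF True] mult_right_mono[OF K, of "norm w" n] by (intro add_mono) auto
    finally show ?thesis by (simp add: indicator_def)
  qed simp
  have "limsup (\<lambda>n. section_volume (X n)) \<le> (\<integral>\<^sup>+x. limsup (\<lambda>n. indicator Q (?y (X n) x)) \<partial>?M)"
    unfolding section_volume_def flat_integral_def
  proof (rule nn_integral_limsup)
    show "(\<lambda>x. indicator ?D (u + (\<Sum>v\<in>B. x v *\<^sub>R v)) :: ennreal) \<in> borel_measurable ?M" by measurable
    show "AE x in ?M. indicator Q (?y (X n) x) \<le> (indicator ?D (u + (\<Sum>v\<in>B. x v *\<^sub>R v)) :: ennreal)" for n
      using bound by simp
    show "(\<integral>\<^sup>+x. indicator ?D (u + (\<Sum>v\<in>B. x v *\<^sub>R v)) \<partial>?M) < \<infinity>"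
      using flat_integral_finite[OF indB bounded_cball[of 0 "R + K * norm w"], of "indicator ?D" 1 u]
      unfolding flat_integral_def by (simp add: indicator_def)
  qed measurable
  also have "\<dots> \<le> section_volume t"
    unfolding section_volume_def flat_integral_def
  proof (rule nn_integral_mono)
    fix x
    show "limsup (\<lambda>n. indicator Q (?y (X n) x)) \<le> (indicator Q (?y t x) :: ennreal)"
    proof (cases "?y t x \<in> Q")
      case True
      have "limsup (\<lambda>n. indicator Q (?y (X n) x)) \<le> (1::ennreal)"
        by (intro Limsup_bounded) (auto simp: indicator_def)
      then show ?thesis using True by simp
    next
      case False
      have "open (- Q)" using Q by (simp add: polytope_imp_closed open_Compl)
      moreover have "(\<lambda>n. ?y (X n) x) \<longlonglongrightarrow> ?y t x" by (intro tendsto_intros X)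
      ultimately have "\<forall>\<^sub>F n in sequentially. ?y (X n) x \<in> - Q"
        using False topological_tendstoD by blast
      then have "limsup (\<lambda>n. indicator Q (?y (X n) x)) \<le> (0::ennreal)"
        by (intro Limsup_bounded) (auto elim!: eventually_mono)
      then show ?thesis using False by simp
    qed
  qed
  finally show ?thesis .
qed

text \<open>If the section has positive volume, \<open>Q\<close> has points strictly above and
  strictly below it. A nearby section contains a copy of it, slightly shrunk towards the point on
  the matching side.\<close>

lemma section_lsc:
  assumes X: "X \<longlonglongrightarrow> t"
  shows "section_volume t \<le> liminf (\<lambda>n. section_volume (X n))"
proof (cases "section_volume t = 0")
  case False
  obtain x1 x2 where x: "x1 \<in> Q" "\<psi> u + t < \<psi> x1" "x2 \<in> Q" "\<psi> x2 < \<psi> u + t"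
    using section_pos_interior[OF False] by auto
  define t1 where "t1 = \<psi> x1 - \<psi> u"
  define t2 where "t2 = \<psi> x2 - \<psi> u"
  have t12: "t < t1" "t2 < t" "\<psi> x1 = \<psi> u + t1" "\<psi> x2 = \<psi> u + t2" using x by (auto simp: t1_def t2_def)
  \<comment> \<open>The weight with which \<open>s\<close> is a convex combination of
    \<open>t\<close> and \<open>t1\<close> if it lies above \<open>t\<close>, or of \<open>t\<close>
    and \<open>t2\<close> if below. The quotient for the wrong side is nonpositive, so
    \<open>max\<close> selects the right one.\<close>
  define \<epsilon> where "\<epsilon> s = max ((s - t) / (t1 - t)) ((t - s) / (t - t2))" for s
  have lower: "ennreal ((1 - \<epsilon> s) ^ card B) * section_volume t \<le> section_volume s" if "\<epsilon> s < 1" for s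
  proof (cases "t \<le> s")
    case True
    then have "(t - s) / (t - t2) \<le> 0" "0 \<le> (s - t) / (t1 - t)" using t12 by (auto simp: divide_le_0_iff)
    then have e: "\<epsilon> s = (s - t) / (t1 - t)" unfolding \<epsilon>_def by linarith
    then have "0 \<le> \<epsilon> s" using True t12 by simp
    moreover have "(1 - \<epsilon> s) * t + \<epsilon> s * t1 = s"
    proof -
      have "\<epsilon> s * (t1 - t) = s - t" using t12 by (simp add: e)
      then show ?thesis by (simp add: algebra_simps)
    qed
    ultimately show ?thesis using section_segment[OF x(1) t12(3), of "\<epsilon> s" t] that by simp
  next
    case False
    then have "0 \<le> (t - s) / (t - t2)" "(s - t) / (t1 - t) \<le> 0" using t12 by (auto simp: divide_le_0_iff)
    then have e: "\<epsilon> s = (t - s) / (t - t2)" unfolding \<epsilon>_def by linarith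
    then have "0 \<le> \<epsilon> s" using False t12 by simp
    moreover have "(1 - \<epsilon> s) * t + \<epsilon> s * t2 = s"
    proof -
      have "\<epsilon> s * (t - t2) = t - s" using t12 by (simp add: e)
      then show ?thesis by (simp add: algebra_simps)
    qed
    ultimately show ?thesis using section_segment[OF x(3) t12(4), of "\<epsilon> s" t] that by simp
  qed
  have \<epsilon>t: "(\<lambda>n. \<epsilon> (X n)) \<longlonglongrightarrow> 0"
  proof -
    have "(\<lambda>n. \<epsilon> (X n)) \<longlonglongrightarrow> max ((t - t) / (t1 - t)) ((t - t) / (t - t2))"
      unfolding \<epsilon>_def using t12 by (intro tendsto_intros X) auto
    then show ?thesis by simp
  qed
  have ev: "\<forall>\<^sub>F n in sequentially. \<epsilon> (X n) < 1" using order_tendstoD(2)[OF \<epsilon>t] by simp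
  have "(\<lambda>n. ennreal ((1 - \<epsilon> (X n)) ^ card B) * section_volume t) \<longlonglongrightarrow> ennreal ((1 - 0) ^ card B) * section_volume t"
    using section_finite by (intro tendsto_mult_ennreal tendsto_ennrealI tendsto_intros \<epsilon>t) auto
  then have "liminf (\<lambda>n. ennreal ((1 - \<epsilon> (X n)) ^ card B) * section_volume t) = section_volume t"
    using lim_imp_Liminf[OF sequentially_bot] by fastforce
  moreover have "liminf (\<lambda>n. ennreal ((1 - \<epsilon> (X n)) ^ card B) * section_volume t) \<le> liminf (\<lambda>n. section_volume (X n))"
    by (rule Liminf_mono) (use ev lower in \<open>auto elim!: eventually_mono\<close>)
  ultimately show ?thesis by simp
qed simp

lemma section_continuous: "continuous_on UNIV (\<lambda>t. enn2real (section_volume t))"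
proof -
  have "isCont (\<lambda>t. enn2real (section_volume t)) t" for t
    unfolding continuous_at_sequentially
  proof (intro allI impI)
    fix X assume X: "X \<longlonglongrightarrow> t"
    have "liminf (\<lambda>n. section_volume (X n)) \<le> limsup (\<lambda>n. section_volume (X n))"
      by (rule Liminf_le_Limsup) simp
    then have "liminf (\<lambda>n. section_volume (X n)) = section_volume t"
      "limsup (\<lambda>n. section_volume (X n)) = section_volume t"
      using section_usc[OF X] section_lsc[OF X] by (auto intro!: antisym)
    then have "(\<lambda>n. section_volume (X n)) \<longlonglongrightarrow> section_volume t"
      by (simp add: tendsto_iff_Liminf_eq_Limsup)
    then show "((\<lambda>t. enn2real (section_volume t)) \<circ> X) \<longlonglongrightarrow> enn2real (section_volume t)"
      unfolding comp_def using section_finite[of t] by (intro tendsto_enn2real) auto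
  qed
  then show ?thesis by (simp add: continuous_on_eq_continuous_at)
qed

lemma total_sections:
  assumes [measurable]: "g \<in> borel_measurable borel"
  shows "flat_integral (insert w B) (\<lambda>x. indicator Q x * ennreal (g (\<psi> x - \<psi> u))) u =
    (\<integral>\<^sup>+t. section_volume t * ennreal (g t) \<partial>lborel)"
proof -
  have "flat_integral (insert w B) (\<lambda>x. indicator Q x * ennreal (g (\<psi> x - \<psi> u))) u =
     (\<integral>\<^sup>+t. flat_integral B (\<lambda>x. indicator Q x * ennreal (g (\<psi> x - \<psi> u))) (u + t *\<^sub>R w) \<partial>lborel)"
    by (rule flat_integral_insert[OF finB wB]) measurable
  also have "\<dots> = (\<integral>\<^sup>+t. section_volume t * ennreal (g t) \<partial>lborel)"
  proof (rule nn_integral_cong)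
    fix t :: real
    have "flat_integral B (\<lambda>x. indicator Q x * ennreal (g (\<psi> x - \<psi> u))) (u + t *\<^sub>R w) =
      flat_integral B (\<lambda>x. ennreal (g t) * indicator Q x) (u + t *\<^sub>R w)"
      by (rule flat_integral_cong) (simp add: height mult.commute)
    then show "flat_integral B (\<lambda>x. indicator Q x * ennreal (g (\<psi> x - \<psi> u))) (u + t *\<^sub>R w) =
      section_volume t * ennreal (g t)"
      by (simp add: flat_integral_cmult section_volume_def mult.commute)
  qed
  finally show ?thesis .
qed

theorem sum_integer_sections:
  assumes vert: "\<And>v. v extreme_point_of Q \<Longrightarrow> \<psi> v - \<psi> u \<in> \<int>"
  shows "((\<lambda>n::int. enn2real (section_volume (of_int n))) has_sum
     enn2real (flat_integral (insert w B) (indicator Q) u)) UNIV"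
proof (cases "aff_dim Q = int (card (insert w B))")
  case True
  define l where "l = card (insert w B)"
  have l: "l \<ge> 1" using finB wB by (simp add: l_def)
  let ?T = "\<psi> ` {v. v extreme_point_of Q}"
  have "bounded (\<psi> ` Q)"
    using Q lin by (intro bounded_linear_image) (auto simp: polytope_imp_bounded linear_linear)
  then obtain a where a: "\<psi> ` Q \<subseteq> {-a..a}" using bounded_subset_cbox_symmetric by (metis cbox_interval real_inner_1_right)
  obtain c where c: "is_spline l {-a..a} ?T
      (\<lambda>g. flat_integral (insert w B) (\<lambda>x. indicator Q x * ennreal (g (\<psi> x))) u) c"
    using polytope_height_spline[OF Q _ lin edges ind _ Qsp a] True unfolding l_def by blast
  define V where "V = enn2real (flat_integral (insert w B) (indicator Q) u)"
  have "flat_integral (insert w B) (indicator Q) u < \<infinity>"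
    by (rule flat_integral_finite[OF ind, where S = Q and K = 1])
      (use Q in \<open>auto simp: polytope_imp_bounded indicator_def\<close>)
  then have V: "flat_integral (insert w B) (indicator Q) u = ennreal V" by (simp add: V_def)
  have supp: "enn2real (section_volume t) = 0" if "\<bar>t\<bar> > a + \<bar>\<psi> u\<bar>" for t
  proof -
    have "Q \<inter> {x. \<psi> x = \<psi> u + t} = {}" using a that by fastforce
    then have "section_volume t = 0" by (intro section_null) simp
    then show ?thesis by simp
  qed
  have "((\<lambda>n::int. enn2real (section_volume (of_int n))) has_sum V) UNIV"
  proof (rule sum_integers_eq_integral[OF section_continuous _ supp])
    fix g F :: "real \<Rightarrow> real"
    assume g: "continuous_on UNIV g" "periodic1 g" "\<And>x. 0 \<le> g x"
      and F: "\<And>x. (F has_real_derivative g x) (at x)"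
    have [measurable]: "g \<in> borel_measurable borel" using g(1) by (rule borel_measurable_continuous_onI)
    have "flat_integral (insert w B) (\<lambda>x. indicator Q x * ennreal (g (\<psi> x - \<psi> u))) u =
       ennreal ((F 1 - F 0) * V)"
      by (rule is_spline_periodic[OF c l _ g F, where \<sigma> = "\<psi> u"]) (use vert V in \<open>auto simp: V_def\<close>)
    then show "(\<integral>\<^sup>+t. ennreal (enn2real (section_volume t)) * ennreal (g t) \<partial>lborel) =
        ennreal ((F 1 - F 0) * V)"
      using total_sections[of g] section_finite by (simp add: less_top)
  qed (auto simp: V_def)
  then show ?thesis by (simp add: V_def)
next
  \<comment> \<open>Degenerate slices do occur, for instance when the slice meets \<open>P\<close>
    in a vertex only. The total is then 0, and so is each section: either \<psi> is constant on
    \<open>Q\<close>, which is then at most a point, or slicing lowers the dimension once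
    more.\<close>
  case False
  have "aff_dim Q \<le> int (card (insert w B))"
  proof (cases "Q = {}")
    case Qne: False
    then obtain q where "q \<in> Q" by auto
    then obtain C where C: "independent C" "aff_dim Q = int (card C)" "C \<subseteq> (\<lambda>x. x - q) ` Q"
      using translate_basis[of q Q] by metis
    have "x - q \<in> span (insert w B)" if "x \<in> Q" for x
      using span_diff[OF Qsp[OF that] Qsp[OF \<open>q \<in> Q\<close>]] by simp
    then have "C \<subseteq> span (insert w B)" using C(3) by auto
    then have "card C \<le> card (insert w B)"
      using C(1) finB by (intro independent_span_bound[THEN conjunct2]) auto
    then show ?thesis using C(2) by simp
  qed simp
  then have low: "aff_dim Q < int (card (insert w B))" using False by simp
  have "flat_integral (insert w B) (indicator Q) u = 0"
    by (rule flat_integral_null[OF ind affine_affine_hull[of Q]])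
      (use low in \<open>auto simp: indicator_def hull_inc\<close>)
  moreover have "section_volume t = 0" for t
  proof (rule section_null)
    let ?S = "Q \<inter> {x. \<psi> x = \<psi> u + t}"
    show "aff_dim ?S < int (card B)"
    proof (cases "\<psi> constant_on Q")
      case True
      then have "aff_dim Q \<le> 0"
        using Q by (intro face_constant_dim face_of_refl polytope_imp_convex)
      moreover have "aff_dim ?S \<le> aff_dim Q" by (rule aff_dim_subset) auto
      ultimately show ?thesis using cardB by simp
    next
      case False
      obtain a where a: "\<And>x. \<psi> x = a \<bullet> x" using inner_repr by blast
      have "\<not> Q \<subseteq> {x. a \<bullet> x = \<psi> u + t}" using False unfolding a[symmetric] by (auto simp: constant_on_def)
      have "affine hull ?S \<noteq> affine hull Q"
      proof
        assume eq: "affine hull ?S = affine hull Q"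
        have "affine hull ?S \<subseteq> {x. a \<bullet> x = \<psi> u + t}"
          by (rule hull_minimal) (auto simp: a affine_hyperplane)
        then show False using eq \<open>\<not> Q \<subseteq> _\<close> hull_subset[of Q affine] by auto
      qed
      moreover have "affine hull ?S \<subseteq> affine hull Q" by (rule hull_mono) auto
      ultimately have "aff_dim (affine hull ?S) < aff_dim (affine hull Q)"
        by (intro aff_dim_psubset) auto
      then show ?thesis using low finB wB by simp
    qed
  qed
  ultimately show ?thesis by simp
qed

end

section \<open>Lattices in coordinates\<close>

lemma int_basis_empty: "int_basis {} {0}"
  by (simp add: int_basis_def independent_empty)

lemma int_subgroup_generator:
  fixes S :: "int set"
  assumes "\<And>x y. x \<in> S \<Longrightarrow> y \<in> S \<Longrightarrow> x - y \<in> S" "x0 \<in> S" "x0 \<noteq> 0"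
  obtains m where "m \<in> S" "m > 0" "\<And>x. x \<in> S \<Longrightarrow> m dvd x"
proof -
  have z: "0 \<in> S" using assms(1)[OF assms(2,2)] by simp
  have neg: "- x \<in> S" if "x \<in> S" for x using assms(1)[OF z that] by simp
  have add: "x + y \<in> S" if "x \<in> S" "y \<in> S" for x y using assms(1)[OF that(1) neg[OF that(2)]] by simp
  have "\<exists>n::nat. n > 0 \<and> int n \<in> S"
  proof (cases "x0 > 0")
    case True then show ?thesis using assms(2) by (intro exI[of _ "nat x0"]) auto
  next
    case False then show ?thesis using neg[OF assms(2)] assms(3) by (intro exI[of _ "nat (- x0)"]) auto
  qed
  then obtain n :: nat where n: "n > 0" "int n \<in> S" and min: "\<And>k::nat. k < n \<Longrightarrow> \<not> (k > 0 \<and> int k \<in> S)"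
    using exists_least_iff[of "\<lambda>n. n > 0 \<and> int n \<in> S"] by blast
  have mult: "int n * q \<in> S" for q
  proof (induction q rule: int_induct[where k = 0])
    case (step1 i) then show ?case using add[OF step1(2) n(2)] by (simp add: algebra_simps)
  next
    case (step2 i) then show ?case using assms(1)[OF step2(2) n(2)] by (simp add: algebra_simps)
  qed (simp add: z)
  have "int n dvd x" if "x \<in> S" for x
  proof -
    have "x mod int n = x - int n * (x div int n)" by (simp add: minus_mult_div_eq_mod)
    then have "x mod int n \<in> S" using assms(1)[OF that mult] by simp
    moreover have "0 \<le> x mod int n" "x mod int n < int n" using n(1) by simp_all
    ultimately have "x mod int n = 0" using min[of "nat (x mod int n)"] by fastforce
    then show ?thesis by auto
  qed
  then show thesis using n that[of "int n"] by auto
qed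

text \<open>The values of \<psi> on \<Gamma> form a nonzero subgroup of the integers, generated by
  some \<open>\<psi> w\<close>; subtracting a multiple of \<open>w\<close> moves any element into
  the kernel. As \<open>\<psi> w\<close> need not be 1, the divisibility of all values is part of
  the conclusion.\<close>

lemma int_basis_extend:
  fixes \<Gamma> :: "'a::euclidean_space set" and \<psi> :: "'a \<Rightarrow> real"
  assumes B: "int_basis B {x \<in> \<Gamma>. \<psi> x = 0}" and diff: "\<And>x y. x \<in> \<Gamma> \<Longrightarrow> y \<in> \<Gamma> \<Longrightarrow> x - y \<in> \<Gamma>"
    and lin: "linear \<psi>" and int: "\<And>x. x \<in> \<Gamma> \<Longrightarrow> \<psi> x \<in> \<int>" and z: "z \<in> \<Gamma>" "\<psi> z \<noteq> 0"
  obtains w where "w \<in> \<Gamma>" "\<psi> w \<noteq> 0" "int_basis (insert w B) \<Gamma>"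
    "\<And>x. x \<in> \<Gamma> \<Longrightarrow> \<exists>n::int. \<psi> x = of_int n * \<psi> w"
proof -
  define S where "S = {n::int. \<exists>x\<in>\<Gamma>. \<psi> x = of_int n}"
  have "a - b \<in> S" if ab: "a \<in> S" "b \<in> S" for a b
  proof -
    obtain x y where "x \<in> \<Gamma>" "y \<in> \<Gamma>" "\<psi> x = of_int a" "\<psi> y = of_int b" using ab by (auto simp: S_def)
    then have "x - y \<in> \<Gamma>" "\<psi> (x - y) = of_int (a - b)" using diff by (simp_all add: linear_diff[OF lin])
    then show ?thesis unfolding S_def by blast
  qed
  moreover obtain n0 :: int where "\<psi> z = of_int n0" using int[OF z(1)] by (auto elim: Ints_cases)
  then have "n0 \<in> S" "n0 \<noteq> 0" using z by (auto simp: S_def)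
  ultimately obtain m where m: "m \<in> S" "m > 0" "\<And>x. x \<in> S \<Longrightarrow> m dvd x"
    using int_subgroup_generator[of S n0] by blast
  obtain w where w: "w \<in> \<Gamma>" "\<psi> w = of_int m" using m(1) by (auto simp: S_def)
  have div: "\<exists>n::int. \<psi> x = of_int n * \<psi> w" if x: "x \<in> \<Gamma>" for x
  proof -
    obtain a :: int where a: "\<psi> x = of_int a" using int[OF x] by (auto elim: Ints_cases)
    then have "m dvd a" using x m(3) by (auto simp: S_def)
    then obtain n where "a = m * n" by auto
    then show ?thesis using a w by (intro exI[of _ n]) simp
  qed
  have zero: "0 \<in> \<Gamma>" using diff[OF z(1) z(1)] by simp
  have neg: "- x \<in> \<Gamma>" if "x \<in> \<Gamma>" for x using diff[OF zero that] by simp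
  have add: "x + y \<in> \<Gamma>" if "x \<in> \<Gamma>" "y \<in> \<Gamma>" for x y using diff[OF that(1) neg[OF that(2)]] by simp
  have mult: "of_int n *\<^sub>R w \<in> \<Gamma>" for n
  proof (induction n rule: int_induct[where k = 0])
    case (step1 i) then show ?case using add[OF step1(2) w(1)] by (simp add: algebra_simps)
  next
    case (step2 i) then show ?case using diff[OF step2(2) w(1)] by (simp add: algebra_simps)
  qed (simp add: zero)
  have indB: "independent B" using B by (simp add: int_basis_def)
  have finB: "finite B" using indB by (rule independent_imp_finite)
  have B0: "\<psi> v = 0" if "v \<in> B" for v using int_basis_subset[OF B] that by auto
  have wB: "w \<notin> span B"
  proof
    assume "w \<in> span B"
    then have "\<psi> w = 0" using linear_eq_0_on_span[OF lin B0] by blast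
    then show False using w m by simp
  qed
  then have "w \<notin> B" by (auto intro: span_base)
  have "\<Gamma> = range (\<lambda>c :: 'a \<Rightarrow> int. \<Sum>v\<in>insert w B. of_int (c v) *\<^sub>R v)"
  proof (intro equalityI subsetI)
    fix x assume x: "x \<in> \<Gamma>"
    obtain n :: int where n: "\<psi> x = of_int n * \<psi> w" using div[OF x] by auto
    have "x - of_int n *\<^sub>R w \<in> {x \<in> \<Gamma>. \<psi> x = 0}"
      using diff[OF x mult] n by (simp add: linear_diff[OF lin] linear_cmul[OF lin])
    then obtain c where c: "x - of_int n *\<^sub>R w = (\<Sum>v\<in>B. of_int (c v) *\<^sub>R v)"
      using int_basis_memE[OF B] by blast
    have "(\<Sum>v\<in>B. of_int ((c(w := n)) v) *\<^sub>R v) = (\<Sum>v\<in>B. of_int (c v) *\<^sub>R v)"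
      using \<open>w \<notin> B\<close> by (intro sum.cong) auto
    then have "x = (\<Sum>v\<in>insert w B. of_int ((c(w := n)) v) *\<^sub>R v)"
      using c finB \<open>w \<notin> B\<close> by (simp add: algebra_simps)
    then show "x \<in> range (\<lambda>c :: 'a \<Rightarrow> int. \<Sum>v\<in>insert w B. of_int (c v) *\<^sub>R v)"
      by (rule image_eqI[of _ _ "c(w := n)"]) simp
  next
    fix x assume "x \<in> range (\<lambda>c :: 'a \<Rightarrow> int. \<Sum>v\<in>insert w B. of_int (c v) *\<^sub>R v)"
    then obtain c :: "'a \<Rightarrow> int" where c: "x = (\<Sum>v\<in>insert w B. of_int (c v) *\<^sub>R v)" by blast
    have "(\<Sum>v\<in>B. of_int (c v) *\<^sub>R v) \<in> {x \<in> \<Gamma>. \<psi> x = 0}" by (rule int_basis_memI[OF B]) simp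
    then show "x \<in> \<Gamma>" using c finB \<open>w \<notin> B\<close> add[OF mult] by simp
  qed
  then have "int_basis (insert w B) \<Gamma>"
    using wB indB \<open>w \<notin> B\<close> by (simp add: int_basis_def independent_insert)
  then show thesis using that[of w] w m div by auto
qed

locale lattice_coordinates =
  fixes \<Lambda> :: "'a::euclidean_space set" and e :: "nat \<Rightarrow> 'a"
  assumes lattice: "lattice_basis DIM('a) e \<Lambda>"
begin

declare One_nat_def [simp del]

definition coord :: "nat \<Rightarrow> 'a \<Rightarrow> real" where
  "coord i v = representation (e ` {1..DIM('a)}) v (e i)"

lemma e_inj: "inj_on e {1..DIM('a)}" and e_indep: "independent (e ` {1..DIM('a)})"
  and \<Lambda>_eq: "\<Lambda> = lattice_gen e {1..DIM('a)}"
  using lattice by (simp_all add: lattice_basis_def)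

lemma e_span: "span (e ` {1..DIM('a)}) = UNIV"
proof -
  have "card (e ` {1..DIM('a)}) = DIM('a)" using e_inj by (simp add: card_image)
  then show ?thesis using e_indep by (metis dim_eq_card_independent dim_eq_full)
qed

lemma coord_linear: "linear (coord i)"
  unfolding coord_def
  by (rule linearI) (simp_all add: representation_add[OF e_indep] representation_scale[OF e_indep] e_span)

lemma coord_diff [simp]: "coord i (x - y) = coord i x - coord i y"
  and coord_add [simp]: "coord i (x + y) = coord i x + coord i y"
  and coord_scale [simp]: "coord i (a *\<^sub>R x) = a * coord i x"
  and coord_zero [simp]: "coord i 0 = 0"
  and coord_sum: "coord i (sum f A) = (\<Sum>x\<in>A. coord i (f x))"
  using linear_diff[OF coord_linear] linear_add[OF coord_linear] linear_cmul[OF coord_linear]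
    linear_0[OF coord_linear] linear_sum[OF coord_linear] by simp_all

lemma coord_e: "i \<in> {1..DIM('a)} \<Longrightarrow> l \<in> {1..DIM('a)} \<Longrightarrow> coord i (e l) = (if i = l then 1 else 0)"
  using e_inj unfolding coord_def by (auto simp: representation_basis[OF e_indep] inj_on_eq_iff)

lemma coord_combination:
  assumes "I \<subseteq> {1..DIM('a)}" "i \<in> {1..DIM('a)}"
  shows "coord i (\<Sum>l\<in>I. a l *\<^sub>R e l) = (if i \<in> I then a i else 0)"
proof -
  have fin: "finite I" using assms(1) finite_subset by blast
  have "coord i (\<Sum>l\<in>I. a l *\<^sub>R e l) = (\<Sum>l\<in>I. if l = i then a l else 0)"
    unfolding coord_sum using assms by (intro sum.cong) (auto simp: coord_e subset_iff)
  then show ?thesis using fin by simp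
qed

lemma coord_expand: "v = (\<Sum>i\<in>{1..DIM('a)}. coord i v *\<^sub>R e i)"
proof -
  have "v \<in> span (e ` {1..DIM('a)})" by (simp add: e_span)
  then obtain a where "v = (\<Sum>u\<in>e ` {1..DIM('a)}. a u *\<^sub>R u)" by (auto simp: span_finite)
  then have v: "v = (\<Sum>i\<in>{1..DIM('a)}. a (e i) *\<^sub>R e i)" using e_inj by (simp add: sum.reindex)
  have "coord i v = a (e i)" if "i \<in> {1..DIM('a)}" for i
    using that by (subst v) (simp add: coord_combination)
  then show ?thesis using v by simp
qed

lemma coord_eqI:
  assumes "\<And>i. i \<in> {1..DIM('a)} \<Longrightarrow> coord i x = coord i y" shows "x = y"
  by (subst coord_expand[of x], subst coord_expand[of y]) (use assms in simp)

lemma lattice_gen_iff: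
  assumes "I \<subseteq> {1..DIM('a)}"
  shows "v \<in> lattice_gen e I \<longleftrightarrow> (\<forall>i\<in>{1..DIM('a)}. (i \<in> I \<longrightarrow> coord i v \<in> \<int>) \<and> (i \<notin> I \<longrightarrow> coord i v = 0))"
proof
  assume "v \<in> lattice_gen e I"
  then obtain c :: "nat \<Rightarrow> int" where "v = (\<Sum>i\<in>I. of_int (c i) *\<^sub>R e i)" by (auto simp: lattice_gen_def)
  then show "\<forall>i\<in>{1..DIM('a)}. (i \<in> I \<longrightarrow> coord i v \<in> \<int>) \<and> (i \<notin> I \<longrightarrow> coord i v = 0)"
    using assms by (simp add: coord_combination)
next
  assume *: "\<forall>i\<in>{1..DIM('a)}. (i \<in> I \<longrightarrow> coord i v \<in> \<int>) \<and> (i \<notin> I \<longrightarrow> coord i v = 0)"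
  have "v = (\<Sum>i\<in>I. of_int \<lfloor>coord i v\<rfloor> *\<^sub>R e i)"
  proof (rule coord_eqI)
    fix i assume i: "i \<in> {1..DIM('a)}"
    then have "i \<in> I \<Longrightarrow> of_int \<lfloor>coord i v\<rfloor> = coord i v" using * by (auto elim: Ints_cases)
    then show "coord i v = coord i (\<Sum>i\<in>I. of_int \<lfloor>coord i v\<rfloor> *\<^sub>R e i)"
      using * i assms by (simp add: coord_combination)
  qed
  then show "v \<in> lattice_gen e I" unfolding lattice_gen_def
    by (rule image_eqI[of _ _ "\<lambda>i. \<lfloor>coord i v\<rfloor>"]) simp
qed

lemma \<Lambda>_iff: "v \<in> \<Lambda> \<longleftrightarrow> (\<forall>i\<in>{1..DIM('a)}. coord i v \<in> \<int>)"
  unfolding \<Lambda>_eq by (subst lattice_gen_iff) auto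

lemma \<Lambda>_diff: "x \<in> \<Lambda> \<Longrightarrow> y \<in> \<Lambda> \<Longrightarrow> x - y \<in> \<Lambda>"
  and \<Lambda>_add: "x \<in> \<Lambda> \<Longrightarrow> y \<in> \<Lambda> \<Longrightarrow> x + y \<in> \<Lambda>"
  and \<Lambda>_scale: "x \<in> \<Lambda> \<Longrightarrow> of_int n *\<^sub>R x \<in> \<Lambda>"
  by (simp_all add: \<Lambda>_iff)

text \<open>Indexed by the coordinates kept and not, like \<open>coord_proj\<close>, by those
  forgotten, because the induction runs over the number of fixed coordinates.\<close>

definition proj :: "nat \<Rightarrow> 'a \<Rightarrow> 'a" where
  "proj j x = (\<Sum>i\<in>{1..j}. coord i x *\<^sub>R e i)"

lemma coord_proj_eq: "j \<le> DIM('a) \<Longrightarrow> coord_proj e (DIM('a) - j) = proj j"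
  by (simp add: fun_eq_iff coord_proj_def proj_def coord_def)

lemma coord_proj:
  assumes "j \<le> DIM('a)" "i \<in> {1..DIM('a)}"
  shows "coord i (proj j x) = (if i \<le> j then coord i x else 0)"
  using assms unfolding proj_def by (subst coord_combination) auto

lemma proj_eq_iff:
  assumes "j \<le> DIM('a)"
  shows "proj j x = proj j y \<longleftrightarrow> (\<forall>i\<in>{1..j}. coord i x = coord i y)"
proof
  assume eq: "proj j x = proj j y"
  show "\<forall>i\<in>{1..j}. coord i x = coord i y"
  proof
    fix i assume "i \<in> {1..j}"
    then show "coord i x = coord i y"
      using coord_proj[OF assms, of i x] coord_proj[OF assms, of i y] assms by (simp add: eq)
  qed
qed (simp add: proj_def)

lemma proj_linear: "linear (proj j)"
  unfolding proj_def by (rule linearI) (simp_all add: sum.distrib scaleR_add_left scaleR_sum_right)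

lemma proj_proj: "i \<le> j \<Longrightarrow> j \<le> DIM('a) \<Longrightarrow> proj i (proj j x) = proj i x"
  by (subst proj_eq_iff) (auto simp: coord_proj)

lemma proj_in_span: "proj j x \<in> span (e ` {1..j})"
  unfolding proj_def by (intro span_sum span_scale span_base) auto

lemma dim_span_e: "j \<le> DIM('a) \<Longrightarrow> dim (span (e ` {1..j})) = j"
proof -
  assume j: "j \<le> DIM('a)"
  then have "{1..j} \<subseteq> {1..DIM('a)}" by auto
  then have "inj_on e {1..j}" "independent (e ` {1..j})"
    using e_inj independent_mono[OF e_indep image_mono] by (auto intro: inj_on_subset)
  then show ?thesis by (simp add: dim_eq_card_independent card_image)
qed

text \<open>For \<open>j \<le> DIM('a)\<close> this is the kernel of \<open>proj j\<close>.\<close>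

definition zero_upto :: "nat \<Rightarrow> 'a set" where
  "zero_upto j = {v. \<forall>i\<in>{1..j}. coord i v = 0}"

lemma subspace_zero_upto: "subspace (zero_upto j)"
  unfolding subspace_def zero_upto_def by simp

lemma zero_upto_0: "zero_upto 0 = UNIV"
  by (simp add: zero_upto_def)

lemma zero_upto_Suc: "zero_upto (Suc j) = {v \<in> zero_upto j. coord (Suc j) v = 0}"
  by (auto simp: zero_upto_def atLeastAtMostSuc_conv)

lemma lattice_gen_upper:
  assumes "j \<le> DIM('a)" shows "lattice_gen e {j + 1..DIM('a)} = \<Lambda> \<inter> zero_upto j"
proof -
  have "v \<in> lattice_gen e {j + 1..DIM('a)} \<longleftrightarrow> v \<in> \<Lambda> \<inter> zero_upto j" for v
    using assms by (subst lattice_gen_iff) (auto simp: \<Lambda>_iff zero_upto_def)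
  then show ?thesis by auto
qed

text \<open>Downward induction: with all coordinates fixed only 0 is left, and releasing one
  coordinate adds at most one basis vector. Nothing is claimed about the rank here, since an
  arbitrary subspace may contain few lattice points.\<close>

lemma sublattice_int_basis:
  assumes "subspace L" "j \<le> DIM('a)"
  shows "\<exists>B. int_basis B (L \<inter> \<Lambda> \<inter> zero_upto j)"
  using assms(2)
proof (induction j rule: inc_induct)
  case base
  have "L \<inter> \<Lambda> \<inter> zero_upto DIM('a) = {0}"
    using assms(1) by (auto simp: zero_upto_def subspace_0 \<Lambda>_iff intro: coord_eqI)
  then show ?case using int_basis_empty by auto
next
  case (step j)
  let ?G = "L \<inter> \<Lambda> \<inter> zero_upto j"
  have G': "L \<inter> \<Lambda> \<inter> zero_upto (Suc j) = {x \<in> ?G. coord (Suc j) x = 0}" by (auto simp: zero_upto_Suc)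
  obtain B where B: "int_basis B {x \<in> ?G. coord (Suc j) x = 0}" using step.IH unfolding G' by blast
  show ?case
  proof (cases "\<exists>z\<in>?G. coord (Suc j) z \<noteq> 0")
    case True
    then obtain z where z: "z \<in> ?G" "coord (Suc j) z \<noteq> 0" by blast
    have "x - y \<in> ?G" if "x \<in> ?G" "y \<in> ?G" for x y
      using that assms(1) subspace_zero_upto by (auto intro: subspace_diff \<Lambda>_diff)
    moreover have "coord (Suc j) x \<in> \<int>" if "x \<in> ?G" for x using that step.hyps by (auto simp: \<Lambda>_iff)
    ultimately show ?thesis
      using int_basis_extend[OF B _ coord_linear _ z] by metis
  next
    case False
    then have "{x \<in> ?G. coord (Suc j) x = 0} = ?G" by blast
    then show ?thesis using B by metis
  qed
qed

end

section \<open>Slices of integral polytopes\<close>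

lemma polytope_point_in_rel_interior_face:
  fixes P :: "'a::euclidean_space set"
  assumes "polytope P" "w \<in> P"
  obtains F where "F face_of P" "w \<in> rel_interior F"
proof -
  have "\<exists>F. F face_of P \<and> w \<in> rel_interior F"
    using assms
  proof (induction "nat (aff_dim P + 1)" arbitrary: P rule: less_induct)
    case less
    show ?case
    proof (cases "w \<in> rel_interior P")
      case True
      then show ?thesis using less.prems(1) by (auto intro: face_of_refl polytope_imp_convex)
    next
      case False
      then obtain F where F: "F facet_of P" "w \<in> F"
        using less.prems rel_interior_of_polyhedron[of P] by (auto simp: polytope_imp_polyhedron)
      have "aff_dim F \<ge> 0" using F(2) by (metis aff_dim_negative_iff empty_iff not_less)
      then have "nat (aff_dim F + 1) < nat (aff_dim P + 1)" using F(1) by (simp add: facet_of_def)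
      moreover have "polytope F"
        using F(1) less.prems(1) by (meson face_of_polytope_polytope facet_of_imp_face_of)
      ultimately obtain E where "E face_of F" "w \<in> rel_interior E" using less.hyps F(2) by blast
      then show ?thesis using F(1) face_of_trans facet_of_imp_face_of by blast
    qed
  qed
  then show thesis using that by blast
qed

lemma rel_interior_direction:
  fixes F :: "'a::euclidean_space set"
  assumes "w \<in> rel_interior F" "x \<in> affine hull F" "x' \<in> affine hull F"
  obtains \<epsilon> where "\<epsilon> > 0" "w + \<epsilon> *\<^sub>R (x - x') \<in> F" "w - \<epsilon> *\<^sub>R (x - x') \<in> F"
proof -
  obtain r where r: "r > 0" "cball w r \<inter> affine hull F \<subseteq> F" and w: "w \<in> F"
    using assms(1) by (auto simp: mem_rel_interior_cball)
  have wF: "w \<in> affine hull F" using w by (rule hull_inc)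
  define \<epsilon> where "\<epsilon> = r / (norm (x - x') + 1)"
  have n: "norm (x - x') + 1 > 0" by (simp add: add_nonneg_pos)
  then have \<epsilon>: "\<epsilon> > 0" using r(1) by (simp add: \<epsilon>_def)
  have "\<epsilon> * norm (x - x') \<le> \<epsilon> * (norm (x - x') + 1)" using \<epsilon> by simp
  also have "\<dots> = r" using n by (simp add: \<epsilon>_def)
  finally have small: "norm (\<epsilon> *\<^sub>R (x - x')) \<le> r" using \<epsilon> by simp
  have aff: "w + c *\<^sub>R (x - x') \<in> affine hull F" for c
    using mem_affine_3_minus[OF affine_affine_hull wF assms(2,3)] .
  have "w + \<epsilon> *\<^sub>R (x - x') \<in> F"
    using r(2) aff[of \<epsilon>] small by (auto simp: dist_norm)
  moreover have "w + (- \<epsilon>) *\<^sub>R (x - x') \<in> F"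
    using r(2) aff[of "- \<epsilon>"] small by (auto simp: dist_norm)
  ultimately show thesis using \<epsilon> that by simp
qed

locale integral_polytope = lattice_coordinates +
  fixes P :: "'a set" and d k :: nat
  assumes k_pos: "0 < k" and k_less: "k < d" and d_le: "d \<le> DIM('a)"
    and P: "polytope P" and dim_P: "aff_dim P = int d"
    and integral: "k_integral \<Lambda> e (k - 1) P" and general: "k_general_position e k P"
begin

declare One_nat_def [simp del]

lemma k_le: "k \<le> DIM('a)" using k_less d_le by simp

lemma P_nonempty: "P \<noteq> {}" using dim_P by auto

lemma face_surj:
  assumes F: "F face_of P" "aff_dim F = int l" "l \<le> k"
  shows "proj l ` (affine hull F) = span (e ` {1..l})"
proof -
  have "F \<noteq> {}" using F(2) by auto
  then have "general_position_affine e (affine hull F)"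
    using general F by (auto simp: k_general_position_def)
  then obtain l' where "aff_dim F = int l'" "coord_proj e (DIM('a) - l') ` (affine hull F) = span (e ` {1..l'})"
    by (auto simp: general_position_affine_def)
  then show ?thesis using F k_le by (simp add: coord_proj_eq)
qed

lemma face_lattice_surj:
  assumes F: "F face_of P" "aff_dim F = int l" "l < k" and y: "\<And>i. i \<in> {1..l} \<Longrightarrow> coord i y \<in> \<int>"
  obtains x where "x \<in> affine hull F" "x \<in> \<Lambda>" "\<And>i. i \<in> {1..l} \<Longrightarrow> coord i x = coord i y"
proof -
  have "F \<noteq> {}" using F(2) by auto
  then have "integral_affine \<Lambda> e (affine hull F)"
    using integral F by (auto simp: k_integral_def)
  then obtain l' where l': "aff_dim F = int l'"
      "coord_proj e (DIM('a) - l') ` (affine hull F \<inter> \<Lambda>) = lattice_gen e {1..l'}"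
    by (auto simp: integral_affine_def)
  have l: "l \<le> DIM('a)" using F(3) k_le by simp
  then have *: "proj l ` (affine hull F \<inter> \<Lambda>) = lattice_gen e {1..l}"
    using l' F(2) by (simp add: coord_proj_eq)
  have "proj l y \<in> lattice_gen e {1..l}"
    using l y by (subst lattice_gen_iff) (auto simp: coord_proj)
  then have "proj l y \<in> proj l ` (affine hull F \<inter> \<Lambda>)" by (simp add: *)
  then obtain x where "x \<in> affine hull F" "x \<in> \<Lambda>" "proj l x = proj l y" by auto
  then show thesis using that l by (auto simp: proj_eq_iff)
qed

text \<open>A linear map onto a space of the same dimension is injective.\<close>

lemma face_inj:
  assumes F: "F face_of P" "aff_dim F = int l" "l \<le> k"
    and x: "x \<in> affine hull F" "x' \<in> affine hull F" "\<And>i. i \<in> {1..l} \<Longrightarrow> coord i x = coord i x'"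
  shows "x = x'"
proof (rule ccontr)
  assume "x \<noteq> x'"
  have l: "l \<le> DIM('a)" using F(3) k_le by simp
  define U where "U = (\<lambda>y. y - x') ` (affine hull F)"
  have U: "subspace U" "dim U = l"
    using affine_diffs_subspace_subtract[of "affine hull F" x'] aff_dim_dim_affine_diffs[of "affine hull F" x'] x(2) F(2)
    by (auto simp: U_def)
  have "span (e ` {1..l}) \<subseteq> proj l ` U"
  proof
    fix z assume z: "z \<in> span (e ` {1..l})"
    then have "z + proj l x' \<in> span (e ` {1..l})" using proj_in_span by (rule span_add)
    then obtain y where "y \<in> affine hull F" "proj l y = z + proj l x'" using face_surj[OF F] by (metis imageE)
    then have "proj l (y - x') = z" "y - x' \<in> U" by (auto simp: linear_diff[OF proj_linear] U_def)
    then show "z \<in> proj l ` U" by blast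
  qed
  then have 1: "l \<le> dim (proj l ` U)" using dim_span_e[OF l] by (metis dim_subset)
  have v: "x - x' \<in> U" "x - x' \<noteq> 0" "proj l (x - x') = 0"
    using x \<open>x \<noteq> x'\<close> by (auto simp: U_def proj_def)
  obtain C where C: "{x - x'} \<subseteq> C" "C \<subseteq> U" "independent C" "U \<subseteq> span C"
    using maximal_independent_subset_extend[of "{x - x'}" U] v by (auto simp: independent_insert)
  have finC: "finite C" using C(3) by (rule independent_imp_finite)
  have "card C = l" using C U(2) by (metis basis_card_eq_dim)
  have "proj l ` U \<subseteq> span (proj l ` (C - {x - x'}))"
  proof -
    have "proj l ` U \<subseteq> proj l ` span C" using C(4) by auto
    also have "\<dots> = span (proj l ` C)" by (rule linear_span_image[OF proj_linear, symmetric])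
    also have "\<dots> \<subseteq> span (proj l ` (C - {x - x'}))"
    proof (rule span_minimal)
      show "proj l ` C \<subseteq> span (proj l ` (C - {x - x'}))"
      proof (rule image_subsetI)
        fix z assume "z \<in> C"
        then show "proj l z \<in> span (proj l ` (C - {x - x'}))"
          using v(3) by (cases "z = x - x'") (auto intro: span_base span_zero)
      qed
    qed (rule subspace_span)
    finally show ?thesis .
  qed
  then have "dim (proj l ` U) \<le> dim (proj l ` (C - {x - x'}))" by (metis dim_span dim_subset)
  also have "\<dots> \<le> card (proj l ` (C - {x - x'}))" using finC by (intro dim_le_card') auto
  also have "\<dots> \<le> card (C - {x - x'})" using finC by (intro card_image_le) auto
  also have "\<dots> < card C" using finC C(1) by (intro psubset_card_mono) auto
  finally show False using 1 \<open>card C = l\<close> by simp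
qed

text \<open>General position is assumed only up to dimension \<open>k\<close>, while
  \<open>F\<close> may be larger. A subface of dimension \<open>Suc j \<le> k\<close> supplies the
  direction, because its hull projects onto the span of the first \<open>Suc j\<close> basis
  vectors.\<close>

lemma face_direction:
  assumes F: "F face_of P" "aff_dim F = int l" "j < l" "j < k"
  obtains x x' where "x \<in> affine hull F" "x' \<in> affine hull F" "x - x' \<in> zero_upto j" "coord (Suc j) (x - x') = 1"
proof -
  have "polytope F" using F(1) P face_of_polytope_polytope by blast
  then obtain G where G: "G face_of F" "aff_dim G = int (Suc j)"
    using polytope_has_face[of F "Suc j"] F by auto
  have GP: "G face_of P" using G(1) F(1) face_of_trans by blast
  have Sj: "Suc j \<le> k" "Suc j \<le> DIM('a)" using F(4) k_le by auto
  have "G \<noteq> {}" using G(2) by auto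
  then obtain x' where x': "x' \<in> affine hull G" by (meson all_not_in_conv hull_inc)
  have "e (Suc j) + proj (Suc j) x' \<in> span (e ` {1..Suc j})"
    by (rule span_add[OF span_base proj_in_span]) auto
  then obtain x where x: "x \<in> affine hull G" "proj (Suc j) x = e (Suc j) + proj (Suc j) x'"
    using face_surj[OF GP G(2) Sj(1)] by (metis imageE)
  have c: "coord i x = coord i (e (Suc j)) + coord i x'" if "i \<in> {1..Suc j}" for i
    using arg_cong[OF x(2), of "coord i"] that Sj(2) by (simp add: coord_proj)
  have "affine hull G \<subseteq> affine hull F" using face_of_imp_subset[OF G(1)] by (rule hull_mono)
  moreover have "x - x' \<in> zero_upto j" using c Sj(2) by (auto simp: zero_upto_def coord_e)
  moreover have "coord (Suc j) (x - x') = 1" using c[of "Suc j"] Sj(2) by (simp add: coord_e)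
  ultimately show thesis using that x(1) x' by blast
qed

section \<open>The direction space of \<open>P\<close>, and the faces of its slices\<close>

abbreviation L :: "'a set" where "L \<equiv> lin_hull P"

lemma L_props: "subspace L" "x \<in> affine hull P \<Longrightarrow> y \<in> affine hull P \<Longrightarrow> x - y \<in> L"
  "x \<in> affine hull P \<Longrightarrow> v \<in> L \<Longrightarrow> x + v \<in> affine hull P"
proof -
  have "affine hull P \<noteq> {}" using P_nonempty by simp
  from theI'[OF affine_parallel_subspace[OF affine_affine_hull this]]
  have L: "subspace L" "affine_parallel (affine hull P) L" unfolding lin_hull_def by auto
  then obtain a where a: "L = (\<lambda>x. a + x) ` (affine hull P)" by (auto simp: affine_parallel_def)
  show "subspace L" by (rule L(1))
  show "x - y \<in> L" if "x \<in> affine hull P" "y \<in> affine hull P" for x y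
  proof -
    have "a + x \<in> L" "a + y \<in> L" using that a by blast+
    then have "(a + x) - (a + y) \<in> L" by (rule subspace_diff[OF L(1)])
    then show ?thesis by simp
  qed
  show "x + v \<in> affine hull P" if "x \<in> affine hull P" "v \<in> L" for x v
  proof -
    have "a + x \<in> L" using that(1) a by blast
    then have "(a + x) + v \<in> L" using that(2) by (rule subspace_add[OF L(1)])
    then obtain z where "z \<in> affine hull P" "a + x + v = a + z" using a by auto
    then show ?thesis by (simp add: add.assoc)
  qed
qed

lemma dim_L: "dim L = d"
proof -
  obtain p where p: "p \<in> P" using P_nonempty by auto
  have pa: "p \<in> affine hull P" using p by (rule hull_inc)
  have "L = (\<lambda>x. x - p) ` (affine hull P)"
  proof (intro equalityI subsetI)
    fix v assume "v \<in> L"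
    then have "p + v \<in> affine hull P" using L_props(3) pa by blast
    then show "v \<in> (\<lambda>x. x - p) ` (affine hull P)" by (intro image_eqI[of _ _ "p + v"]) auto
  qed (use L_props(2) pa in auto)
  then show ?thesis using aff_dim_dim_affine_diffs[of "affine hull P" p] pa dim_P by simp
qed

text \<open>Labelled by a point \<open>u\<close> rather than by its projection, since a lattice
  point of the affine hull of \<open>P\<close> later serves as the origin for heights.\<close>

definition slice :: "nat \<Rightarrow> 'a \<Rightarrow> 'a set" where
  "slice j u = {x \<in> P. x - u \<in> zero_upto j}"

lemma slice_coord: "x \<in> slice j u \<Longrightarrow> i \<in> {1..j} \<Longrightarrow> coord i x = coord i u"
  by (simp add: slice_def zero_upto_def)

lemma coord_slice_eq: "j \<le> DIM('a) \<Longrightarrow> coord_slice e (DIM('a) - j) (proj j u) P = slice j u"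
  by (auto simp: coord_slice_def coord_proj_eq slice_def zero_upto_def proj_eq_iff)

lemma slice_polytope: "polytope (slice j u)"
proof -
  have "affine {x. x - u \<in> zero_upto j}"
  proof -
    have "{x. x - u \<in> zero_upto j} = (\<lambda>v. u + v) ` zero_upto j"
    proof (intro equalityI subsetI)
      fix x assume "x \<in> {x. x - u \<in> zero_upto j}"
      then show "x \<in> (\<lambda>v. u + v) ` zero_upto j" by (intro image_eqI[of _ _ "x - u"]) auto
    qed auto
    then show ?thesis
      using subspace_imp_affine[OF subspace_zero_upto] by (simp add: affine_translation[symmetric])
  qed
  then have "polytope (P \<inter> {x. x - u \<in> zero_upto j})"
    using P by (intro polytope_Int_polyhedron affine_imp_polyhedron)
  moreover have "slice j u = P \<inter> {x. x - u \<in> zero_upto j}" by (auto simp: slice_def)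
  ultimately show ?thesis by simp
qed

text \<open>If \<open>w\<close> lies in a face of the slice and in the relative interior of a face \<open>F\<close> of \<open>P\<close>, then the
  face of the slice contains a segment around \<open>w\<close> in every direction of \<open>F\<close> along the slice.\<close>

lemma slice_face_segment:
  assumes E: "E face_of slice j u" "w \<in> E" and F: "F face_of P" "w \<in> rel_interior F"
    and x: "x \<in> affine hull F" "x' \<in> affine hull F" "x - x' \<in> zero_upto j" "x \<noteq> x'"
  obtains \<epsilon> where "\<epsilon> > 0" "w + \<epsilon> *\<^sub>R (x - x') \<in> E" "w - \<epsilon> *\<^sub>R (x - x') \<in> E"
proof -
  obtain \<epsilon> where \<epsilon>: "\<epsilon> > 0" "w + \<epsilon> *\<^sub>R (x - x') \<in> F" "w - \<epsilon> *\<^sub>R (x - x') \<in> F"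
    using rel_interior_direction[OF F(2) x(1,2)] .
  have "w \<in> slice j u" using E face_of_imp_subset by blast
  then have wu: "w - u \<in> zero_upto j" by (simp add: slice_def)
  have z: "\<epsilon> *\<^sub>R (x - x') \<in> zero_upto j" using subspace_zero_upto x(3) by (rule subspace_scale)
  have "(w - u) + \<epsilon> *\<^sub>R (x - x') \<in> zero_upto j" "(w - u) - \<epsilon> *\<^sub>R (x - x') \<in> zero_upto j"
    using subspace_add[OF subspace_zero_upto wu z] subspace_diff[OF subspace_zero_upto wu z] .
  then have in_slice: "w + \<epsilon> *\<^sub>R (x - x') \<in> slice j u" "w - \<epsilon> *\<^sub>R (x - x') \<in> slice j u"
    using \<epsilon> face_of_imp_subset[OF F(1)] by (auto simp: slice_def algebra_simps)
  have ne: "w + \<epsilon> *\<^sub>R (x - x') \<noteq> w - \<epsilon> *\<^sub>R (x - x')"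
  proof
    assume "w + \<epsilon> *\<^sub>R (x - x') = w - \<epsilon> *\<^sub>R (x - x')"
    then have "(2 * \<epsilon>) *\<^sub>R (x - x') = 0" by (simp add: algebra_simps flip: scaleR_2)
    then show False using \<epsilon>(1) x(4) by simp
  qed
  have "w = midpoint (w + \<epsilon> *\<^sub>R (x - x')) (w - \<epsilon> *\<^sub>R (x - x'))"
    by (simp add: midpoint_def scaleR_2[symmetric])
  then have "w \<in> open_segment (w + \<epsilon> *\<^sub>R (x - x')) (w - \<epsilon> *\<^sub>R (x - x'))"
    using ne by (metis midpoint_in_open_segment)
  then show thesis using face_ofD[OF E(1) _ in_slice E(2)] \<epsilon>(1) that by blast
qed

text \<open>A face \<open>F\<close> with \<open>v\<close> in its relative interior has dimension
  \<open>l \<le> j\<close>, as otherwise it would contain a direction along the slice. Since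
  \<open>j < k\<close>, integrality gives a lattice point of its hull with the same first
  \<open>l\<close> coordinates as \<open>v\<close>, and injectivity of the projection identifies the
  two.\<close>

lemma slice_vertex_in_lattice:
  assumes j: "j < k" and u: "u \<in> \<Lambda>" and v: "v extreme_point_of slice j u"
  shows "v \<in> \<Lambda>"
proof -
  have vs: "{v} face_of slice j u" using v by (simp add: face_of_singleton)
  then have vQ: "v \<in> slice j u" using face_of_imp_subset by blast
  then have vP: "v \<in> P" by (simp add: slice_def)
  obtain F where F: "F face_of P" "v \<in> rel_interior F"
    using polytope_point_in_rel_interior_face[OF P vP] .
  have vF: "v \<in> F" using F(2) rel_interior_subset by blast
  then have "aff_dim F \<ge> 0" by (metis aff_dim_negative_iff empty_iff not_less)
  then obtain l where l: "aff_dim F = int l" using nonneg_int_cases by blast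
  have "l \<le> j"
  proof (rule ccontr)
    assume "\<not> l \<le> j"
    then obtain x x' where x: "x \<in> affine hull F" "x' \<in> affine hull F" "x - x' \<in> zero_upto j" "coord (Suc j) (x - x') = 1"
      using face_direction[OF F(1) l _ j] by auto
    have "x \<noteq> x'" using x(4) by auto
    then obtain \<epsilon> where "\<epsilon> > 0" "v + \<epsilon> *\<^sub>R (x - x') \<in> {v}"
      using slice_face_segment[OF vs _ F x(1-3)] by blast
    then show False using \<open>x \<noteq> x'\<close> by simp
  qed
  then have "l < k" using j by simp
  have c: "coord i v = coord i u" if "i \<in> {1..l}" for i
    using slice_coord[OF vQ, of i] that \<open>l \<le> j\<close> by auto
  have int: "coord i v \<in> \<int>" if "i \<in> {1..l}" for i
    using c[OF that] u that \<open>l < k\<close> k_le by (auto simp: \<Lambda>_iff)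
  obtain x where x: "x \<in> affine hull F" "x \<in> \<Lambda>" "\<And>i. i \<in> {1..l} \<Longrightarrow> coord i x = coord i v"
    using face_lattice_surj[OF F(1) l \<open>l < k\<close>, of v] int by blast
  have "x = v"
    using face_inj[OF F(1) l _ x(1) hull_inc[OF vF] x(3)] \<open>l < k\<close> by simp
  then show ?thesis using x(2) by simp
qed

text \<open>Let \<open>F\<close> be a face of \<open>P\<close> with a relative interior point of
  \<open>E\<close> in its own relative interior. If its dimension is at most \<open>j\<close>, the
  fixed coordinates determine its points and \<open>E\<close> would be a single point. Otherwise
  \<open>F\<close> has a direction along the slice in which \<open>coord (Suc j)\<close> varies, and
  \<open>E\<close> contains a segment in that direction.\<close>

lemma slice_edge_nonconstant:
  assumes j: "j < k" and E: "E face_of slice j u" "aff_dim E = 1"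
  shows "\<not> coord (Suc j) constant_on E"
proof
  assume const: "coord (Suc j) constant_on E"
  have "convex E" using E(1) by (rule face_of_imp_convex)
  moreover have "E \<noteq> {}" using E(2) by auto
  ultimately obtain w where w: "w \<in> rel_interior E" using rel_interior_eq_empty by blast
  then have wE: "w \<in> E" using rel_interior_subset by blast
  have EQ: "E \<subseteq> slice j u" using E(1) by (rule face_of_imp_subset)
  then have EP: "E \<subseteq> P" by (auto simp: slice_def)
  obtain F where F: "F face_of P" "w \<in> rel_interior F"
    using polytope_point_in_rel_interior_face[OF P] wE EP by blast
  have wF: "w \<in> F" using F(2) rel_interior_subset by blast
  then have "aff_dim F \<ge> 0" by (metis aff_dim_negative_iff empty_iff not_less)
  then obtain l where l: "aff_dim F = int l" using nonneg_int_cases by blast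
  show False
  proof (cases "l \<le> j")
    case True
    have "E \<subseteq> F" using subset_of_face_of[OF F(1) EP] w wF by blast
    have "x = w" if "x \<in> E" for x
    proof (rule face_inj[OF F(1) l])
      show "l \<le> k" using True j by simp
      show "x \<in> affine hull F" "w \<in> affine hull F" using that \<open>E \<subseteq> F\<close> wF by (auto intro: hull_inc)
      show "coord i x = coord i w" if "i \<in> {1..l}" for i
      proof -
        have "i \<in> {1..j}" "x \<in> slice j u" "w \<in> slice j u" using that True \<open>x \<in> E\<close> wE EQ by auto
        then show ?thesis by (simp only: slice_coord)
      qed
    qed
    then have "E = {w}" using wE by blast
    then show False using E(2) by simp
  next
    case False
    then obtain x x' where x: "x \<in> affine hull F" "x' \<in> affine hull F" "x - x' \<in> zero_upto j" "coord (Suc j) (x - x') = 1"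
      using face_direction[OF F(1) l _ j] by auto
    have "x \<noteq> x'" using x(4) by auto
    then obtain \<epsilon> where \<epsilon>: "\<epsilon> > 0" "w + \<epsilon> *\<^sub>R (x - x') \<in> E"
      using slice_face_segment[OF E(1) wE F x(1-3)] by blast
    then have "coord (Suc j) (w + \<epsilon> *\<^sub>R (x - x')) = coord (Suc j) w"
      using const wE unfolding constant_on_def by metis
    then show False using \<epsilon>(1) x(4) by (simp del: coord_diff)
  qed
qed

end

section \<open>Full rank of the sublattices and the induction over slices\<close>

lemma lattice_volume_nonneg: "0 \<le> lattice_volume \<Gamma> Q"
  by (simp add: lattice_volume_def Let_def)

context integral_polytope
begin

declare One_nat_def [simp del]

abbreviation sublattice :: "nat \<Rightarrow> 'a set" where
  "sublattice j \<equiv> L \<inter> \<Lambda> \<inter> zero_upto j"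

lemma vertex_in_lattice:
  assumes "v extreme_point_of P" shows "v \<in> \<Lambda>"
proof -
  have "slice 0 0 = P" by (simp add: slice_def zero_upto_0)
  moreover have "0 \<in> \<Lambda>" by (simp add: \<Lambda>_iff)
  ultimately show ?thesis using slice_vertex_in_lattice[of 0 0 v] k_pos assms by simp
qed

text \<open>A face \<open>G\<close> of dimension \<open>Suc j\<close> may have dimension
  \<open>k\<close>, where integrality is not assumed. Its vertices are lattice points nevertheless,
  and its facet \<open>H\<close> is integral: the vector is the difference of a vertex off the hull
  of \<open>H\<close> and a lattice point of that hull with the same first \<open>j\<close>
  coordinates. Its next coordinate is nonzero because the projection is injective on the hull of
  \<open>G\<close>.\<close>

lemma exists_lattice_vector:
  assumes j: "j < k"
  obtains z where "z \<in> sublattice j" "coord (Suc j) z \<noteq> 0"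
proof -
  obtain G where G: "G face_of P" "aff_dim G = int (Suc j)"
    using polytope_has_face[OF P, of "Suc j"] j k_less dim_P by auto
  have GP: "polytope G" using G(1) P face_of_polytope_polytope by blast
  obtain H where H: "H face_of G" "aff_dim H = int j"
    using polytope_has_face[OF GP, of j] G(2) by auto
  have HP: "H face_of P" using H(1) G(1) face_of_trans by blast
  have "\<exists>v. v extreme_point_of G \<and> v \<notin> affine hull H"
  proof (rule ccontr)
    assume "\<not> ?thesis"
    then have "convex hull {v. v extreme_point_of G} \<subseteq> affine hull H"
      by (intro hull_minimal affine_imp_convex affine_affine_hull) auto
    moreover have "G = convex hull {v. v extreme_point_of G}"
      using GP by (intro Krein_Milman_Minkowski polytope_imp_compact polytope_imp_convex)
    ultimately have "aff_dim G \<le> aff_dim H" by (metis aff_dim_affine_hull aff_dim_subset)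
    then show False using G(2) H(2) by simp
  qed
  then obtain v where v: "v extreme_point_of G" "v \<notin> affine hull H" by blast
  have "v extreme_point_of P" using v(1) G(1) extreme_point_of_face by blast
  then have v\<Lambda>: "v \<in> \<Lambda>" by (rule vertex_in_lattice)
  have "coord i v \<in> \<int>" if "i \<in> {1..j}" for i using v\<Lambda> that j k_le by (auto simp: \<Lambda>_iff)
  then obtain x where x: "x \<in> affine hull H" "x \<in> \<Lambda>" "\<And>i. i \<in> {1..j} \<Longrightarrow> coord i x = coord i v"
    using face_lattice_surj[OF HP H(2) j, of v] by blast
  have vG: "v \<in> affine hull G" using v(1) by (auto simp: extreme_point_of_def intro: hull_inc)
  have xG: "x \<in> affine hull G" using x(1) hull_mono[OF face_of_imp_subset[OF H(1)]] by blast
  have GPh: "affine hull G \<subseteq> affine hull P" using face_of_imp_subset[OF G(1)] by (rule hull_mono)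
  have "v - x \<in> L" using vG xG GPh by (intro L_props(2)) auto
  then have "v - x \<in> sublattice j" using \<Lambda>_diff[OF v\<Lambda> x(2)] x(3) by (auto simp: zero_upto_def)
  moreover have "coord (Suc j) (v - x) \<noteq> 0"
  proof
    assume "coord (Suc j) (v - x) = 0"
    then have "coord i v = coord i x" if "i \<in> {1..Suc j}" for i
      using that x(3)[of i] by (cases "i = Suc j") auto
    then have "v = x" using face_inj[OF G _ vG xG] j by auto
    then show False using v(2) x(1) by simp
  qed
  ultimately show thesis by (rule that)
qed

text \<open>Full rank is needed for the slices to lie in translates of the span of their lattice,
  where \<open>lattice_volume\<close> is meaningful. At \<open>j = 0\<close> it holds because the
  vertices of \<open>P\<close> are lattice points that affinely span its hull; in the step, removing
  \<open>w\<close> from the basis leaves exactly the vectors whose next coordinate vanishes.\<close>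

lemma span_sublattice:
  assumes "j \<le> k" shows "span (sublattice j) = L \<inter> zero_upto j"
  using assms
proof (induction j)
  case 0
  have "L \<subseteq> span (L \<inter> \<Lambda>)"
  proof
    fix x assume x: "x \<in> L"
    let ?V = "{v. v extreme_point_of P}"
    have PV: "P = convex hull ?V"
      using P by (intro Krein_Milman_Minkowski polytope_imp_compact polytope_imp_convex)
    then obtain p where p: "p \<in> ?V" using P_nonempty by fastforce
    have hull: "affine hull P = affine hull ?V" using PV by (metis affine_hull_convex_hull)
    have V: "v \<in> affine hull P" if "v \<in> ?V" for v using that hull by (simp add: hull_inc)
    have "p + x \<in> affine hull ?V" using L_props(3)[OF V[OF p] x] hull by simp
    then have "x \<in> span ((\<lambda>v. - p + v) ` (?V - {p}))"
      unfolding affine_hull_span2[OF p] by auto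
    moreover have "(\<lambda>v. - p + v) ` (?V - {p}) \<subseteq> L \<inter> \<Lambda>"
      using L_props(2)[OF V V[OF p]] \<Lambda>_diff vertex_in_lattice p by force
    ultimately show "x \<in> span (L \<inter> \<Lambda>)" using span_mono by blast
  qed
  moreover have "span (L \<inter> \<Lambda>) \<subseteq> L" using L_props(1) by (intro span_minimal) auto
  ultimately show ?case by (auto simp: zero_upto_0)
next
  case (Suc j)
  have IH: "span (sublattice j) = L \<inter> zero_upto j" using Suc by simp
  obtain z where z: "z \<in> sublattice j" "coord (Suc j) z \<noteq> 0" using exists_lattice_vector[of j] Suc.prems by auto
  obtain B where B: "int_basis B {x \<in> sublattice j. coord (Suc j) x = 0}"
  proof -
    have "Suc j \<le> DIM('a)" using Suc.prems k_le by simp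
    then obtain B where "int_basis B (sublattice (Suc j))" using sublattice_int_basis[OF L_props(1)] by blast
    moreover have "sublattice (Suc j) = {x \<in> sublattice j. coord (Suc j) x = 0}" by (auto simp: zero_upto_Suc)
    ultimately show thesis using that by simp
  qed
  have diff: "x - y \<in> sublattice j" if "x \<in> sublattice j" "y \<in> sublattice j" for x y
    using that L_props(1) subspace_zero_upto by (auto intro: subspace_diff \<Lambda>_diff)
  have int: "coord (Suc j) x \<in> \<int>" if "x \<in> sublattice j" for x
    using that Suc.prems k_le by (auto simp: \<Lambda>_iff)
  obtain w where w: "w \<in> sublattice j" "coord (Suc j) w \<noteq> 0" "int_basis (insert w B) (sublattice j)"
    using int_basis_extend[OF B diff coord_linear int z] by metis
  have B0: "coord (Suc j) b = 0" if "b \<in> span B" for b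
    by (rule linear_eq_0_on_span[OF coord_linear _ that]) (use int_basis_subset[OF B] in auto)
  have "L \<inter> zero_upto (Suc j) \<subseteq> span B"
  proof
    fix x assume "x \<in> L \<inter> zero_upto (Suc j)"
    then have "x \<in> L \<inter> zero_upto j" and x0: "coord (Suc j) x = 0" by (auto simp: zero_upto_Suc)
    then have "x \<in> span (insert w B)" using IH int_basis_span[OF w(3)] by simp
    then obtain a where a: "x - a *\<^sub>R w \<in> span B" by (auto simp: span_breakdown_eq)
    have "a = 0" using B0[OF a] x0 w(2) by simp
    then show "x \<in> span B" using a by simp
  qed
  moreover have "sublattice (Suc j) = {x \<in> sublattice j. coord (Suc j) x = 0}" by (auto simp: zero_upto_Suc)
  then have "span B = span (sublattice (Suc j))" using int_basis_span[OF B] by (simp only:)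
  moreover have "span (sublattice (Suc j)) \<subseteq> L \<inter> zero_upto (Suc j)"
    using L_props(1) subspace_zero_upto by (intro span_minimal subspace_inter) auto
  ultimately show ?case by simp
qed

text \<open>Otherwise \<open>proj j\<close> would embed the \<open>d\<close>-dimensional
  \<open>L\<close> into a space of dimension \<open>j\<close>. Applied at
  \<open>Suc j \<le> k\<close>, this is how \<open>k < d\<close> makes the directions of the
  sections nontrivial.\<close>

lemma L_zero_upto_nontrivial:
  assumes "j < d" "j \<le> DIM('a)" shows "\<not> L \<inter> zero_upto j \<subseteq> {0}"
proof
  assume triv: "L \<inter> zero_upto j \<subseteq> {0}"
  have "inj_on (proj j) (span L)"
  proof (rule inj_onI)
    fix x y assume xy: "x \<in> span L" "y \<in> span L" "proj j x = proj j y"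
    have "x \<in> L" "y \<in> L" using xy L_props(1) by (simp_all add: span_eq_iff[THEN iffD2])
    then have "x - y \<in> L \<inter> zero_upto j"
      using xy(3) assms(2) L_props(1) by (auto simp: proj_eq_iff zero_upto_def subspace_diff)
    then show "x = y" using triv by auto
  qed
  then have "dim (proj j ` L) = d" using dim_image_eq[OF proj_linear] dim_L by blast
  moreover have "dim (proj j ` L) \<le> dim (span (e ` {1..j}))"
    using proj_in_span by (intro dim_subset) auto
  ultimately show False using dim_span_e[OF assms(2)] assms(1) by simp
qed

text \<open>The index set consists of the projections of the progression of points \<open>u\<close>
  plus an integral multiple of \<open>w\<close>, and the slices through these points are the
  sections of \<open>slice j u\<close> at integral heights relative to \<open>u\<close>.\<close>

lemma slice_volume_step:
  assumes j: "j < k" and u: "u \<in> affine hull P \<inter> \<Lambda>"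
  shows "((\<lambda>z. lattice_volume (sublattice (Suc j)) (coord_slice e (DIM('a) - Suc j) z P)) has_sum
      lattice_volume (sublattice j) (coord_slice e (DIM('a) - j) (proj j u) P))
    {z \<in> proj (Suc j) ` (affine hull P \<inter> \<Lambda>). proj j z = proj j u}"
proof -
  have jD: "j \<le> DIM('a)" "Suc j \<le> DIM('a)" using j k_le by auto
  let ?Q = "slice j u"
  let ?c = "coord (Suc j)"
  have G': "sublattice (Suc j) = {x \<in> sublattice j. ?c x = 0}" by (auto simp: zero_upto_Suc)
  obtain B where B': "int_basis B (sublattice (Suc j))" using sublattice_int_basis[OF L_props(1) jD(2)] by blast
  then have B: "int_basis B {x \<in> sublattice j. ?c x = 0}" by (simp only: G')
  obtain z where z: "z \<in> sublattice j" "?c z \<noteq> 0" using exists_lattice_vector[OF j] .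
  have diff: "x - y \<in> sublattice j" if "x \<in> sublattice j" "y \<in> sublattice j" for x y
    using that L_props(1) subspace_zero_upto by (auto intro: subspace_diff \<Lambda>_diff)
  have int: "?c x \<in> \<int>" if "x \<in> sublattice j" for x using that jD by (auto simp: \<Lambda>_iff)
  obtain w where w: "w \<in> sublattice j" "?c w \<noteq> 0" "int_basis (insert w B) (sublattice j)"
      and mult: "\<And>x. x \<in> sublattice j \<Longrightarrow> \<exists>n::int. ?c x = of_int n * ?c w"
    using int_basis_extend[OF B diff coord_linear int z] by metis
  have spB: "span B = L \<inter> zero_upto (Suc j)"
    using int_basis_span[OF B'] span_sublattice[of "Suc j"] j by simp
  have spwB: "span (insert w B) = L \<inter> zero_upto j"
    using int_basis_span[OF w(3)] span_sublattice[of j] j by simp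
  \<comment> \<open>On \<open>sublattice j\<close> the coordinate \<open>?c\<close> takes exactly
    the integral multiples of \<open>?c w\<close>, which may differ from 1; the division makes these
    heights the integers.\<close>
  define \<psi> where "\<psi> x = ?c x / ?c w" for x
  have const: "\<psi> constant_on E \<Longrightarrow> ?c constant_on E" for E
    using w(2) unfolding constant_on_def \<psi>_def by (metis nonzero_divide_eq_eq)
  interpret sp: sliced_polytope ?Q B w u \<psi>
  proof (rule sliced_polytope.intro)
    show "polytope ?Q" by (rule slice_polytope)
    show "independent (insert w B)" using w(3) by (simp add: int_basis_def)
    show "w \<notin> B"
    proof
      assume "w \<in> B"
      then have "w \<in> zero_upto (Suc j)" using spB span_base by blast
      then show False using w(2) by (simp add: zero_upto_Suc)
    qed
    show "B \<noteq> {}"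
      using L_zero_upto_nontrivial[of "Suc j"] spB j k_less jD by auto
    show "linear \<psi>" unfolding \<psi>_def by (rule linearI) (simp_all add: add_divide_distrib)
    show "\<psi> w = 1" using w(2) by (simp add: \<psi>_def)
    show "\<psi> b = 0" if "b \<in> B" for b
    proof -
      have "b \<in> zero_upto (Suc j)" using that spB span_base by blast
      then show ?thesis by (simp add: \<psi>_def zero_upto_Suc)
    qed
    show "x - u \<in> span (insert w B)" if "x \<in> ?Q" for x
      using that u L_props(2) unfolding spwB by (auto simp: slice_def intro: hull_inc)
    show "\<not> \<psi> constant_on E" if "E face_of ?Q" "aff_dim E = 1" for E
      using slice_edge_nonconstant[OF j that] const by blast
  qed
  have "\<psi> v - \<psi> u \<in> \<int>" if v: "v extreme_point_of ?Q" for v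
  proof -
    have "v \<in> ?Q" using v by (simp add: extreme_point_of_def)
    then have "v - u \<in> sublattice j"
      using u L_props(2) \<Lambda>_diff[OF slice_vertex_in_lattice[OF j _ v], of u]
      by (auto simp: slice_def intro: hull_inc)
    then obtain n :: int where "?c (v - u) = of_int n * ?c w" using mult by blast
    then have "\<psi> v - \<psi> u = of_int n" using w(2) by (simp add: \<psi>_def diff_divide_distrib[symmetric])
    then show ?thesis by simp
  qed
  note main = sp.sum_integer_sections[OF this]
  let ?g = "\<lambda>n::int. proj (Suc j) (u + of_int n *\<^sub>R w)"
  have unw: "u + of_int n *\<^sub>R w \<in> affine hull P \<inter> \<Lambda>" for n :: int
    using u w(1) by (auto intro!: L_props(3) \<Lambda>_add \<Lambda>_scale subspace_scale[OF L_props(1)])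
  have wz: "coord i w = 0" if "i \<in> {1..j}" for i using w(1) that by (simp add: zero_upto_def)
  have bij: "bij_betw ?g UNIV {z \<in> proj (Suc j) ` (affine hull P \<inter> \<Lambda>). proj j z = proj j u}"
    unfolding bij_betw_def
  proof (intro conjI)
    show "inj ?g"
    proof (rule injI)
      fix m n :: int assume "?g m = ?g n"
      then have "?c (u + of_int m *\<^sub>R w) = ?c (u + of_int n *\<^sub>R w)"
        unfolding proj_eq_iff[OF jD(2)] by (rule bspec) simp
      then show "m = n" using w(2) by simp
    qed
    show "range ?g = {z \<in> proj (Suc j) ` (affine hull P \<inter> \<Lambda>). proj j z = proj j u}"
    proof (intro equalityI subsetI)
      fix z assume "z \<in> range ?g"
      then obtain n :: int where n: "z = ?g n" by blast
      have "proj j z = proj j (u + of_int n *\<^sub>R w)" unfolding n using jD by (intro proj_proj) auto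
      also have "\<dots> = proj j u" unfolding proj_eq_iff[OF jD(1)] using wz by simp
      finally show "z \<in> {z \<in> proj (Suc j) ` (affine hull P \<inter> \<Lambda>). proj j z = proj j u}"
        using unw n by blast
    next
      fix z assume "z \<in> {z \<in> proj (Suc j) ` (affine hull P \<inter> \<Lambda>). proj j z = proj j u}"
      then obtain x where x: "x \<in> affine hull P" "x \<in> \<Lambda>" "z = proj (Suc j) x" "proj j z = proj j u" by blast
      have "proj j x = proj j u" using x(3,4) jD by (simp add: proj_proj)
      then have eq: "coord i x = coord i u" if "i \<in> {1..j}" for i
        using that by (simp add: proj_eq_iff[OF jD(1)])
      then have "x - u \<in> sublattice j"
        using x u L_props(2) \<Lambda>_diff by (auto simp: zero_upto_def)
      then obtain n :: int where n: "?c (x - u) = of_int n * ?c w" using mult by blast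
      have "coord i x = coord i (u + of_int n *\<^sub>R w)" if "i \<in> {1..Suc j}" for i
      proof (cases "i = Suc j")
        case True then show ?thesis using n by simp
      next
        case False
        then have "i \<in> {1..j}" using that by auto
        then show ?thesis using eq wz by simp
      qed
      then have "z = ?g n" unfolding x(3) proj_eq_iff[OF jD(2)] by blast
      then show "z \<in> range ?g" by blast
    qed
  qed
  have cl: "closed (slice i y)" for i y using slice_polytope by (rule polytope_imp_closed)
  have total: "lattice_volume (sublattice j) (coord_slice e (DIM('a) - j) (proj j u) P) =
      enn2real (flat_integral (insert w B) (indicator ?Q) u)"
    unfolding coord_slice_eq[OF jD(1)] by (rule lattice_volume_eq[OF w(3) cl sp.Qsp])
  have term_eq: "lattice_volume (sublattice (Suc j)) (coord_slice e (DIM('a) - Suc j) (?g n) P) =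
      enn2real (sp.section_volume (of_int n))" for n :: int
  proof -
    let ?q = "u + of_int n *\<^sub>R w"
    have in_sp: "x - ?q \<in> span B" if "x \<in> slice (Suc j) ?q" for x
      using that unw[of n] L_props(2) unfolding spB by (auto simp: slice_def intro: hull_inc)
    have "lattice_volume (sublattice (Suc j)) (slice (Suc j) ?q) =
        enn2real (flat_integral B (indicator (slice (Suc j) ?q)) ?q)"
      by (rule lattice_volume_eq[OF B' cl in_sp])
    also have "flat_integral B (indicator (slice (Suc j) ?q)) ?q = flat_integral B (indicator ?Q) ?q"
    proof (rule flat_integral_cong)
      fix x assume "x - ?q \<in> span B"
      then have xq: "x - ?q \<in> zero_upto (Suc j)" by (simp add: spB)
      then have "x - ?q \<in> zero_upto j" by (simp add: zero_upto_Suc)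
      then have "x - u \<in> zero_upto j" using wz by (simp add: zero_upto_def)
      then show "(indicator (slice (Suc j) ?q) x :: ennreal) = indicator ?Q x"
        using xq by (simp add: indicator_def slice_def)
    qed
    finally show ?thesis unfolding coord_slice_eq[OF jD(2)] sp.section_volume_def .
  qed
  have "((\<lambda>n::int. lattice_volume (sublattice (Suc j)) (coord_slice e (DIM('a) - Suc j) (?g n) P)) has_sum
     lattice_volume (sublattice j) (coord_slice e (DIM('a) - j) (proj j u) P)) UNIV"
    unfolding total term_eq by (rule main)
  then show ?thesis by (subst (asm) has_sum_reindex_bij_betw[OF bij])
qed

text \<open>The lattice projections to \<open>Suc j\<close> coordinates split into fibres over those
  to \<open>j\<close> coordinates, and each fibre sums to one term of the previous stage. At
  \<open>j = 0\<close> the index set is a single point; it is nonempty because \<open>P\<close> has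
  a vertex and its vertices are lattice points.\<close>

lemma slice_volumes_sum:
  assumes "j \<le> k"
  shows "((\<lambda>y. lattice_volume (sublattice j) (coord_slice e (DIM('a) - j) y P)) has_sum
      lattice_volume (L \<inter> \<Lambda>) P) (proj j ` (affine hull P \<inter> \<Lambda>))"
  using assms
proof (induction j)
  case 0
  obtain v where "v extreme_point_of P"
    using extreme_point_exists_convex[OF polytope_imp_compact[OF P] polytope_imp_convex[OF P] P_nonempty] by blast
  then have "v \<in> affine hull P \<inter> \<Lambda>"
    using vertex_in_lattice by (auto simp: extreme_point_of_def intro: hull_inc)
  then have img: "proj 0 ` (affine hull P \<inter> \<Lambda>) = {0}" by (auto simp: proj_def)
  have "coord_slice e (DIM('a) - 0) 0 P = P"
    using coord_slice_eq[of 0 0] by (simp add: proj_def slice_def zero_upto_0)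
  moreover have "((\<lambda>y. lattice_volume (sublattice 0) (coord_slice e (DIM('a) - 0) y P)) has_sum
      (\<Sum>y\<in>{0}. lattice_volume (sublattice 0) (coord_slice e (DIM('a) - 0) y P))) {0}"
    by (rule has_sum_finite) simp
  ultimately show ?case unfolding img by (simp add: zero_upto_0)
next
  case (Suc j)
  let ?S = "\<lambda>j. proj j ` (affine hull P \<inter> \<Lambda>)"
  let ?f = "\<lambda>j y. lattice_volume (sublattice j) (coord_slice e (DIM('a) - j) y P)"
  let ?B = "\<lambda>y. {z \<in> ?S (Suc j). proj j z = y}"
  have jk: "j < k" "Suc j \<le> DIM('a)" using Suc.prems k_le by auto
  have IH: "(?f j has_sum lattice_volume (L \<inter> \<Lambda>) P) (?S j)" using Suc by simp
  have step: "((\<lambda>z. ?f (Suc j) (snd (y, z))) has_sum ?f j y) (?B y)" if "y \<in> ?S j" for y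
    using slice_volume_step[OF jk(1)] that by auto
  have "((\<lambda>p. ?f (Suc j) (snd p)) has_sum lattice_volume (L \<inter> \<Lambda>) P) (Sigma (?S j) ?B)"
  proof (rule has_sum_SigmaI[OF step IH])
    \<comment> \<open>The terms are nonnegative, so convergence of the iterated sums gives
      summability over the union of the fibres.\<close>
    show "(\<lambda>p. ?f (Suc j) (snd p)) summable_on Sigma (?S j) ?B"
      by (rule summable_on_SigmaI[OF step has_sum_imp_summable[OF IH]])
        (auto intro: lattice_volume_nonneg)
  qed
  moreover have "bij_betw snd (Sigma (?S j) ?B) (?S (Suc j))"
    unfolding bij_betw_def
  proof (intro conjI equalityI subsetI)
    show "inj_on snd (Sigma (?S j) ?B)" by (auto simp: inj_on_def)
    fix z assume z: "z \<in> ?S (Suc j)"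
    then have "proj j z \<in> ?S j" using jk by (auto simp: proj_proj)
    then show "z \<in> snd ` (Sigma (?S j) ?B)" using z by (intro image_eqI[of _ _ "(proj j z, z)"]) auto
  qed auto
  ultimately show ?case by (subst (asm) has_sum_reindex_bij_betw)
qed

end

theorem theorem1p5:
  fixes \<Lambda> P :: "'a::euclidean_space set" and e :: "nat \<Rightarrow> 'a" and D d k :: nat
  assumes "DIM('a) = D"
    and "lattice_basis D e \<Lambda>"
    and "0 < k" and "k < d" and "d \<le> D"
    and "polytope P" and "aff_dim P = int d"
    and "k_integral \<Lambda> e (k - 1) P"
    and "k_general_position e k P"
  shows "((\<lambda>y. lattice_volume (lattice_gen e {k+1..D} \<inter> (lin_hull P \<inter> \<Lambda>))
                 (coord_slice e (D - k) y P))
          has_sum lattice_volume (lin_hull P \<inter> \<Lambda>) P)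
         (coord_proj e (D - k) ` (affine hull P \<inter> \<Lambda>))"
proof -
  interpret integral_polytope \<Lambda> e P d k
    by unfold_locales (use assms in simp_all)
  have "lattice_gen e {k+1..D} \<inter> (lin_hull P \<inter> \<Lambda>) = lin_hull P \<inter> \<Lambda> \<inter> zero_upto k"
    using lattice_gen_upper[OF k_le] assms(1) by auto
  moreover have "coord_proj e (D - k) = proj k" using coord_proj_eq[OF k_le] assms(1) by simp
  ultimately show ?thesis using slice_volumes_sum[of k] assms(1) by simp
qed

end
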